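(* $\mathsf{LinKaw}^*\subset\mathsf{Drop1}$.
   Context: Let $\mathcal{H}=\mathbb{Q}\langle x,y\rangle$, $\mathcal{H}^1=\mathbb{Q}+y\mathcal{H}$, $\mathcal{H}^0=\mathbb{Q}+y\mathcal{H}x$, $\mathcal{H}^{\ge2}=\mathbb{Q}+yx\,\mathbb{Q}\langle x,yx\rangle$, $e_k=yx^{k-1}$ (so words of $\mathcal{H}^1$ are the $e_{k_1}\cdots e_{k_r}$). Harmonic product $*$ on $\mathcal{H}^1$: $\mathbb{Q}$-bilinear, $w*1=1*w=w$, and $w_1e_{k_1}*w_2e_{k_2}=(w_1*w_2e_{k_2})e_{k_1}+(w_1e_{k_1}*w_2)e_{k_2}+(w_1*w_2)e_{k_1+k_2}$ for words $w_1,w_2$ and positive integers $k_1,k_2$. $\phi$ is the algebra automorphism of $\mathcal{H}$ with $\phi(x)=x+y$, $\phi(y)=-y$. Define $\mathsf{LinKaw}^*=\operatorname{span}_{\mathbb{Q}}\{(\phi(w_1*w_2)x)*w_3\mid w_1,w_2\in y\mathcal{H},\ w_3\in\mathcal{H}^{\ge2}\}$ and $\mathsf{Drop1}=\operatorname{span}_{\mathbb{Q}}\{w-\mathcal{D}(w)\mid w\in y\mathcal{H}x\}$, where $\mathcal{D}$ is defined as follows. Notation: $[n]=\{1,\dots,n\}$. For an index (tuple of positive integers) $\boldsymbol{c}=(c_1,\dots,c_r)$: $[r]^1_{\boldsymbol{c}}=\{i:c_i=1\}$, $[r]^{>1}_{\boldsymbol{c}}=\{i:c_i>1\}$; for $A\subset[r]$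 with $[r]\setminus A=\{i_1<\dots<i_t\}$, $\boldsymbol{c}_{(-A)}=(c_{i_1},\dots,c_{i_t})$ and for $B\subset[r]$, $\boldsymbol{c}_{(-A)}-\boldsymbol{\delta}_B=(c_{i_1}-\delta_{i_1\in B},\dots,c_{i_t}-\delta_{i_t\in B})$ ($\delta_{i\in B}=1$ if $i\in B$, else $0$). $A\subset[2s]$ is even-odd if (even $i\in A\Rightarrow i+1\in A$) and (odd $i\in A\Rightarrow i-1\in A$); odd-even if (odd $i\in A\Rightarrow i+1\in A$) and (even $i\in A\Rightarrow i-1\in A$). $\mathcal{D}\colon\mathcal{H}^0\to\mathcal{H}^{\ge2}$ is $\mathbb{Q}$-linear with $\mathcal{D}(1)=1$; writing $\mathfrak{D}(\boldsymbol{c})=\mathcal{D}(y^{c_1}x^{c_2}\cdots y^{c_{2s-1}}x^{c_{2s}})$ for even-depth $\boldsymbol{c}$ (every word of $y\mathcal{H}x$ is uniquely of this form) and $\mathfrak{D}(\varnothing)=1$, it satisfies the recursion \begin{align*} \mathfrak{D}(\boldsymbol{c})&=\sum_{\substack{A\subset[2s]^1_{\boldsymbol{c}}\\ A\text{ even-odd}}}\ \sum_{\substack{B\subset[2s]^{>1}_{\boldsymbol{c}},\ \#A+\#B\ge1\\ \{2r,2r+1\}\not\subset B\ (r\in[s-1])}}(-1)^{\#B-1}\mathfrak{D}(\boldsymbol{c}_{(-A)}-\boldsymbol{\delta}_B)\,x^{\#A+\#B}\\ &\quad+\sum_{\substack{A\subset[2s]^1_{\boldsymbol{c}}\\ A\text{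 even-odd}}}\ \sum_{\substack{B\subset[2s]^{>1}_{\boldsymbol{c}},\ \#A+\#B\ge2\\ \{2r,2r+1\}\not\subset B\ (r\in[s-1])}}(-1)^{\#B-1}\mathfrak{D}(\boldsymbol{c}_{(-A)}-\boldsymbol{\delta}_B)\,yx^{\#A+\#B-1}\\ &\quad+\sum_{\substack{A\subset[2s]^1_{\boldsymbol{c}}\\ A\text{ odd-even}}}\ \sum_{\substack{B\subset[2s]^{>1}_{\boldsymbol{c}},\ \#A+\#B\ge2\\ \{2r-1,2r\}\not\subset B\ (r\in[s])}}(-1)^{\#B}\mathfrak{D}(\boldsymbol{c}_{(-A)}-\boldsymbol{\delta}_B)\,yx^{\#A+\#B-1}. \end{align*} (The arguments on the right are even-depth indices of strictly smaller weight, so this determines $\mathcal{D}$.) *)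

theory Defs
  imports Complex_Main "HOL-Library.Poly_Mapping"
begin

datatype letter = X | Y

type_synonym word = "letter list"

text \<open>An element of H = Q<x,y>: a finitely supported Q-valued function on words.\<close>
type_synonym hpoly = "word \<Rightarrow>\<^sub>0 rat"

definition wmon :: "word \<Rightarrow> hpoly" where
  "wmon w = Poly_Mapping.single w 1"

definition smult :: "rat \<Rightarrow> hpoly \<Rightarrow> hpoly" where
  "smult a p = Poly_Mapping.map (\<lambda>c. a * c) p"

definition lin :: "(word \<Rightarrow> hpoly) \<Rightarrow> hpoly \<Rightarrow> hpoly" where
  "lin f p = (\<Sum>w\<in>Poly_Mapping.keys p. smult (Poly_Mapping.lookup p w) (f w))"

definition lin2 :: "(word \<Rightarrow> word \<Rightarrow> hpoly) \<Rightarrow> hpoly \<Rightarrow> hpoly \<Rightarrow> hpoly" where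
  "lin2 f p q = (\<Sum>u\<in>Poly_Mapping.keys p. \<Sum>v\<in>Poly_Mapping.keys q. smult (Poly_Mapping.lookup p u * Poly_Mapping.lookup q v) (f u v))"

definition cat :: "hpoly \<Rightarrow> hpoly \<Rightarrow> hpoly" where
  "cat p q = lin2 (\<lambda>u v. wmon (u @ v)) p q"

definition qspan :: "hpoly set \<Rightarrow> hpoly set" where
  "qspan S = {(\<Sum>v\<in>F. smult (c v) v) | F c. finite F \<and> F \<subseteq> S}"

definition in_yH :: "hpoly \<Rightarrow> bool" where
  "in_yH p \<longleftrightarrow> (\<forall>w\<in>Poly_Mapping.keys p. \<exists>u. w = Y # u)"

definition in_yHx :: "hpoly \<Rightarrow> bool" where
  "in_yHx p \<longleftrightarrow> (\<forall>w\<in>Poly_Mapping.keys p. \<exists>u. w = Y # u @ [X])"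

definition e :: "nat \<Rightarrow> word" where
  "e k = Y # replicate (k - 1) X"

definition word_of_index :: "nat list \<Rightarrow> word" where
  "word_of_index ks = concat (map e ks)"

text \<open>Words of H^{>=2} = Q + yx Q<x,yx>: the words e_{k_1}...e_{k_r} with all k_i >= 2.\<close>
definition ge2_word :: "word \<Rightarrow> bool" where
  "ge2_word w \<longleftrightarrow> (\<exists>ks. (\<forall>k\<in>set ks. k \<ge> 2) \<and> w = word_of_index ks)"

definition in_Hge2 :: "hpoly \<Rightarrow> bool" where
  "in_Hge2 p \<longleftrightarrow> (\<forall>w\<in>Poly_Mapping.keys p. ge2_word w)"

definition index_of :: "word \<Rightarrow> nat list" where
  "index_of w = (THE ks. (\<forall>k\<in>set ks. k > 0) \<and> word_of_index ks = w)"

text \<open>Harmonic product of two words of H^1, given by their REVERSED indices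
  (so that the last letters e_{k_1}, e_{k_2} are the list heads).\<close>
fun harr :: "nat list \<Rightarrow> nat list \<Rightarrow> hpoly" where
  "harr [] bs = wmon (word_of_index (rev bs))"
| "harr as [] = wmon (word_of_index (rev as))"
| "harr (a # as) (b # bs) =
     cat (harr as (b # bs)) (wmon (e a))
   + cat (harr (a # as) bs) (wmon (e b))
   + cat (harr as bs) (wmon (e (a + b)))"

definition hstar :: "hpoly \<Rightarrow> hpoly \<Rightarrow> hpoly" where
  "hstar p q = lin2 (\<lambda>u v. harr (rev (index_of u)) (rev (index_of v))) p q"

fun phi_letter :: "letter \<Rightarrow> hpoly" where
  "phi_letter X = wmon [X] + wmon [Y]"
| "phi_letter Y = - wmon [Y]"

fun phi_word :: "word \<Rightarrow> hpoly" where
  "phi_word [] = wmon []"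
| "phi_word (a # w) = cat (phi_letter a) (phi_word w)"

definition phi :: "hpoly \<Rightarrow> hpoly" where
  "phi p = lin phi_word p"

fun word_of_even_index :: "nat list \<Rightarrow> word" where
  "word_of_even_index (a # b # cs) = replicate a Y @ replicate b X @ word_of_even_index cs"
| "word_of_even_index _ = []"

definition ones :: "nat list \<Rightarrow> nat set" where
  "ones c = {i \<in> {1..length c}. c ! (i - 1) = 1}"

definition gt1 :: "nat list \<Rightarrow> nat set" where
  "gt1 c = {i \<in> {1..length c}. c ! (i - 1) > 1}"

definition even_odd :: "nat set \<Rightarrow> bool" where
  "even_odd A \<longleftrightarrow> (\<forall>i\<in>A. (even i \<longrightarrow> i + 1 \<in> A) \<and> (odd i \<longrightarrow> i - 1 \<in> A))"

definition odd_even :: "nat set \<Rightarrow> bool" where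
  "odd_even A \<longleftrightarrow> (\<forall>i\<in>A. (odd i \<longrightarrow> i + 1 \<in> A) \<and> (even i \<longrightarrow> i - 1 \<in> A))"

definition reduce :: "nat list \<Rightarrow> nat set \<Rightarrow> nat set \<Rightarrow> nat list" where
  "reduce c A B = map (\<lambda>i. c ! (i - 1) - (if i \<in> B then 1 else 0))
                      (filter (\<lambda>i. i \<notin> A) [1..<length c + 1])"

definition xpow :: "nat \<Rightarrow> hpoly" where
  "xpow n = wmon (replicate n X)"

text \<open>The recursion for \<DD>, with a fuel parameter n: Dfuel n c is the value
  \<DD>(c) whenever n \<ge> weight of c (recursive arguments have strictly smaller weight).
  The factor (-1)^{#B-1} is written -((-1)^{#B}).\<close>
primrec Dfuel :: "nat \<Rightarrow> nat list \<Rightarrow> hpoly" where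
  "Dfuel 0 c = (if c = [] then wmon [] else 0)"
| "Dfuel (Suc n) c =
    (if c = [] then wmon [] else
     (let s = length c div 2 in
        (\<Sum>A | A \<subseteq> ones c \<and> even_odd A.
           \<Sum>B | B \<subseteq> gt1 c \<and> card A + card B \<ge> 1 \<and>
                 (\<forall>r\<in>{1..s-1}. \<not> {2*r, 2*r+1} \<subseteq> B).
             smult (- ((-1) ^ card B)) (cat (Dfuel n (reduce c A B)) (xpow (card A + card B))))
      + (\<Sum>A | A \<subseteq> ones c \<and> even_odd A.
           \<Sum>B | B \<subseteq> gt1 c \<and> card A + card B \<ge> 2 \<and>
                 (\<forall>r\<in>{1..s-1}. \<not> {2*r, 2*r+1} \<subseteq> B).
             smult (- ((-1) ^ card B))
               (cat (Dfuel n (reduce c A B)) (wmon (Y # replicate (card A + card B - 1) X))))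
      + (\<Sum>A | A \<subseteq> ones c \<and> odd_even A.
           \<Sum>B | B \<subseteq> gt1 c \<and> card A + card B \<ge> 2 \<and>
                 (\<forall>r\<in>{1..s}. \<not> {2*r - 1, 2*r} \<subseteq> B).
             smult ((-1) ^ card B)
               (cat (Dfuel n (reduce c A B)) (wmon (Y # replicate (card A + card B - 1) X))))))"

definition frakD :: "nat list \<Rightarrow> hpoly" where
  "frakD c = Dfuel (sum_list c) c"

definition even_index_of :: "word \<Rightarrow> nat list" where
  "even_index_of w = (THE c. even (length c) \<and> (\<forall>k\<in>set c. k > 0) \<and> word_of_even_index c = w)"

definition calD :: "hpoly \<Rightarrow> hpoly" where
  "calD p = lin (\<lambda>w. frakD (even_index_of w)) p"

definition LinKaw :: "hpoly set" where
  "LinKaw = qspan {hstar (cat (phi (hstar w1 w2)) (wmon [X])) w3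
                    | w1 w2 w3. in_yH w1 \<and> in_yH w2 \<and> in_Hge2 w3}"

definition Drop1 :: "hpoly set" where
  "Drop1 = qspan {w - calD w | w. in_yHx w}"

end

theory Submission
  imports Defs "HOL-Computational_Algebra.Polynomial"
begin

text \<open>The stronger statement that \<open>\<DD>\<close> vanishes on all generators is proved coefficient by
  coefficient.  For a word \<open>v\<close> in the letters \<open>e_k\<close> let \<open>\<Phi>_v\<close> be the functional sending a word to
  the coefficient of \<open>v\<close> in its image under \<open>\<DD>\<close>.  Let \<open>\<Psi>_v\<close> be the sum of \<open>\<Phi>_v\<close> and all
  \<open>\<Phi>_{v e_k}\<close>; these live in different weights.  The recursion says precisely that the even-odd
  signed sum over \<open>(A, B)\<close> of \<open>\<Psi>_v\<close> is the odd-even signed sum of \<open>\<Phi>_v\<close>.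

  Regard functionals as noncommutative power series in \<open>x, y\<close>.  The signed sums insert
  fixed series at the junctions of \<open>x\<close>- and \<open>y\<close>-runs, which a representation of the free algebra by
  two by two matrices makes multiplicative.  Comparing the two representations gives
  \<open>\<Psi>_v = T \<Phi>_v\<close> with an explicit \<open>T\<close> built from the automorphism \<open>x \<mapsto> x'\<close>, \<open>y \<mapsto> y'\<close>
  determined by \<open>x' - y' = x - y\<close> and \<open>x' (1 - y') = (1 - y) x\<close>.

  In the letters \<open>e_k\<close> the operator \<open>T\<close> is compatible with the coproduct dual to \<open>*\<close>, up to group-like
  factors, as long as the second tensor factor is restricted to \<open>H^{\<ge>2}\<close>.  This disposes of
  \<open>w_3\<close>.  A functional \<open>F\<close> vanishes on all \<open>\<phi>(w_1 * w_2) x\<close> iff an associated series is primitive, and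
  \<open>T\<close> preserves such \<open>F\<close> because, conjugated by \<open>y \<mapsto> x - y\<close>, the automorphism respects the
  coproduct.  Induction on \<open>v\<close> then shows that \<open>\<Phi>_v\<close> vanishes on every generator.\<close>

section \<open>Noncommutative formal power series\<close>

text \<open>The defining equations of the automorphism are dictated by the two representations: with
  them the twisted even-odd letters become conjugate to the odd-even letters, so that only boundary
  vectors remain to be matched. The images of the e_k are known through these equations alone, so
  both coproduct statements are proved by isolating the lowest weight in which an error could occur;
  in a product the other factor enters there only through its constant term. For multiplication by
  H^{\<ge>2} a recursion in k makes the lowest part of the error independent of k, while its order
  grows with k. Setting e_1 = 0 in the second factor is what closes this recursion. For primitivity
  the error is a polynomial in a parameter s, invariant under s -> s/(s - 1), hence constant, and it
  vanishes at s = 0. The induction on v has to carry all functionals u -> F(u * w_3) at once, since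
  the one-step operator relates the one for w_3 to those for w_3 and for w_3 without its last
  letter. The conclusion about the spans is immediate: a generator g with \<DD>(g) = 0 equals g -
  \<DD>(g).\<close>

typedef ('l, 'a) ser = "UNIV :: ('l list \<Rightarrow> 'a) set"
  morphisms cf Ser ..

lemma cf_Ser [simp]: "cf (Ser f) = f"
  by (simp add: Ser_inverse)

lemma ser_eqI: "(\<And>w. cf f w = cf g w) \<Longrightarrow> f = g"
  by (metis cf_inject ext)

lemma ser_eq_iff: "f = g \<longleftrightarrow> (\<forall>w. cf f w = cf g w)"
  by (metis ser_eqI)

text \<open>Recursion through the left derivative of the first factor lets the ring laws follow by
  induction on the word; \<open>cmul_take_drop\<close> recovers the usual sum over all
  splits.\<close>

primrec cmul :: "('l list \<Rightarrow> 'a::semiring_0) \<Rightarrow> ('l list \<Rightarrow> 'a) \<Rightarrow> 'l list \<Rightarrow> 'a" where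
  "cmul f g [] = f [] * g []"
| "cmul f g (a # w) = f [] * g (a # w) + cmul (\<lambda>v. f (a # v)) g w"

lemma cmul_add_left: "cmul (\<lambda>v. f v + f' v) g w = cmul f g w + cmul f' g w"
  by (induction w arbitrary: f f') (simp_all add: algebra_simps)

lemma cmul_add_right: "cmul f (\<lambda>v. g v + g' v) w = cmul f g w + cmul f g' w"
  by (induction w arbitrary: f) (simp_all add: algebra_simps)

lemma cmul_mult_left: "cmul (\<lambda>v. c * f v) g w = c * cmul f g w"
  by (induction w arbitrary: f) (simp_all add: algebra_simps)

lemma cmul_assoc: "cmul (cmul f g) h w = cmul f (cmul g h) w"
proof (induction w arbitrary: f)
  case (Cons a w)
  show ?case
    by (simp add: cmul_add_left cmul_mult_left Cons.IH algebra_simps)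
qed (simp add: algebra_simps)

lemma cmul_zero_left [simp]: "cmul (\<lambda>v. 0) g w = 0"
  by (induction w) simp_all

lemma cmul_zero_right [simp]: "cmul f (\<lambda>v. 0) w = 0"
  by (induction w arbitrary: f) simp_all

lemma cmul_one_left: "cmul (\<lambda>v. if v = [] then 1 else 0) g w = (g w :: 'a::semiring_1)"
  by (cases w) simp_all

lemma cmul_one_right: "cmul f (\<lambda>v. if v = [] then 1 else 0) w = (f w :: 'a::semiring_1)"
  by (induction w arbitrary: f) simp_all

lemma cmul_take_drop: "cmul f g w = (\<Sum>i\<le>length w. f (take i w) * g (drop i w))"
proof (induction w arbitrary: f)
  case (Cons a w)
  show ?case
    by (simp add: Cons.IH sum.atMost_Suc_shift del: sum.atMost_Suc)
qed simp

lemma cmul_cong: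
  assumes "\<And>v v'. v @ v' = w \<Longrightarrow> f v = f' v" "\<And>v v'. v @ v' = w \<Longrightarrow> g v' = g' v'"
  shows "cmul f g w = cmul f' g' w"
  unfolding cmul_take_drop using assms by (intro sum.cong refl) (metis append_take_drop_id)

instantiation ser :: (type, ring_1) ring_1
begin
definition zero_ser where "0 = Ser (\<lambda>w. 0)"
definition one_ser where "1 = Ser (\<lambda>w. if w = [] then 1 else 0)"
definition plus_ser where "f + g = Ser (\<lambda>w. cf f w + cf g w)"
definition minus_ser where "f - g = Ser (\<lambda>w. cf f w - cf g w)"
definition uminus_ser where "- f = Ser (\<lambda>w. - cf f w)"
definition times_ser where "f * g = Ser (cmul (cf f) (cf g))"
instance
proof
  fix a b c :: "('a, 'b) ser"
  show "a * b * c = a * (b * c)"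
    by (rule ser_eqI) (simp add: times_ser_def cmul_assoc)
  show "(a + b) * c = a * c + b * c" "a * (b + c) = a * b + a * c"
    by (rule ser_eqI, simp add: times_ser_def plus_ser_def cmul_add_left cmul_add_right)+
  show "1 * a = a" "a * 1 = a"
    by (rule ser_eqI, simp add: times_ser_def one_ser_def cmul_one_left cmul_one_right)+
  show "(0::('a, 'b) ser) \<noteq> 1"
    by (auto simp: ser_eq_iff zero_ser_def one_ser_def)
qed (auto simp: ser_eq_iff zero_ser_def plus_ser_def minus_ser_def uminus_ser_def times_ser_def)
end

lemma cf_simps [simp]:
  "cf 0 w = 0" "cf (f + g) w = cf f w + cf g w" "cf (f - g) w = cf f w - cf g w"
  "cf (- f) w = - cf f w"
  by (simp_all add: zero_ser_def plus_ser_def minus_ser_def uminus_ser_def)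

lemma cf_one: "cf 1 w = (if w = [] then 1 else 0)"
  by (simp add: one_ser_def)

lemma cf_one_simps [simp]: "cf 1 [] = 1" "cf 1 (a # w) = 0"
  by (simp_all add: cf_one)

lemma cf_mult: "cf (f * g) w = cmul (cf f) (cf g) w"
  by (simp add: times_ser_def)

lemma cf_mult_Nil [simp]: "cf (f * g) [] = cf f [] * cf g []"
  by (simp add: cf_mult)

lemma cf_sum: "cf (sum f A) w = (\<Sum>a\<in>A. cf (f a) w)"
  by (induction A rule: infinite_finite_induct) simp_all

instantiation ser :: (type, real_algebra_1) real_algebra_1
begin
definition scaleR_ser where "c *\<^sub>R f = Ser (\<lambda>w. c *\<^sub>R cf f w)"
instance
proof
  fix a b :: real and x y :: "('a, 'b) ser"
  have l: "cmul (\<lambda>v. a *\<^sub>R f v) g w = a *\<^sub>R cmul f g w" for f g :: "'a list \<Rightarrow> 'b" and w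
    by (induction w arbitrary: f) (simp_all add: algebra_simps)
  have r: "cmul f (\<lambda>v. a *\<^sub>R g v) w = a *\<^sub>R cmul f g w" for f g :: "'a list \<Rightarrow> 'b" and w
    by (induction w arbitrary: f) (simp_all add: algebra_simps)
  show "a *\<^sub>R x * y = a *\<^sub>R (x * y)" "x * a *\<^sub>R y = a *\<^sub>R (x * y)"
    by (rule ser_eqI, simp add: scaleR_ser_def times_ser_def l r)+
qed (auto simp: ser_eq_iff scaleR_ser_def algebra_simps)
end

lemma cf_scaleR [simp]: "cf (c *\<^sub>R f) w = c *\<^sub>R cf f w"
  by (simp add: scaleR_ser_def)

definition lq :: "'l \<Rightarrow> ('l, 'a) ser \<Rightarrow> ('l, 'a) ser" where
  "lq a f = Ser (\<lambda>w. cf f (a # w))"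

lemma cf_lq [simp]: "cf (lq a f) w = cf f (a # w)"
  by (simp add: lq_def)

definition L :: "'l \<Rightarrow> ('l, 'a::ring_1) ser" where
  "L a = Ser (\<lambda>w. if w = [a] then 1 else 0)"

lemma cf_mult_Cons: "cf (f * g) (a # w) = cf f [] * cf g (a # w) + cf (lq a f * g) w"
  by (simp add: cf_mult lq_def)

lemma lq_simps [simp]:
  "lq a (0 :: ('l, 'a::ring_1) ser) = 0" "lq a (1 :: ('l, 'a) ser) = 0"
  "lq a (f + g) = lq a f + lq a g" "lq a (f - g) = lq a f - lq a (g :: ('l, 'a) ser)"
  "lq a (- f) = - lq a f"
  by (simp_all add: ser_eq_iff)

lemma lq_L: "lq b (L a :: ('l, 'a::ring_1) ser) = (if a = b then 1 else 0)"
  by (auto simp: ser_eq_iff L_def cf_one)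

lemma cf_L: "cf (L a) w = (if w = [a] then 1 else 0)"
  by (simp add: L_def)

lemma cf_L_Nil [simp]: "cf (L a) [] = 0"
  by (simp add: L_def)

lemma cf_L_mult: "cf (L a * f) (b # w) = (if a = b then cf f w else 0)"
  by (simp add: cf_mult_Cons lq_L)

lemma lq_L_mult: "lq b (L a * f) = (if a = b then f else 0)"
  by (simp add: ser_eq_iff cf_L_mult)

lemma cf_mult_snoc: "cf (f * g) (w @ [a]) = cf f (w @ [a]) * cf g [] + cmul (cf f) (\<lambda>v. cf g (v @ [a])) w"
  unfolding cf_mult cmul_take_drop
  by (simp add: algebra_simps)

lemma cf_mult_L: "cf (f * L a) (w @ [b]) = (if a = b then cf f w else 0)"
proof -
  have "cmul (cf f) (\<lambda>v. cf (L a) (v @ [b])) w = (if a = b then cmul (cf f) (\<lambda>v. if v = [] then 1 else 0) w else 0)"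
    by (auto simp: cf_L intro!: cmul_cong)
  then show ?thesis by (simp add: cf_mult_snoc cmul_one_right)
qed

text \<open>The geometric series of \<open>h\<close>. Without constant term, \<open>h ^ n\<close>
  vanishes on words shorter than n, so each coefficient is a finite sum.\<close>

definition star :: "('l, 'a::ring_1) ser \<Rightarrow> ('l, 'a) ser" where
  "star h = Ser (\<lambda>w. \<Sum>n\<le>length w. cf (h ^ n) w)"

lemma cf_mult_short:
  assumes "\<And>v. length v < m \<Longrightarrow> cf f v = 0" "\<And>v. length v < n \<Longrightarrow> cf g v = 0" "length w < m + n"
  shows "cf (f * g) w = 0"
  unfolding cf_mult cmul_take_drop
proof (intro sum.neutral ballI)
  fix i assume "i \<in> {..length w}"
  then show "cf f (take i w) * cf g (drop i w) = 0"
    using assms by (cases "i < m") auto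
qed

lemma cf_power_short:
  assumes "cf h [] = 0" "length w < n"
  shows "cf (h ^ n) w = 0"
  using assms(2)
proof (induction n arbitrary: w)
  case (Suc n)
  have "cf (h * h ^ n) w = 0"
    by (rule cf_mult_short[of 1 _ n]) (use assms(1) Suc in auto)
  then show ?case by simp
qed simp

lemma cf_star:
  assumes "cf h [] = 0" "length w \<le> N"
  shows "cf (star h) w = cf (\<Sum>n\<le>N. h ^ n) w"
proof -
  have "(\<Sum>n\<le>N. cf (h ^ n) w) = (\<Sum>n\<le>length w. cf (h ^ n) w)"
    by (rule sum.mono_neutral_right) (use assms cf_power_short[of h w] in auto)
  then show ?thesis by (simp add: star_def cf_sum)
qed

lemma star_eq:
  assumes "cf h [] = 0"
  shows "star h = 1 + h * star h" "star h = 1 + star h * h"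
proof -
  have P: "1 + h * (\<Sum>n\<le>N. h ^ n) = (\<Sum>n\<le>Suc N. h ^ n)"
          "1 + (\<Sum>n\<le>N. h ^ n) * h = (\<Sum>n\<le>Suc N. h ^ n)" for N
    by (simp_all add: sum_distrib_left sum_distrib_right sum.atMost_Suc_shift power_Suc2
                 del: sum.atMost_Suc power_Suc)
       (simp_all add: power_commutes)
  show "star h = 1 + h * star h"
  proof (rule ser_eqI)
    fix w
    have "cf (h * star h) w = cf (h * (\<Sum>n\<le>length w. h ^ n)) w"
      unfolding cf_mult by (rule cmul_cong) (use assms in \<open>auto simp: cf_star\<close>)
    then have "cf (1 + h * star h) w = cf (1 + h * (\<Sum>n\<le>length w. h ^ n)) w" by simp
    also have "\<dots> = cf (star h) w" unfolding P by (rule cf_star[symmetric]) (use assms in auto)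
    finally show "cf (star h) w = cf (1 + h * star h) w" by simp
  qed
  show "star h = 1 + star h * h"
  proof (rule ser_eqI)
    fix w
    have "cf (star h * h) w = cf ((\<Sum>n\<le>length w. h ^ n) * h) w"
      unfolding cf_mult by (rule cmul_cong) (use assms in \<open>auto simp: cf_star\<close>)
    then have "cf (1 + star h * h) w = cf (1 + (\<Sum>n\<le>length w. h ^ n) * h) w" by simp
    also have "\<dots> = cf (star h) w" unfolding P by (rule cf_star[symmetric]) (use assms in auto)
    finally show "cf (star h) w = cf (1 + star h * h) w" by simp
  qed
qed

lemma star_inverse:
  assumes "cf h [] = 0"
  shows "(1 - h) * star h = 1" "star h * (1 - h) = 1"
  using star_eq[OF assms] by (simp_all add: algebra_simps)

lemma cf_star_Nil [simp]: "cf (star h) [] = 1"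
  by (simp add: star_def)

section \<open>Weights and substitution homomorphisms\<close>

text \<open>The alphabet of the e_k is infinite, so length alone would leave infinitely many words.
  With these weights only finitely many words lie below a bound, which makes substitution well
  defined.\<close>

class weighted =
  fixes lw :: "'a \<Rightarrow> nat"
  assumes lw_pos: "0 < lw a" and finite_lw: "finite {a. lw a \<le> n}"

definition wt :: "'l::weighted list \<Rightarrow> nat" where
  "wt w = sum_list (map lw w)"

lemma wt_simps [simp]: "wt [] = 0" "wt (a # w) = lw a + wt w" "wt (v @ w) = wt v + wt w"
  by (simp_all add: wt_def)

lemma wt_eq_0 [simp]: "wt w = 0 \<longleftrightarrow> w = []"
  by (cases w) (use lw_pos in \<open>auto simp: gr0_conv_Suc\<close>)

lemma length_le_wt: "length w \<le> wt w"
proof (induction w)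
  case (Cons a w) then show ?case using lw_pos[of a] by simp
qed simp

lemma finite_wt [simp]: "finite {w :: 'l::weighted list. wt w \<le> n}"
proof (rule finite_subset)
  have "wt w \<le> n \<Longrightarrow> set w \<subseteq> {a. lw a \<le> n}" for w :: "'l list"
    by (induction w) auto
  then show "{w :: 'l list. wt w \<le> n} \<subseteq> {w. set w \<subseteq> {a. lw a \<le> n} \<and> length w \<le> n}"
    using length_le_wt order_trans by blast
  show "finite {w :: 'l list. set w \<subseteq> {a. lw a \<le> n} \<and> length w \<le> n}"
    by (rule finite_lists_length_le) (rule finite_lw)
qed

lemma finite_wt_less [simp]: "finite {w :: 'l::weighted list. wt w < n}"
  by (rule finite_subset[OF _ finite_wt[of n]]) auto

definition ordge :: "nat \<Rightarrow> ('l::weighted, 'a::zero) ser \<Rightarrow> bool" where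
  "ordge n f \<longleftrightarrow> (\<forall>w. wt w < n \<longrightarrow> cf f w = 0)"

lemma ordge_mult:
  fixes f g :: "('l::weighted, 'a::ring_1) ser"
  assumes "ordge m f" "ordge n g"
  shows "ordge (m + n) (f * g)"
  unfolding ordge_def cf_mult cmul_take_drop
proof (intro allI impI sum.neutral ballI)
  fix w :: "'l list" and i assume w: "wt w < m + n"
  have "wt (take i w) + wt (drop i w) = wt w" by (metis append_take_drop_id wt_simps(3))
  then have "wt (take i w) < m \<or> wt (drop i w) < n" using w by linarith
  then show "cf f (take i w) * cf g (drop i w) = 0" using assms by (auto simp: ordge_def)
qed

lemma ordge_0 [simp]: "ordge 0 f" by (simp add: ordge_def)

lemma ordge_1: "ordge 1 f \<longleftrightarrow> cf f [] = 0"
  by (auto simp: ordge_def)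

lemma ordge_mono: "ordge n f \<Longrightarrow> m \<le> n \<Longrightarrow> ordge m f"
  by (auto simp: ordge_def)

lemma ordge_zeroI: "(\<And>n. ordge n f) \<Longrightarrow> f = 0" for f :: "('l::weighted, 'a::ring_1) ser"
  by (rule ser_eqI) (metis cf_simps(1) lessI ordge_def)

lemma ordge_add: "ordge n f \<Longrightarrow> ordge n g \<Longrightarrow> ordge n (f + g)"
  for f :: "('l::weighted, 'a::ring_1) ser"
  by (simp add: ordge_def)

lemma ordge_multL: "ordge n f \<Longrightarrow> ordge n (f * g)" "ordge n f \<Longrightarrow> ordge n (g * f)"
  for f :: "('l::weighted, 'a::ring_1) ser"
  using ordge_mult[of n f 0 g] ordge_mult[of 0 g n f] by simp_all

definition pw :: "('l \<Rightarrow> 'r::monoid_mult) \<Rightarrow> 'l list \<Rightarrow> 'r" where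
  "pw h v = prod_list (map h v)"

lemma pw_simps [simp]: "pw h [] = 1" "pw h (a # v) = h a * pw h v" "pw h (u @ v) = pw h u * pw h v"
  by (simp_all add: pw_def)

definition adm :: "('l::weighted \<Rightarrow> ('m::weighted, 'a::ring_1) ser) \<Rightarrow> bool" where
  "adm h \<longleftrightarrow> (\<forall>k. ordge (lw k) (h k))"

lemma ordge_pw: "adm h \<Longrightarrow> ordge (wt v) (pw h v)"
  by (induction v) (auto simp: adm_def intro: ordge_mult)

text \<open>The sum over all words v is cut at the weight of w; for admissible \<open>h\<close> the
  heavier v contribute nothing.\<close>

definition subst :: "('l::weighted \<Rightarrow> ('m::weighted, 'a::ring_1) ser) \<Rightarrow> ('l, 'a) ser \<Rightarrow> ('m, 'a) ser" where
  "subst h f = Ser (\<lambda>w. \<Sum>v | wt v \<le> wt w. cf f v * cf (pw h v) w)"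

lemma cf_subst:
  assumes "adm h" "wt w \<le> N"
  shows "cf (subst h f) w = (\<Sum>v | wt v \<le> N. cf f v * cf (pw h v) w)"
proof -
  have "(\<Sum>v | wt v \<le> N. cf f v * cf (pw h v) w) = (\<Sum>v | wt v \<le> wt w. cf f v * cf (pw h v) w)"
    by (rule sum.mono_neutral_right)
       (use assms ordge_pw[OF assms(1)] in \<open>auto simp: ordge_def not_le\<close>)
  then show ?thesis by (simp add: subst_def)
qed

lemma cmul_sum_left: "cmul (\<lambda>v. \<Sum>i\<in>A. f i v) g w = (\<Sum>i\<in>A. cmul (f i) g w)"
  by (induction A rule: infinite_finite_induct) (simp_all add: cmul_add_left)

lemma cmul_sum_right: "cmul f (\<lambda>v. \<Sum>i\<in>A. g i v) w = (\<Sum>i\<in>A. cmul f (g i) w)"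
  by (induction A rule: infinite_finite_induct) (simp_all add: cmul_add_right)

lemma cmul_commute_coeff:
  fixes d :: "'a::ring_1"
  assumes "\<And>w. p w * d = d * p w"
  shows "cmul p (\<lambda>w. d * q w) w = d * cmul p q w"
  unfolding cmul_take_drop sum_distrib_left
  by (intro sum.cong refl) (simp add: assms mult.assoc[symmetric])

lemma sum_splits:
  "(\<Sum>(v, v') | v @ v' = u. F v v') = (\<Sum>i\<le>length u. F (take i u) (drop i u))"
  by (rule sum.reindex_bij_witness[of _ "\<lambda>i. (take i u, drop i u)" "\<lambda>(v, v'). length v"]) auto

text \<open>The condition that the coefficients of \<open>g\<close> commute with those of the images
  covers two cases: real coefficients of \<open>g\<close>, and real coefficients of the images.\<close>

lemma subst_mult:
  fixes h :: "'l::weighted \<Rightarrow> ('m::weighted, 'a::ring_1) ser"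
  assumes h: "adm h"
    and com: "\<And>v v' w. cf (pw h v) w * cf g v' = cf g v' * cf (pw h v) w"
  shows "subst h (f * g) = subst h f * subst h g"
proof (rule ser_eqI)
  fix w :: "'m list"
  define N where "N = wt w"
  define V where "V = {v :: 'l list. wt v \<le> N}"
  define G where "G = (\<lambda>v v'. cf f v * cf g v' * cf (pw h (v @ v')) w)"
  have fin: "finite V" "finite (V \<times> V)" by (simp_all add: V_def)
  have "cf (subst h f * subst h g) w
      = cmul (\<lambda>w. \<Sum>v\<in>V. cf f v * cf (pw h v) w) (\<lambda>w. \<Sum>v\<in>V. cf g v * cf (pw h v) w) w"
    unfolding cf_mult V_def by (rule cmul_cong) (auto intro!: cf_subst[OF h] simp: N_def)
  also have "\<dots> = (\<Sum>v\<in>V. \<Sum>v'\<in>V. cf f v * (cf g v' * cmul (cf (pw h v)) (cf (pw h v')) w))"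
    by (simp add: cmul_sum_left cmul_sum_right cmul_mult_left cmul_commute_coeff[OF com]
        sum_distrib_left)
  also have "\<dots> = (\<Sum>(v, v')\<in>V \<times> V. G v v')"
    by (simp add: sum.cartesian_product G_def cf_mult mult.assoc)
  \<comment> \<open>Pairs whose concatenation outweighs w contribute nothing; the others are then
    regrouped by their concatenation.\<close>
  also have "\<dots> = (\<Sum>(v, v')\<in>{p \<in> V \<times> V. fst p @ snd p \<in> V}. G v v')"
  proof (rule sum.mono_neutral_right)
    show "\<forall>i\<in>V \<times> V - {p \<in> V \<times> V. fst p @ snd p \<in> V}. (case i of (v, v') \<Rightarrow> G v v') = 0"
    proof
      fix p assume p: "p \<in> V \<times> V - {p \<in> V \<times> V. fst p @ snd p \<in> V}"
      then have "wt w < wt (fst p @ snd p)" by (auto simp: V_def N_def)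
      then have "cf (pw h (fst p @ snd p)) w = 0"
        using ordge_pw[OF h, of "fst p @ snd p"] unfolding ordge_def by blast
      then show "(case p of (v, v') \<Rightarrow> G v v') = 0" by (simp add: G_def case_prod_unfold del: pw_simps)
    qed
  qed (use fin in auto)
  also have "\<dots> = (\<Sum>u\<in>V. \<Sum>p | p \<in> {p \<in> V \<times> V. fst p @ snd p \<in> V} \<and> fst p @ snd p = u. case p of (v, v') \<Rightarrow> G v v')"
    by (rule sum.group[symmetric]) (use fin in auto)
  also have "\<dots> = (\<Sum>u\<in>V. \<Sum>(v, v') | v @ v' = u. G v v')"
    by (intro sum.cong refl) (auto simp: V_def)
  also have "\<dots> = (\<Sum>u\<in>V. cf (f * g) u * cf (pw h u) w)"
    unfolding sum_splits by (simp add: G_def cf_mult cmul_take_drop sum_distrib_right del: pw_simps)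
  also have "\<dots> = cf (subst h (f * g)) w"
    using cf_subst[OF h, of w N] by (simp add: V_def N_def)
  finally show "cf (subst h (f * g)) w = cf (subst h f * subst h g) w" ..
qed

section \<open>Substitution of series over an algebra into series with real coefficients\<close>

definition emb :: "('l, real) ser \<Rightarrow> ('l, 'a::real_algebra_1) ser" where
  "emb f = Ser (\<lambda>w. of_real (cf f w))"

lemma cf_emb [simp]: "cf (emb f) w = of_real (cf f w)"
  by (simp add: emb_def)

lemma emb_mult: "emb (f * g) = emb f * emb g"
  by (rule ser_eqI) (simp add: cf_mult cmul_take_drop)

lemma emb_simps [simp]: "emb 1 = 1" "emb 0 = 0" "emb (f + g) = emb f + emb g" "emb (f - g) = emb f - emb g"
  "emb (c *\<^sub>R f) = c *\<^sub>R emb f" "emb (L a) = L a"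
  by (simp_all add: ser_eq_iff cf_one cf_L of_real_def scaleR_add_left scaleR_diff_left)

lemma emb_pw: "emb (pw h v) = pw (\<lambda>k. emb (h k)) v"
  by (induction v) (simp_all add: emb_mult)

lemma of_real_commute: "of_real c * x = x * (of_real c :: 'a::real_algebra_1)"
  by (simp add: of_real_def)

definition sb :: "('l::weighted \<Rightarrow> ('m::weighted, 'a::real_algebra_1) ser) \<Rightarrow> ('l, real) ser \<Rightarrow> ('m, 'a) ser" where
  "sb h f = subst h (emb f)"

lemma cf_sb:
  assumes "adm h" "wt w \<le> N"
  shows "cf (sb h f) w = (\<Sum>v | wt v \<le> N. cf f v *\<^sub>R cf (pw h v) w)"
  unfolding sb_def cf_subst[OF assms] by (simp add: scaleR_conv_of_real)

lemma sb_mult: "adm h \<Longrightarrow> sb h (f * g) = sb h f * sb h g"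
  unfolding sb_def emb_mult by (rule subst_mult) (simp_all add: of_real_commute)

lemma sb_linear: "linear (sb h)"
  by (rule linearI; rule ser_eqI)
     (simp_all add: sb_def subst_def algebra_simps sum.distrib scaleR_sum_right)

lemmas sb_add = linear_add[OF sb_linear]
  and sb_diff = linear_diff[OF sb_linear]
  and sb_neg = linear_neg[OF sb_linear]
  and sb_scale = linear_scale[OF sb_linear]
  and sb_0 = linear_0[OF sb_linear]

lemma sb_ordge: "ordge n f \<Longrightarrow> ordge n (sb h f)"
  by (auto simp: ordge_def sb_def subst_def intro!: sum.neutral)

definition mon :: "'l list \<Rightarrow> ('l, 'a::ring_1) ser" where
  "mon v = pw L v"

lemma mon_simps [simp]: "mon [] = 1" "mon (a # v) = L a * mon v" "mon (u @ v) = mon u * mon v"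
  by (simp_all add: mon_def)

lemma cf_mon: "cf (mon v) w = (if w = v then 1 else 0)"
proof (induction v arbitrary: w)
  case (Cons a v)
  show ?case by (cases w) (auto simp: cf_L_mult Cons)
qed (simp add: cf_one)

lemma sb_mon: assumes "adm h" shows "sb h (mon v) = pw h v"
proof (rule ser_eqI)
  fix w
  have "cf (sb h (mon v)) w = (\<Sum>v' | wt v' \<le> max (wt w) (wt v). cf (mon v :: ('a, real) ser) v' *\<^sub>R cf (pw h v') w)"
    by (rule cf_sb[OF assms]) simp
  also have "\<dots> = (\<Sum>v' | wt v' \<le> max (wt w) (wt v). if v' = v then cf (pw h v) w else 0)"
    by (intro sum.cong refl) (simp add: cf_mon)
  also have "\<dots> = cf (pw h v) w" by (simp add: sum.delta)
  finally show "cf (sb h (mon v)) w = cf (pw h v) w" .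
qed

lemma sb_L: "adm h \<Longrightarrow> sb h (L k) = h k"
  using sb_mon[of h "[k]"] by simp

lemma sb_1: "adm h \<Longrightarrow> sb h 1 = 1"
  using sb_mon[of h "[]"] by simp

text \<open>Monomials do not span the series, but maps that kill everything of order n see only the
  truncation below weight n, which is a finite combination of monomials.\<close>

lemma linear_eq_by_mons:
  fixes H1 H2 :: "('l::weighted, real) ser \<Rightarrow> 'b::real_vector"
  assumes lin: "linear H1" "linear H2"
    and cont: "\<And>f. ordge n f \<Longrightarrow> H1 f = 0" "\<And>f. ordge n f \<Longrightarrow> H2 f = 0"
    and eq: "\<And>v. H1 (mon v) = H2 (mon v)"
  shows "H1 f = H2 f"
proof -
  define p where "p = (\<Sum>v | wt v < n. cf f v *\<^sub>R (mon v :: ('l, real) ser))"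
  have "cf p w = (if wt w < n then cf f w else 0)" for w
  proof -
    have "cf p w = (\<Sum>v | wt v < n. if v = w then cf f w else 0)"
      unfolding p_def cf_sum by (intro sum.cong refl) (auto simp: cf_mon)
    then show ?thesis by (simp add: sum.delta)
  qed
  then have o: "ordge n (f - p)" by (simp add: ordge_def)
  have "H1 p = H2 p"
    unfolding p_def by (simp add: linear_sum[OF lin(1)] linear_sum[OF lin(2)] linear_scale[OF lin(1)]
        linear_scale[OF lin(2)] eq)
  moreover have "H1 (f - p) = 0" "H2 (f - p) = 0" using cont o by auto
  ultimately show ?thesis by (simp add: linear_diff[OF lin(1)] linear_diff[OF lin(2)])
qed

lemma filtered_linear_eqI:
  fixes H1 H2 :: "('l::weighted, real) ser \<Rightarrow> ('m::weighted, 'a::real_algebra_1) ser"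
  assumes lin: "linear H1" "linear H2"
    and cont: "\<And>f n. ordge n f \<Longrightarrow> ordge n (H1 f)" "\<And>f n. ordge n f \<Longrightarrow> ordge n (H2 f)"
    and eq: "\<And>v. H1 (mon v) = H2 (mon v)"
  shows "H1 f = H2 f"
proof (rule ser_eqI)
  fix w
  have l: "linear (\<lambda>g. cf (H g) w)" if "linear H" for H :: "('l, real) ser \<Rightarrow> ('m, 'a) ser"
    by (rule linearI) (simp_all add: linear_add[OF that] linear_scale[OF that])
  show "cf (H1 f) w = cf (H2 f) w"
    by (rule linear_eq_by_mons[of "\<lambda>g. cf (H1 g) w" "\<lambda>g. cf (H2 g) w" "Suc (wt w)"])
       (use l lin cont eq in \<open>auto simp: ordge_def\<close>)
qed

lemma pw_hom:
  assumes "\<And>f g. H (f * g) = H f * H g" "H 1 = 1"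
  shows "H (pw h v) = pw (\<lambda>k. H (h k)) v"
  by (induction v) (simp_all add: assms)

lemma adm_sb: "adm h1 \<Longrightarrow> adm (\<lambda>k. sb h2 (h1 k))"
  by (simp add: adm_def sb_ordge)

lemma sb_sb:
  assumes "adm h1" "adm h2"
  shows "sb h2 (sb h1 f) = sb (\<lambda>k. sb h2 (h1 k)) f"
proof (rule filtered_linear_eqI[of "\<lambda>f. sb h2 (sb h1 f)"])
  show "linear (\<lambda>f. sb h2 (sb h1 f))"
    by (rule linearI) (simp_all add: sb_add sb_scale)
  show "sb h2 (sb h1 (mon v)) = sb (\<lambda>k. sb h2 (h1 k)) (mon v)" for v
    by (simp add: sb_mon assms adm_sb pw_hom[of "sb h2", OF sb_mult sb_1])
qed (auto intro: sb_ordge sb_linear)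

lemma sb_conj:
  assumes h: "adm h" and ab: "a * b = 1" "b * a = 1"
  shows "sb (\<lambda>k. a * h k * b) f = a * sb h f * b"
proof -
  have h': "adm (\<lambda>k. a * h k * b)" using h by (simp add: adm_def ordge_multL)
  have p: "pw (\<lambda>k. a * h k * b) v = a * pw h v * b" for v
  proof (induction v)
    case (Cons k v)
    have "a * h k * b * (a * pw h v * b) = a * h k * (b * a) * pw h v * b" by (simp only: mult.assoc)
    also have "\<dots> = a * (h k * pw h v) * b" by (simp only: ab mult_1_right mult.assoc)
    finally show ?case by (simp only: pw_simps Cons)
  qed (simp add: ab)
  show ?thesis
  proof (rule filtered_linear_eqI[of "sb (\<lambda>k. a * h k * b)" "\<lambda>f. a * sb h f * b"])
    show "linear (\<lambda>f. a * sb h f * b)"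
      by (rule linearI) (simp_all add: sb_add sb_scale algebra_simps)
  qed (auto simp: sb_mon h h' p sb_ordge ordge_multL sb_linear)
qed

section \<open>The one-step operator on functionals\<close>

instantiation letter :: weighted
begin
definition lw_letter :: "letter \<Rightarrow> nat" where "lw_letter a = 1"
instance
proof
  fix n
  have "{a. lw (a :: letter) \<le> n} \<subseteq> {X, Y}" using letter.exhaust by auto
  then show "finite {a. lw (a :: letter) \<le> n}" by (rule finite_subset) simp
qed (simp add: lw_letter_def)
end

lemma lw_letter [simp]: "lw (a :: letter) = 1" by (simp add: lw_letter_def)

lemma wt_word: "wt (w :: word) = length w"
  by (induction w) simp_all

lemma adm_letter: "adm (h :: letter \<Rightarrow> _) \<longleftrightarrow> cf (h X) [] = 0 \<and> cf (h Y) [] = 0"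
  by (auto simp: adm_def ordge_1[symmetric]) (metis letter.exhaust)

abbreviation x :: "(letter, real) ser" where "x \<equiv> L X"
abbreviation y :: "(letter, real) ser" where "y \<equiv> L Y"

subsection \<open>Two by two matrices\<close>

datatype m2 = M2 (m11: real) (m12: real) (m21: real) (m22: real)

instantiation m2 :: real_algebra_1
begin
definition zero_m2 where "0 = M2 0 0 0 0"
definition one_m2 where "1 = M2 1 0 0 1"
definition plus_m2 where "A + B = M2 (m11 A + m11 B) (m12 A + m12 B) (m21 A + m21 B) (m22 A + m22 B)"
definition minus_m2 where "A - B = M2 (m11 A - m11 B) (m12 A - m12 B) (m21 A - m21 B) (m22 A - m22 B)"
definition uminus_m2 where "- A = M2 (- m11 A) (- m12 A) (- m21 A) (- m22 A)"
definition times_m2 where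
  "A * B = M2 (m11 A * m11 B + m12 A * m21 B) (m11 A * m12 B + m12 A * m22 B)
              (m21 A * m11 B + m22 A * m21 B) (m21 A * m12 B + m22 A * m22 B)"
definition scaleR_m2 where "c *\<^sub>R A = M2 (c * m11 A) (c * m12 A) (c * m21 A) (c * m22 A)"
instance
  by standard (simp_all add: zero_m2_def one_m2_def plus_m2_def minus_m2_def uminus_m2_def times_m2_def
      scaleR_m2_def algebra_simps)
end

text \<open>A series with matrix coefficients is handled as a matrix of four series, so that matrix
  identities become identities between series.\<close>

definition comb :: "('l, real) ser \<Rightarrow> ('l, real) ser \<Rightarrow> ('l, real) ser \<Rightarrow> ('l, real) ser \<Rightarrow> ('l, m2) ser" where
  "comb a b c d = Ser (\<lambda>w. M2 (cf a w) (cf b w) (cf c w) (cf d w))"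

definition e11 :: "('l, m2) ser \<Rightarrow> ('l, real) ser" where "e11 F = Ser (\<lambda>w. m11 (cf F w))"
definition e21 :: "('l, m2) ser \<Rightarrow> ('l, real) ser" where "e21 F = Ser (\<lambda>w. m21 (cf F w))"

lemma comb_eq_iff: "comb a b c d = comb a' b' c' d' \<longleftrightarrow> a = a' \<and> b = b' \<and> c = c' \<and> d = d'"
  by (auto simp: comb_def ser_eq_iff)

lemma comb_add: "comb a b c d + comb a' b' c' d' = comb (a + a') (b + b') (c + c') (d + d')"
  and comb_diff: "comb a b c d - comb a' b' c' d' = comb (a - a') (b - b') (c - c') (d - d')"
  and comb_one: "(1 :: ('l, m2) ser) = comb 1 0 0 1"
  by (simp_all add: comb_def ser_eq_iff plus_m2_def minus_m2_def scaleR_m2_def cf_one one_m2_def zero_m2_def)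

lemma comb_mult: "comb a b c d * comb a' b' c' d'
    = comb (a * a' + b * c') (a * b' + b * d') (c * a' + d * c') (c * b' + d * d')"
proof (rule ser_eqI)
  fix w
  have "cmul (\<lambda>w. M2 (a w) (b w) (c w) (d w)) (\<lambda>w. M2 (a' w) (b' w) (c' w) (d' w)) w
    = M2 (cmul a a' w + cmul b c' w) (cmul a b' w + cmul b d' w)
         (cmul c a' w + cmul d c' w) (cmul c b' w + cmul d d' w)"
    for a b c d a' b' c' d' :: "'a list \<Rightarrow> real"
    by (induction w arbitrary: a b c d) (simp_all add: times_m2_def plus_m2_def)
  then show "cf (comb a b c d * comb a' b' c' d') w
    = cf (comb (a * a' + b * c') (a * b' + b * d') (c * a' + d * c') (c * b' + d * d')) w"
    by (simp add: comb_def cf_mult)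
qed

lemma cf_comb_Nil: "cf (comb a b c d) [] = 0 \<longleftrightarrow> cf a [] = 0 \<and> cf b [] = 0 \<and> cf c [] = 0 \<and> cf d [] = 0"
  by (simp add: comb_def zero_m2_def)

lemma comb_surj: "\<exists>a b c d. F = comb a b c d"
  by (rule exI[of _ "Ser (\<lambda>w. m11 (cf F w))"], rule exI[of _ "Ser (\<lambda>w. m12 (cf F w))"],
      rule exI[of _ "Ser (\<lambda>w. m21 (cf F w))"], rule exI[of _ "Ser (\<lambda>w. m22 (cf F w))"])
     (simp add: comb_def ser_eq_iff)

lemma e11_comb [simp]: "e11 (comb a b c d) = a" and e21_comb [simp]: "e21 (comb a b c d) = c"
  by (simp_all add: e11_def e21_def comb_def ser_eq_iff)

subsection \<open>The twisted letters\<close>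

text \<open>With \<open>t' = t - a + b\<close> the fixed point equation \<open>t = twist_step a b t\<close> is
  \<open>t (1 - t') = (1 - b) a\<close>; it determines \<open>t\<close> degree by degree.\<close>
definition twist_step :: "'r::ring_1 \<Rightarrow> 'r \<Rightarrow> 'r \<Rightarrow> 'r" where
  "twist_step a b t = (1 - b) * a + t * (t - a + b)"

text \<open>The difference of two solutions is a sum of products of itself with series without
  constant term, so its order grows beyond every bound.\<close>

lemma twist_unique:
  fixes a b s t :: "('l::weighted, 'a::ring_1) ser"
  assumes "s = twist_step a b s" "t = twist_step a b t"
    and "cf s [] = 0" "cf t [] = 0" "cf a [] = 0" "cf b [] = 0"
  shows "s = t"
proof -
  have "ordge n (s - t)" for n
  proof (induction n)
    case (Suc n)
    have "s - t = twist_step a b s - twist_step a b t" using assms(1,2) by metis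
    also have "\<dots> = s * (s - t) + (s - t) * (t - a + b)"
      by (simp add: twist_step_def algebra_simps)
    finally have "s - t = s * (s - t) + (s - t) * (t - a + b)" .
    moreover have "ordge (1 + n) (s * (s - t))" "ordge (n + 1) ((s - t) * (t - a + b))"
      by (rule ordge_mult; use Suc assms ordge_1 in \<open>force simp: ordge_1\<close>)+
    ultimately show ?case by (metis add.commute ordge_add plus_1_eq_Suc)
  qed simp
  then have "s - t = 0" by (rule ordge_zeroI)
  then show ?thesis by simp
qed

definition agree :: "nat \<Rightarrow> ('l, 'a) ser \<Rightarrow> ('l, 'a) ser \<Rightarrow> bool" where
  "agree n f g \<longleftrightarrow> (\<forall>w. length w < n \<longrightarrow> cf f w = cf g w)"

text \<open>The trivial splits vanish on both sides, and any other split has two strictly shorter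
  parts. The gained degree makes \<open>twist_step\<close> a contraction.\<close>

lemma agree_mult:
  assumes "agree n f f'" "agree n g g'" "cf f [] = 0" "cf f' [] = 0" "cf g [] = 0" "cf g' [] = 0"
  shows "agree (Suc n) (f * g) (f' * g')"
  unfolding agree_def cf_mult cmul_take_drop
proof (intro allI impI sum.cong refl)
  fix w :: "'a list" and i assume w: "length w < Suc n" "i \<in> {..length w}"
  show "cf f (take i w) * cf g (drop i w) = cf f' (take i w) * cf g' (drop i w)"
  proof (cases "i = 0 \<or> i = length w")
    case True then show ?thesis using assms by auto
  next
    case False
    then have "length (take i w) < n" "length (drop i w) < n" using w by auto
    then show ?thesis using assms unfolding agree_def by metis
  qed
qed

text \<open>The limit of the iteration from 0: the coefficient of w is final after
  \<open>Suc (length w)\<close> steps.\<close>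

definition xt :: "(letter, real) ser" where
  "xt = Ser (\<lambda>w. cf ((twist_step x y ^^ Suc (length w)) 0) w)"

definition yt :: "(letter, real) ser" where
  "yt = xt - x + y"

lemma xt_eq: "xt = twist_step x y xt" and cf_xt_Nil [simp]: "cf xt [] = 0"
proof -
  have s0: "cf (twist_step x y t) [] = 0" if "cf t [] = 0" for t
    by (simp add: twist_step_def that)
  define it where "it = (\<lambda>n. (twist_step x y ^^ n) 0)"
  have it0: "cf (it n) [] = 0" for n by (induction n) (simp_all add: it_def s0)
  have step: "agree (Suc n) (twist_step x y s) (twist_step x y t)"
    if "agree n s t" "cf s [] = 0" "cf t [] = 0" for n s t
    using agree_mult[of n s t "s - x + y" "t - x + y"] that by (auto simp: agree_def twist_step_def)
  have it1: "agree n (it n) (it (n + k))" for n k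
  proof (induction n)
    case 0 then show ?case by (simp add: agree_def)
  next
    case (Suc n)
    have "it (Suc m) = twist_step x y (it m)" for m by (simp add: it_def)
    then show ?case using step[OF Suc] it0 by simp
  qed
  have xt: "agree n xt (it n)" for n
    unfolding agree_def
  proof (intro allI impI)
    fix w :: word assume "length w < n"
    then obtain k where "n = Suc (length w) + k" by (metis Suc_leI le_add_diff_inverse)
    then have "cf (it (Suc (length w))) w = cf (it n) w"
      using it1[of "Suc (length w)" k] by (simp add: agree_def)
    then show "cf xt w = cf (it n) w" by (simp add: xt_def it_def)
  qed
  show x0: "cf xt [] = 0" using xt[of 1] it0 by (simp add: agree_def)
  show "xt = twist_step x y xt"
  proof (rule ser_eqI)
    fix w :: word
    let ?n = "length w"
    have "agree (Suc ?n) (twist_step x y xt) (twist_step x y (it ?n))"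
      by (rule step[OF xt x0 it0])
    moreover have "it (Suc ?n) = twist_step x y (it ?n)" by (simp add: it_def)
    ultimately show "cf xt w = cf (twist_step x y xt) w"
      using xt[of "Suc ?n"] by (simp add: agree_def)
  qed
qed

lemma cf_yt_Nil [simp]: "cf yt [] = 0" by (simp add: yt_def)

lemma twist_x: "xt * (1 - yt) = (1 - y) * x"
  using xt_eq by (simp add: twist_step_def yt_def algebra_simps)

lemma twist_y: "(1 - xt) * yt = y * (1 - x)"
  using twist_x by (simp add: yt_def algebra_simps)

definition tw :: "letter \<Rightarrow> (letter, real) ser" where
  "tw a = (case a of X \<Rightarrow> xt | Y \<Rightarrow> yt)"

lemma tw_simps [simp]: "tw X = xt" "tw Y = yt" by (simp_all add: tw_def)

lemma adm_tw: "adm tw" by (simp add: adm_letter)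

subsection \<open>The matrix representations\<close>

definition Vs :: "(letter, real) ser" where "Vs = star (x * y)"
text \<open>The geometric series of \<open>y * x\<close>, expressed through \<open>Vs\<close> so
  that one set of rewrite rules normalises both.\<close>

definition Ws :: "(letter, real) ser" where "Ws = 1 + y * Vs * x"

lemma Vs_left: "x * (y * Vs) = Vs - 1" and Vs_right: "Vs * (x * y) = Vs - 1"
  using star_eq[of "x * y"] by (simp_all add: Vs_def mult.assoc algebra_simps)

lemma Vs_left2: "x * (y * (Vs * r)) = Vs * r - r"
  using arg_cong[OF Vs_left, of "\<lambda>z. z * r"] by (simp add: mult.assoc left_diff_distrib)

lemma Vs_right2: "Vs * (x * (y * r)) = Vs * r - r"
  using arg_cong[OF Vs_right, of "\<lambda>z. z * r"] by (simp add: mult.assoc left_diff_distrib)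

lemmas Vs_rules = Vs_left Vs_right Vs_left2 Vs_right2

text \<open>The off-diagonal entries are what gets inserted where a run of one letter ends and a
  run of the other begins: \<open>1 - x - y\<close> at a junction where at most one neighbour may lose a letter,
  \<open>Vs\<close> and \<open>Ws\<close> where adjacent pairs of runs of length one may be removed.\<close>
definition rho_eo :: "letter \<Rightarrow> (letter, m2) ser" where
  "rho_eo a = (case a of X \<Rightarrow> comb x 0 (Vs * x) 0 | Y \<Rightarrow> comb 0 ((1 - x - y) * y) 0 y)"

definition rho_oe :: "letter \<Rightarrow> (letter, m2) ser" where
  "rho_oe a = (case a of X \<Rightarrow> comb x 0 ((1 - x - y) * x) 0 | Y \<Rightarrow> comb 0 (Ws * y) 0 y)"

lemma rho_simps: "rho_eo X = comb x 0 (Vs * x) 0" "rho_eo Y = comb 0 ((1 - x - y) * y) 0 y"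
  "rho_oe X = comb x 0 ((1 - x - y) * x) 0" "rho_oe Y = comb 0 (Ws * y) 0 y"
  by (simp_all add: rho_eo_def rho_oe_def)

lemma adm_rho: "adm rho_eo" "adm rho_oe"
  by (simp_all add: adm_letter rho_simps cf_comb_Nil)

text \<open>A closed form for the image of \<open>xt\<close>, of rank one: the column (1 - y(1 - y),
  1 - y) times x times the row (1, y). It is justified by uniqueness of the fixed point.\<close>

definition X_eo :: "(letter, m2) ser" where
  "X_eo = comb ((1 - y * (1 - y)) * x) ((1 - y * (1 - y)) * x * y) ((1 - y) * x) ((1 - y) * x * y)"

lemma X_eo_eq: "X_eo = twist_step (rho_eo X) (rho_eo Y) X_eo"
  unfolding twist_step_def X_eo_def rho_simps comb_one comb_add comb_diff comb_mult comb_eq_iff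
  by (simp add: algebra_simps Vs_rules)

lemma rho_eo_xt: "sb rho_eo xt = X_eo"
proof (rule twist_unique[OF _ X_eo_eq])
  have "sb rho_eo xt = sb rho_eo (twist_step x y xt)" by (subst (1) xt_eq) simp
  then show "sb rho_eo xt = twist_step (rho_eo X) (rho_eo Y) (sb rho_eo xt)"
    by (simp add: twist_step_def sb_mult sb_add sb_diff sb_1 sb_L adm_rho)
  show "cf (sb rho_eo xt) [] = 0"
    using sb_ordge[of 1 xt rho_eo] by (simp add: ordge_1[unfolded One_nat_def])
qed (simp_all add: X_eo_def cf_comb_Nil rho_simps)

text \<open>The product of two elementary matrices, with -x below and y above the diagonal; hence
  invertible.\<close>

definition Rm where "Rm = comb 1 y (- x) (1 - x * y)"
definition Ri where "Ri = comb (1 - y * x) (- y) x 1"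

lemma Rm_Ri: "Rm * Ri = 1" "Ri * Rm = 1"
  unfolding Rm_def Ri_def comb_mult comb_one comb_eq_iff by (simp_all add: algebra_simps)

text \<open>This is where the choice of the automorphism pays off. Checking letters suffices, since
  both sides extend to algebra homomorphisms (\<open>rho_eo_tw\<close>).\<close>

lemma conj_rho: "Rm * sb rho_eo (tw a) * Ri = rho_oe a"
proof (cases a)
  case X
  show ?thesis unfolding X
    unfolding tw_simps rho_eo_xt X_eo_def Rm_def Ri_def rho_simps comb_mult comb_eq_iff
    by (simp add: algebra_simps Vs_rules)
next
  case Y
  show ?thesis unfolding Y
    unfolding tw_simps yt_def sb_add sb_diff sb_L[OF adm_rho(1)] rho_eo_xt
    unfolding X_eo_def Rm_def Ri_def rho_simps comb_mult comb_eq_iff comb_add comb_diff Ws_def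
    by (simp add: algebra_simps Vs_rules)
qed

lemma rho_eo_tw: "Rm * sb rho_eo (sb tw f) * Ri = sb rho_oe f"
proof -
  have "Rm * sb rho_eo (sb tw f) * Ri = Rm * sb (\<lambda>k. sb rho_eo (tw k)) f * Ri"
    by (simp add: sb_sb adm_tw adm_rho)
  also have "\<dots> = sb (\<lambda>k. Rm * sb rho_eo (tw k) * Ri) f"
    by (rule sb_conj[symmetric]) (simp_all add: adm_sb adm_tw Rm_Ri)
  also have "\<dots> = sb rho_oe f" by (simp add: conj_rho)
  finally show ?thesis .
qed

section \<open>The operator T and the boundary vectors\<close>

definition ux where "ux = star x"
definition vy where "vy = star y"

lemma ux_inv: "(1 - x) * ux = 1" "ux * (1 - x) = 1" and vy_inv: "(1 - y) * vy = 1" "vy * (1 - y) = 1"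
  by (simp_all add: ux_def vy_def star_inverse)

definition nu :: "(word \<Rightarrow> real) \<Rightarrow> (letter, real) ser" where
  "nu F = Ser (\<lambda>m. F (Y # m @ [X]))"

text \<open>The part of a functional living on \<open>H^0\<close>.\<close>
definition res0 :: "(word \<Rightarrow> real) \<Rightarrow> (letter, real) ser" where
  "res0 F = F [] *\<^sub>R 1 + y * nu F * x"

text \<open>The operator T of the overview. Its outer factors convert the boundary vectors of
  \<open>evEO\<close> into those of \<open>evOE\<close>. That conversion needs a letter y in front
  and a letter x at the end, so the constant term is treated separately.\<close>

definition onestep :: "(word \<Rightarrow> real) \<Rightarrow> (letter, real) ser" where
  "onestep F = F [] *\<^sub>R (1 + vy * y * x * ux) + vy * (1 - xt) * sb tw (y * nu F * x) * (1 - yt) * ux"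

text \<open>Matrix indices record the previous letter, 1 for X and 2 for Y. The entry x of the start
  row cancels the -x that \<open>1 - x - y\<close> would put before a first y, leaving (1 - y)y; the
  column lets a final x-run lose a letter.\<close>

definition evEO :: "(letter, real) ser \<Rightarrow> (letter, real) ser" where
  "evEO f = e11 (comb 1 x 0 0 * sb rho_eo f * comb (1 - x) 0 1 0)"

text \<open>The state after an X is the initial one, so a first y is preceded by \<open>Ws\<close>;
  the column allows removed pairs y x behind a final x.\<close>

definition evOE :: "(letter, real) ser \<Rightarrow> (letter, real) ser" where
  "evOE f = e11 (sb rho_oe f * comb Ws 0 1 0)"

lemma linear_e11: "linear e11"
  by (rule linearI) (simp_all add: e11_def ser_eq_iff plus_m2_def scaleR_m2_def)

text \<open>The images of \<open>vy\<close> and \<open>ux\<close> turn the boundary vectors into (1,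
  x + y) and (1, 1 + Vs x). After conjugation to \<open>rho_oe\<close>, the remaining matrices act
  next to the outer letters y and x exactly like the boundary vectors of
  \<open>evOE\<close>.\<close>

theorem evEO_onestep: "evEO (onestep F) = evOE (res0 F)"
proof -
  define U where "U = sb rho_eo ux"
  define Vv where "Vv = sb rho_eo vy"
  define N where "N = sb rho_oe (nu F)"
  have hom: "sb rho_eo (f * g) = sb rho_eo f * sb rho_eo g" for f g by (rule sb_mult[OF adm_rho(1)])
  have one: "sb rho_eo 1 = 1" by (rule sb_1[OF adm_rho(1)])
  have "sb rho_eo ((1 - x) * ux) = 1" "sb rho_eo (vy * (1 - y)) = 1"
    "sb rho_eo (ux * (1 - x)) = 1" "sb rho_eo ((1 - y) * vy) = 1"
    by (simp_all add: ux_inv vy_inv one)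
  then have UV: "(1 - rho_eo X) * U = 1" "U * (1 - rho_eo X) = 1" "Vv * (1 - rho_eo Y) = 1" "(1 - rho_eo Y) * Vv = 1"
    by (simp_all add: hom sb_diff one sb_L adm_rho U_def Vv_def)
  have "comb 1 x 0 0 = comb 1 (x + y) 0 0 * (1 - rho_eo Y)"
    unfolding rho_simps comb_one comb_diff comb_mult comb_eq_iff by (simp add: algebra_simps)
  then have row: "comb 1 x 0 0 * Vv = comb 1 (x + y) 0 0"
    by (simp add: mult.assoc UV)
  have "comb (1 - x) 0 1 0 = (1 - rho_eo X) * comb 1 0 (1 + Vs * x) 0"
    unfolding rho_simps comb_one comb_diff comb_mult comb_eq_iff by (simp add: algebra_simps)
  then have col: "U * comb (1 - x) 0 1 0 = comb 1 0 (1 + Vs * x) 0"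
    by (simp add: mult.assoc[symmetric] UV)
  have tau: "sb rho_eo (sb tw f) = Ri * sb rho_oe f * Rm" for f
  proof -
    have "Ri * sb rho_oe f * Rm = Ri * (Rm * sb rho_eo (sb tw f) * Ri) * Rm" by (simp add: rho_eo_tw)
    also have "\<dots> = (Ri * Rm) * sb rho_eo (sb tw f) * (Ri * Rm)" by (simp only: mult.assoc)
    finally show ?thesis by (simp add: Rm_Ri)
  qed
  have xtm: "sb rho_eo (1 - xt) = 1 - X_eo" by (simp add: sb_diff one rho_eo_xt)
  have ytm: "sb rho_eo (1 - yt) = 1 - (X_eo - rho_eo X + rho_eo Y)"
    by (simp add: sb_diff sb_add one rho_eo_xt yt_def sb_L adm_rho)
  \<comment> \<open>Of a row (a, b) only \<open>a * Ws + b\<close> survives multiplication by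
    \<open>rho_oe Y\<close>; this is \<open>Ws\<close> on both sides.\<close>
  have start: "comb 1 (x + y) 0 0 * (1 - X_eo) * Ri * rho_oe Y = comb 1 0 0 0 * rho_oe Y"
    unfolding rho_simps comb_one comb_diff comb_mult comb_eq_iff X_eo_def Ri_def Ws_def
    by (simp add: algebra_simps Vs_rules)
  have "rho_oe X * (Rm * (1 - (X_eo - rho_eo X + rho_eo Y)) * comb 1 0 (1 + Vs * x) 0)
      = rho_oe X * comb Ws 0 1 0"
    unfolding rho_simps comb_one comb_diff comb_add comb_mult comb_eq_iff X_eo_def Rm_def Ws_def
    by (simp add: algebra_simps Vs_rules)
  then have fin: "rho_oe X * Rm * (1 - (X_eo - rho_eo X + rho_eo Y)) * comb 1 0 (1 + Vs * x) 0
      = rho_oe X * comb Ws 0 1 0"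
    by (simp only: mult.assoc)
  have A: "comb 1 x 0 0 * sb rho_eo (vy * (1 - xt) * sb tw (y * nu F * x) * (1 - yt) * ux) * comb (1 - x) 0 1 0
     = comb 1 0 0 0 * (sb rho_oe (y * nu F * x) * comb Ws 0 1 0)"
  proof -
    have "comb 1 x 0 0 * sb rho_eo (vy * (1 - xt) * sb tw (y * nu F * x) * (1 - yt) * ux) * comb (1 - x) 0 1 0
      = (comb 1 x 0 0 * Vv) * (1 - X_eo) * Ri * sb rho_oe (y * nu F * x) * Rm *
        (1 - (X_eo - rho_eo X + rho_eo Y)) * (U * comb (1 - x) 0 1 0)"
      by (simp only: hom tau xtm ytm mult.assoc U_def Vv_def)
    also have "\<dots> = (comb 1 (x + y) 0 0 * (1 - X_eo) * Ri * rho_oe Y) * N *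
        (rho_oe X * Rm * (1 - (X_eo - rho_eo X + rho_eo Y)) * comb 1 0 (1 + Vs * x) 0)"
      by (simp only: row col sb_mult[OF adm_rho(2)] sb_L[OF adm_rho(2)] N_def mult.assoc)
    also have "\<dots> = (comb 1 0 0 0 * rho_oe Y) * N * (rho_oe X * comb Ws 0 1 0)"
      by (simp only: start fin)
    also have "\<dots> = comb 1 0 0 0 * (sb rho_oe (y * nu F * x) * comb Ws 0 1 0)"
      by (simp only: sb_mult[OF adm_rho(2)] sb_L[OF adm_rho(2)] N_def mult.assoc)
    finally show ?thesis .
  qed
  have B: "comb 1 x 0 0 * sb rho_eo (1 + vy * y * x * ux) * comb (1 - x) 0 1 0 = comb 1 0 0 0 * comb Ws 0 1 0"
  proof -
    have "comb 1 x 0 0 * sb rho_eo (1 + vy * y * x * ux) * comb (1 - x) 0 1 0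
      = comb 1 x 0 0 * comb (1 - x) 0 1 0 + (comb 1 x 0 0 * Vv) * rho_eo Y * rho_eo X * (U * comb (1 - x) 0 1 0)"
      by (simp add: hom sb_add one sb_L adm_rho U_def Vv_def algebra_simps)
    also have "\<dots> = comb 1 0 0 0 * comb Ws 0 1 0"
      unfolding row col rho_simps comb_mult comb_add comb_eq_iff Ws_def
      by (simp add: algebra_simps Vs_rules)
    finally show ?thesis .
  qed
  have e: "e11 (comb 1 0 0 0 * G) = e11 G" for G
    using comb_surj[of G] by (auto simp: comb_mult)
  have "evEO (onestep F) = e11 (F [] *\<^sub>R (comb 1 0 0 0 * comb Ws 0 1 0)
      + comb 1 0 0 0 * (sb rho_oe (y * nu F * x) * comb Ws 0 1 0))"
    unfolding evEO_def onestep_def A[symmetric] B[symmetric]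
    by (subst sb_add, subst sb_scale) (simp only: distrib_left distrib_right mult_scaleR_left mult_scaleR_right)
  also have "\<dots> = F [] *\<^sub>R e11 (comb Ws 0 1 0) + e11 (sb rho_oe (y * nu F * x) * comb Ws 0 1 0)"
    by (simp only: linear_add[OF linear_e11] linear_scale[OF linear_e11] e)
  also have "\<dots> = evOE (res0 F)"
    by (simp add: evOE_def res0_def sb_add sb_scale sb_1 adm_rho distrib_right
        linear_add[OF linear_e11] linear_scale[OF linear_e11])
  finally show ?thesis .
qed

section \<open>The two sides of the recursion as list recursions\<close>

text \<open>Deleting the first entry of an index turns even-odd sets into odd-even ones, so both
  sums are handled by the odd-even recursion \<open>SO\<close>.\<close>
fun SO :: "(nat list \<Rightarrow> real) \<Rightarrow> nat list \<Rightarrow> real" where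
  "SO g [] = g []"
| "SO g [b] = g [b] - (if b > 1 then g [b - 1] else 0)"
| "SO g (a # b # cs) = SO (\<lambda>ds. g (a # b # ds)) cs
    - (if a > 1 then SO (\<lambda>ds. g ((a - 1) # b # ds)) cs else 0)
    - (if b > 1 then SO (\<lambda>ds. g (a # (b - 1) # ds)) cs else 0)
    + (if a = 1 \<and> b = 1 then SO g cs else 0)"

fun SE :: "(nat list \<Rightarrow> real) \<Rightarrow> nat list \<Rightarrow> real" where
  "SE g [] = g []"
| "SE g (a # cs) = SO (\<lambda>ds. g (a # ds)) cs - (if a > 1 then SO (\<lambda>ds. g ((a - 1) # ds)) cs else 0)"

abbreviation wei where "wei \<equiv> word_of_even_index"

definition valid :: "nat list \<Rightarrow> bool" where
  "valid c \<longleftrightarrow> even (length c) \<and> (\<forall>k\<in>set c. k > 0)"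

definition lqs :: "'l list \<Rightarrow> ('l, 'a) ser \<Rightarrow> ('l, 'a) ser" where
  "lqs u f = Ser (\<lambda>w. cf f (u @ w))"

lemma cf_lqs [simp]: "cf (lqs u f) w = cf f (u @ w)"
  by (simp add: lqs_def)

lemma lqs_Nil [simp]: "lqs [] f = f" and lqs_Cons: "lqs (a # u) f = lqs u (lq a f)"
  and lqs_append: "lqs (u @ v) f = lqs v (lqs u f)" and lqs_single: "lqs [a] f = lq a f"
  by (simp_all add: ser_eq_iff)

lemma ser_decomp: "f = cf f [] *\<^sub>R 1 + x * lq X f + y * lq Y f"
proof (rule ser_eqI)
  fix w show "cf f w = cf (cf f [] *\<^sub>R 1 + x * lq X f + y * lq Y f) w"
  proof (cases w)
    case (Cons a v) then show ?thesis by (cases a) (simp_all add: cf_L_mult)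
  qed simp
qed

lemma cf_xy_mult [simp]:
  "cf (x * f) (X # w) = cf f w" "cf (x * f) (Y # w) = 0"
  "cf (y * f) (Y # w) = cf f w" "cf (y * f) (X # w) = 0"
  by (simp_all add: cf_L_mult)

lemma linear_e21: "linear e21"
  by (rule linearI) (simp_all add: e21_def ser_eq_iff plus_m2_def scaleR_m2_def)

text \<open>The two components of the state vector: \<open>pO\<close> continues after a letter X,
  \<open>qO\<close> after a letter Y. Likewise \<open>pE\<close> and \<open>qE\<close>.\<close>

definition pO where "pO f = e11 (sb rho_oe f * comb Ws 0 1 0)"
definition qO where "qO f = e21 (sb rho_oe f * comb Ws 0 1 0)"
definition pE where "pE f = e11 (sb rho_eo f * comb (1 - x) 0 1 0)"
definition qE where "qE f = e21 (sb rho_eo f * comb (1 - x) 0 1 0)"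

lemma sb_decomp: "adm h \<Longrightarrow> sb h f = cf f [] *\<^sub>R 1 + h X * sb h (lq X f) + h Y * sb h (lq Y f)"
  by (subst ser_decomp) (simp add: sb_add sb_scale sb_mult sb_1 sb_L)

lemma e_mult: "e11 (comb a b c d * G) = a * e11 G + b * e21 G" "e21 (comb a b c d * G) = c * e11 G + d * e21 G"
  using comb_surj[of G] by (auto simp: comb_mult)

lemma pqO_rec:
  "pO f = cf f [] *\<^sub>R Ws + x * pO (lq X f) + Ws * y * qO (lq Y f)"
  "qO f = cf f [] *\<^sub>R 1 + (1 - x - y) * x * pO (lq X f) + y * qO (lq Y f)"
proof -
  have *: "sb rho_oe f * C = cf f [] *\<^sub>R C + rho_oe X * (sb rho_oe (lq X f) * C) + rho_oe Y * (sb rho_oe (lq Y f) * C)" for C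
    by (subst sb_decomp[OF adm_rho(2)]) (simp add: algebra_simps)
  show "pO f = cf f [] *\<^sub>R Ws + x * pO (lq X f) + Ws * y * qO (lq Y f)"
    unfolding pO_def qO_def
    by (subst *) (simp add: linear_add[OF linear_e11] linear_scale[OF linear_e11] rho_simps e_mult)
  show "qO f = cf f [] *\<^sub>R 1 + (1 - x - y) * x * pO (lq X f) + y * qO (lq Y f)"
    unfolding pO_def qO_def
    by (subst *) (simp add: linear_add[OF linear_e21] linear_scale[OF linear_e21] rho_simps e_mult)
qed

lemma pqE_rec:
  "pE f = cf f [] *\<^sub>R (1 - x) + x * pE (lq X f) + (1 - x - y) * y * qE (lq Y f)"
  "qE f = cf f [] *\<^sub>R 1 + Vs * x * pE (lq X f) + y * qE (lq Y f)"
proof -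
  have *: "sb rho_eo f * C = cf f [] *\<^sub>R C + rho_eo X * (sb rho_eo (lq X f) * C) + rho_eo Y * (sb rho_eo (lq Y f) * C)" for C
    by (subst sb_decomp[OF adm_rho(1)]) (simp add: algebra_simps)
  show "pE f = cf f [] *\<^sub>R (1 - x) + x * pE (lq X f) + (1 - x - y) * y * qE (lq Y f)"
    unfolding pE_def qE_def
    by (subst *) (simp add: linear_add[OF linear_e11] linear_scale[OF linear_e11] rho_simps e_mult)
  show "qE f = cf f [] *\<^sub>R 1 + Vs * x * pE (lq X f) + y * qE (lq Y f)"
    unfolding pE_def qE_def
    by (subst *) (simp add: linear_add[OF linear_e21] linear_scale[OF linear_e21] rho_simps e_mult)
qed

subsection \<open>Odd-even side\<close>

text \<open>The part of \<open>pO f\<close> in which the next letter of \<open>f\<close> is y or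
  missing; \<open>KO_eq\<close> splits off one inserted pair y x.\<close>

definition KO where "KO f = Ws * (cf f [] *\<^sub>R 1 + y * qO (lq Y f))"

lemma Ws_eq: "Ws = 1 + y * x * Ws"
  by (simp add: Ws_def algebra_simps Vs_rules)

lemma KO_eq: "KO f = cf f [] *\<^sub>R 1 + y * qO (lq Y f) + y * (x * KO f)"
  unfolding KO_def by (subst (1) Ws_eq) (simp add: algebra_simps)

lemma pO_KO: "pO f = x * pO (lq X f) + KO f"
  unfolding KO_def by (subst pqO_rec(1)) (simp add: algebra_simps)

lemma cf_KO: "cf (KO f) [] = cf f []" "cf (KO f) (X # w) = 0"
    "cf (KO f) (Y # w) = cf (qO (lq Y f)) w + cf (x * KO f) w"
  using arg_cong[OF KO_eq[of f], of "\<lambda>g. cf g []"] arg_cong[OF KO_eq[of f], of "\<lambda>g. cf g (X # w)"]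
    arg_cong[OF KO_eq[of f], of "\<lambda>g. cf g (Y # w)"] by simp_all

lemma cf_pO: "cf (pO f) [] = cf f []" "cf (pO f) (X # w) = cf (pO (lq X f)) w"
    "cf (pO f) (Y # w) = cf (KO f) (Y # w)"
  by (subst pO_KO, simp add: cf_KO)+

lemma cf_qO: "cf (qO f) (X # w) = cf (pO (lq X f)) w - cf (x * pO (lq X f)) w"
    "cf (qO f) (Y # w) = cf (qO (lq Y f)) w - cf (x * pO (lq X f)) w"
  by (subst pqO_rec(2), simp add: algebra_simps)+

lemma cf_pO_X: "cf (pO f) (replicate n X @ w) = cf (pO (lqs (replicate n X) f)) w"
  by (induction n arbitrary: f) (simp_all add: cf_pO lqs_Cons)

lemma cf_qO_X: "n > 0 \<Longrightarrow> w = [] \<or> hd w = Y \<Longrightarrow> cf (qO f) (replicate n X @ w)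
    = cf (pO (lqs (replicate n X) f)) w - (if n > 1 then cf (pO (lqs (replicate (n - 1) X) f)) w else 0)"
proof (cases n)
  case (Suc m)
  assume w: "w = [] \<or> hd w = Y"
  show ?thesis
  proof (cases m)
    case 0
    have "cf (x * pO (lq X f)) w = 0" using w by (cases w) auto
    then show ?thesis using Suc 0 by (simp add: cf_qO lqs_Cons)
  next
    case (Suc k)
    then show ?thesis using \<open>n = Suc m\<close> by (simp add: cf_qO cf_pO cf_pO_X lqs_Cons)
  qed
qed simp

lemma cf_qO_Y: "cf (qO f) (replicate n Y @ X # w)
    = cf (qO (lqs (replicate n Y) f)) (X # w)
      - (if n > 0 then cf (pO (lqs (replicate (n - 1) Y @ [X]) f)) w else 0)"
proof (induction n arbitrary: f)
  case (Suc n)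
  show ?case
  proof (cases n)
    case 0 then show ?thesis by (simp add: cf_qO lqs_Cons)
  next
    case (Suc k)
    then show ?thesis using Suc.IH[of "lq Y f"] by (simp add: cf_qO lqs_Cons)
  qed
qed simp

lemma cf_KO_nonX: "w = [] \<or> hd w = Y \<Longrightarrow> cf (KO f) w = cf (pO f) w"
proof (cases w)
  case (Cons a v)
  assume "w = [] \<or> hd w = Y"
  then show ?thesis using Cons by (simp add: cf_pO)
qed (simp add: cf_KO cf_pO)

text \<open>Inside the block y^a x^b the junction contributes 1, -y or -x, which gives the first
  three terms. The last term is an inserted pair y x that fills the whole block.\<close>

lemma pO_block:
  assumes "a > 0" "b > 0" "w = [] \<or> hd w = Y"
  shows "cf (pO f) (replicate a Y @ replicate b X @ w)
    = cf (pO (lqs (replicate a Y @ replicate b X) f)) w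
      - (if a > 1 then cf (pO (lqs (replicate (a - 1) Y @ replicate b X) f)) w else 0)
      - (if b > 1 then cf (pO (lqs (replicate a Y @ replicate (b - 1) X) f)) w else 0)
      + (if a = 1 \<and> b = 1 then cf (pO f) w else 0)"
proof -
  obtain a' b' where ab: "a = Suc a'" "b = Suc b'" using assms gr0_implies_Suc by blast
  let ?r = "replicate b' X @ w"
  have 1: "cf (pO f) (replicate a Y @ replicate b X @ w)
    = cf (qO (lq Y f)) (replicate a' Y @ X # ?r) + cf (x * KO f) (replicate a' Y @ X # ?r)"
    by (simp add: ab cf_pO cf_KO)
  have 2: "cf (x * KO f) (replicate a' Y @ X # ?r) = (if a = 1 \<and> b = 1 then cf (pO f) w else 0)"
  proof (cases a')
    case 0
    have "cf (KO f) ?r = (if b' = 0 then cf (pO f) w else 0)"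
      by (cases b') (simp_all add: cf_KO cf_KO_nonX assms)
    then show ?thesis by (simp add: 0 ab)
  qed (simp add: ab)
  have 3: "cf (qO (lq Y f)) (replicate a' Y @ X # ?r) =
     cf (qO (lqs (replicate a' Y) (lq Y f))) (X # ?r)
     - (if a' > 0 then cf (pO (lqs (replicate (a' - 1) Y @ [X]) (lq Y f))) ?r else 0)"
    by (rule cf_qO_Y)
  have 4: "cf (qO (lqs (replicate a' Y) (lq Y f))) (X # ?r) =
      cf (pO (lqs (replicate a Y @ replicate b X) f)) w
      - (if b > 1 then cf (pO (lqs (replicate a Y @ replicate (b - 1) X) f)) w else 0)"
    using cf_qO_X[of b w "lqs (replicate a' Y) (lq Y f)"] assms
    by (simp add: ab lqs_Cons lqs_append)
  have 5: "cf (pO (lqs (replicate (a' - 1) Y @ [X]) (lq Y f))) ?r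
      = cf (pO (lqs (replicate (a - 1) Y @ replicate b X) f)) w" if "a' > 0"
    using that by (cases a') (simp_all add: ab cf_pO_X lqs_Cons lqs_append)
  show ?thesis unfolding 1 2 3 4 using 5 by (simp add: ab)
qed

lemma wei_hd: "\<forall>k\<in>set c. k > 0 \<Longrightarrow> wei c = [] \<or> hd (wei c) = Y"
proof (cases c rule: word_of_even_index.cases)
  case (1 a b cs)
  assume "\<forall>k\<in>set c. k > 0"
  then obtain a' where "a = Suc a'" using 1 gr0_implies_Suc by auto
  then show ?thesis using 1 by simp
qed simp_all

lemma SO_cong:
  assumes "\<And>ds. length ds mod 2 = length c mod 2 \<Longrightarrow> g ds = g' ds"
  shows "SO g c = SO g' c"
  using assms
proof (induction g c arbitrary: g' rule: SO.induct)
  case (3 g a b cs)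
  have "SO (\<lambda>ds. g (u # v # ds)) cs = SO (\<lambda>ds. g' (u # v # ds)) cs"
    if "\<And>h. (\<And>ds. length ds mod 2 = length cs mod 2 \<Longrightarrow> g (u # v # ds) = h ds) \<Longrightarrow> SO (\<lambda>ds. g (u # v # ds)) cs = SO h cs"
    for u v by (rule that) (simp add: "3.prems" mod_Suc)
  note * = this
  have "SO g cs = SO g' cs" if "a = 1 \<and> b = 1" using "3.IH"(4)[OF that, of g'] "3.prems" by (simp add: mod_Suc)
  then show ?case using *[OF "3.IH"(1)] *[OF "3.IH"(2)] *[OF "3.IH"(3)] by simp
qed simp_all

theorem cf_evOE:
  assumes "valid c"
  shows "cf (evOE f) (wei c) = SO (\<lambda>ds. cf f (wei ds)) c"
proof -
  have "cf (pO f) (wei c) = SO (\<lambda>ds. cf f (wei ds)) c"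
    using assms
  proof (induction c arbitrary: f rule: word_of_even_index.induct)
    case (1 a b cs)
    then have v: "valid cs" "a > 0" "b > 0" by (auto simp: valid_def)
    have IH: "cf (pO (lqs (replicate a' Y @ replicate b' X) f)) (wei cs)
        = SO (\<lambda>ds. cf f (replicate a' Y @ replicate b' X @ wei ds)) cs" for a' b'
      using "1.IH"[OF v(1), of "lqs (replicate a' Y @ replicate b' X) f"] by simp
    have w: "wei cs = [] \<or> hd (wei cs) = Y" using v(1) wei_hd by (auto simp: valid_def)
    show ?case
      unfolding SO.simps word_of_even_index.simps pO_block[OF v(2,3) w] IH "1.IH"[OF v(1), of f]
      by (rule refl)
  qed (simp_all add: valid_def cf_pO)
  then show ?thesis by (simp add: evOE_def pO_def)
qed

subsection \<open>Even-odd side\<close>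

definition KE where "KE f = Vs * (x * pE (lq X f))"

lemma KE_eq: "KE f = x * pE (lq X f) + x * (y * KE f)"
  unfolding KE_def by (simp add: algebra_simps Vs_rules)

lemma qE_KE: "qE f = cf f [] *\<^sub>R 1 + y * qE (lq Y f) + KE f"
  unfolding KE_def by (subst pqE_rec(2)) (simp add: algebra_simps)

lemma cf_KE: "cf (KE f) [] = 0" "cf (KE f) (Y # w) = 0"
    "cf (KE f) (X # w) = cf (pE (lq X f)) w + cf (y * KE f) w"
  using arg_cong[OF KE_eq[of f], of "\<lambda>g. cf g []"] arg_cong[OF KE_eq[of f], of "\<lambda>g. cf g (Y # w)"]
    arg_cong[OF KE_eq[of f], of "\<lambda>g. cf g (X # w)"] by simp_all

lemma cf_qE: "cf (qE f) (Y # w) = cf (qE (lq Y f)) w" "cf (qE f) (X # w) = cf (KE f) (X # w)"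
  by (subst qE_KE, simp add: cf_KE)+

lemma cf_pE: "cf (pE f) [] = cf f []"
    "cf (pE f) (X # w) = cf (pE (lq X f)) w - (if w = [] then cf f [] else 0) - cf (y * qE (lq Y f)) w"
    "cf (pE f) (Y # w) = cf (qE (lq Y f)) w - cf (y * qE (lq Y f)) w"
  by (subst pqE_rec(1), simp add: algebra_simps cf_L cf_one)+

lemma cf_qE_Y: "cf (qE f) (replicate n Y @ w) = cf (qE (lqs (replicate n Y) f)) w"
  by (induction n arbitrary: f) (simp_all add: cf_qE lqs_Cons)

lemma cf_pE_Y: "n > 0 \<Longrightarrow> hd w = X \<Longrightarrow> w \<noteq> [] \<Longrightarrow> cf (pE f) (replicate n Y @ w)
    = cf (qE (lqs (replicate n Y) f)) w - (if n > 1 then cf (qE (lqs (replicate (n - 1) Y) f)) w else 0)"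
proof (cases n)
  case (Suc m)
  assume w: "hd w = X" "w \<noteq> []"
  show ?thesis
  proof (cases m)
    case 0
    have "cf (y * qE (lq Y f)) w = 0" using w by (cases w) auto
    then show ?thesis using Suc 0 by (simp add: cf_pE lqs_Cons)
  next
    case (Suc k)
    then show ?thesis using \<open>n = Suc m\<close> by (simp add: cf_pE cf_qE cf_qE_Y lqs_Cons)
  qed
qed simp

lemma cf_pE_X: "cf (pE f) (replicate n X @ Y # w)
    = cf (pE (lqs (replicate n X) f)) (Y # w)
      - (if n > 0 then cf (qE (lqs (replicate (n - 1) X @ [Y]) f)) w else 0)"
proof (induction n arbitrary: f)
  case (Suc n)
  show ?case
  proof (cases n)
    case 0 then show ?thesis by (simp add: cf_pE lqs_Cons)
  next
    case (Suc k)
    then show ?thesis using Suc.IH[of "lq X f"] by (simp add: cf_pE lqs_Cons)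
  qed
qed simp

lemma cf_pE_X_end: "cf (pE f) (replicate n X)
    = cf f (replicate n X) - (if n > 0 then cf f (replicate (n - 1) X) else 0)"
proof (induction n arbitrary: f)
  case (Suc n)
  then show ?case by (cases n) (simp_all add: cf_pE)
qed (simp add: cf_pE)

lemma qE_end:
  assumes "b > 0"
  shows "cf (qE f) (replicate b X) = cf f (replicate b X) - (if b > 1 then cf f (replicate (b - 1) X) else 0)"
proof -
  obtain b' where b: "b = Suc b'" using assms gr0_implies_Suc by blast
  have "cf (y * KE f) (replicate b' X) = 0" by (cases b') simp_all
  moreover have "0 < b' \<Longrightarrow> X # replicate (b' - 1) X = replicate b' X" by (cases b') simp_all
  ultimately show ?thesis by (simp add: b cf_qE cf_KE cf_pE_X_end)
qed

lemma qE_block: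
  assumes "b > 0" "a > 0" "w \<noteq> []" "hd w = X"
  shows "cf (qE f) (replicate b X @ replicate a Y @ w)
    = cf (qE (lqs (replicate b X @ replicate a Y) f)) w
      - (if b > 1 then cf (qE (lqs (replicate (b - 1) X @ replicate a Y) f)) w else 0)
      - (if a > 1 then cf (qE (lqs (replicate b X @ replicate (a - 1) Y) f)) w else 0)
      + (if b = 1 \<and> a = 1 then cf (qE f) w else 0)"
proof -
  obtain a' b' where ab: "a = Suc a'" "b = Suc b'" using assms gr0_implies_Suc by blast
  let ?r = "replicate a' Y @ w"
  have 1: "cf (qE f) (replicate b X @ replicate a Y @ w)
    = cf (pE (lq X f)) (replicate b' X @ Y # ?r) + cf (y * KE f) (replicate b' X @ Y # ?r)"
    by (simp add: ab cf_qE cf_KE)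
  have 2: "cf (y * KE f) (replicate b' X @ Y # ?r) = (if b = 1 \<and> a = 1 then cf (qE f) w else 0)"
  proof (cases b')
    case 0
    have "cf (KE f) w = cf (qE f) w" using assms by (cases w) (auto simp: cf_qE)
    then have "cf (KE f) ?r = (if a' = 0 then cf (qE f) w else 0)"
      by (cases a') (simp_all add: cf_KE)
    then show ?thesis by (simp add: 0 ab)
  qed (simp add: ab)
  have 3: "cf (pE (lq X f)) (replicate b' X @ Y # ?r) =
     cf (pE (lqs (replicate b' X) (lq X f))) (Y # ?r)
     - (if b' > 0 then cf (qE (lqs (replicate (b' - 1) X @ [Y]) (lq X f))) ?r else 0)"
    by (rule cf_pE_X)
  have 4: "cf (pE (lqs (replicate b' X) (lq X f))) (Y # ?r) =
      cf (qE (lqs (replicate b X @ replicate a Y) f)) w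
      - (if a > 1 then cf (qE (lqs (replicate b X @ replicate (a - 1) Y) f)) w else 0)"
    using cf_pE_Y[of a w "lqs (replicate b' X) (lq X f)"] assms
    by (simp add: ab lqs_Cons lqs_append)
  have 5: "cf (qE (lqs (replicate (b' - 1) X @ [Y]) (lq X f))) ?r
      = cf (qE (lqs (replicate (b - 1) X @ replicate a Y) f)) w" if "b' > 0"
    using that by (cases b') (simp_all add: ab cf_qE_Y lqs_Cons lqs_append)
  show ?thesis unfolding 1 2 3 4 using 5 by (simp add: ab)
qed

text \<open>Words that begin with an x-run. The even-odd side couples an x-run with the following
  y-run, so once the first y-run is split off it proceeds in blocks x^b y^a.\<close>

fun wxi :: "nat list \<Rightarrow> word" where
  "wxi [] = []"
| "wxi (b # ds) = replicate b X @ wei ds"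

lemma wxi_Cons2: "wxi (b # a # ds) = replicate b X @ replicate a Y @ wxi ds" if "odd (length ds)"
  using that by (cases ds) simp_all

lemma qE_SO: "odd (length c) \<Longrightarrow> \<forall>k\<in>set c. k > 0 \<Longrightarrow> cf (qE f) (wxi c) = SO (\<lambda>ds. cf f (wxi ds)) c"
proof (induction c arbitrary: f rule: word_of_even_index.induct)
  case (1 b a cs)
  then have v: "odd (length cs)" "\<forall>k\<in>set cs. k > 0" "a > 0" "b > 0" by auto
  have IH: "cf (qE (lqs (replicate b' X @ replicate a' Y) f)) (wxi cs)
      = SO (\<lambda>ds. cf f (wxi (b' # a' # ds))) cs" for a' b'
  proof -
    have "SO (\<lambda>ds. cf (lqs (replicate b' X @ replicate a' Y) f) (wxi ds)) cs
        = SO (\<lambda>ds. cf f (wxi (b' # a' # ds))) cs"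
      by (rule SO_cong) (use v(1) in \<open>auto simp: wxi_Cons2 odd_iff_mod_2_eq_one simp del: wxi.simps\<close>)
    then show ?thesis using "1.IH"[OF v(1,2)] by simp
  qed
  have w: "wxi cs \<noteq> []" "hd (wxi cs) = X"
    using v(1,2) by (cases cs; auto simp: gr0_conv_Suc)+
  show ?case
    using qE_block[OF v(4,3) w, of f] "1.IH"[OF v(1,2), of f]
    by (simp add: IH wxi_Cons2[OF v(1)] del: wxi.simps)
qed (simp_all add: qE_end)

theorem cf_evEO:
  assumes "valid c"
  shows "cf (evEO f) (wei c) = SE (\<lambda>ds. cf f (wei ds)) c"
proof -
  have e: "evEO f = pE f + x * qE f"
    by (simp add: evEO_def pE_def qE_def mult.assoc e_mult)
  show ?thesis
  proof (cases c)
    case Nil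
    then show ?thesis by (simp add: e cf_pE)
  next
    case (Cons a cs)
    then have v: "odd (length cs)" "\<forall>k\<in>set cs. k > 0" "a > 0" using assms by (auto simp: valid_def)
    then have w: "wxi cs \<noteq> []" "hd (wxi cs) = X" by (cases cs; auto simp: gr0_conv_Suc)+
    have wc: "wei (a' # ds) = replicate a' Y @ wxi ds" if "odd (length ds)" for a' ds
      using that by (cases ds) simp_all
    have "cf (x * qE f) (wei c) = 0"
      using v(3) wc[OF v(1), of a] Cons by (cases a) simp_all
    moreover have "cf (pE f) (wei c) = SE (\<lambda>ds. cf f (wei ds)) c"
    proof -
      have IH: "cf (qE (lqs (replicate a' Y) f)) (wxi cs) = SO (\<lambda>ds. cf f (wei (a' # ds))) cs" for a'
      proof -
        have "SO (\<lambda>ds. cf (lqs (replicate a' Y) f) (wxi ds)) cs = SO (\<lambda>ds. cf f (wei (a' # ds))) cs"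
          by (rule SO_cong) (use v(1) in \<open>auto simp: wc odd_iff_mod_2_eq_one\<close>)
        then show ?thesis using qE_SO[OF v(1,2)] by simp
      qed
      show ?thesis
        using cf_pE_Y[OF v(3) w(2,1), of f] by (simp add: IH Cons wc[OF v(1)])
    qed
    ultimately show ?thesis by (simp add: e)
  qed
qed

section \<open>Index sets\<close>

text \<open>The index pairs of the third sum of the recursion without the bound on
  \<open>card A + card B\<close>; \<open>EOP\<close> plays the same part for the first two
  sums.\<close>

definition OEP :: "nat list \<Rightarrow> (nat set \<times> nat set) set" where
  "OEP c = {(A, B). A \<subseteq> ones c \<and> odd_even A \<and> B \<subseteq> gt1 c \<and>
     (\<forall>r\<in>{1..length c div 2}. \<not> {2 * r - 1, 2 * r} \<subseteq> B)}"

definition EOP :: "nat list \<Rightarrow> (nat set \<times> nat set) set" where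
  "EOP c = {(A, B). A \<subseteq> ones c \<and> even_odd A \<and> B \<subseteq> gt1 c \<and>
     (\<forall>r\<in>{1..length c div 2 - 1}. \<not> {2 * r, 2 * r + 1} \<subseteq> B)}"

definition up :: "nat \<Rightarrow> nat set \<Rightarrow> nat set" where
  "up k A = (\<lambda>i. i + k) ` A"

lemma mem_up: "i \<in> up k A \<longleftrightarrow> k \<le> i \<and> i - k \<in> A"
  by (force simp: up_def)

lemma card_up [simp]: "card (up k A) = card A"
  by (simp add: up_def card_image)

lemma finite_up [simp]: "finite (up k A) \<longleftrightarrow> finite A"
  by (simp add: up_def finite_image_iff)

lemma ones_pos: "ones c \<subseteq> {1..}" and gt1_pos: "gt1 c \<subseteq> {1..}"
  and finite_ones [simp]: "finite (ones c)" and finite_gt1 [simp]: "finite (gt1 c)"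
  by (auto simp: ones_def gt1_def)

lemma mem_ones_Cons: "i \<in> ones (a # cs) \<longleftrightarrow> i = 1 \<and> a = 1 \<or> i > 1 \<and> i - 1 \<in> ones cs"
  by (cases i; cases "i - 1") (auto simp: ones_def)

lemma mem_gt1_Cons: "i \<in> gt1 (a # cs) \<longleftrightarrow> i = 1 \<and> a > 1 \<or> i > 1 \<and> i - 1 \<in> gt1 cs"
  by (cases i; cases "i - 1") (auto simp: gt1_def)

lemma ones_Cons: "ones (a # cs) = (if a = 1 then {1} else {}) \<union> up 1 (ones cs)"
  using ones_pos[of cs] by (auto simp: mem_ones_Cons mem_up)

lemma gt1_Cons: "gt1 (a # cs) = (if a > 1 then {1} else {}) \<union> up 1 (gt1 cs)"
  using gt1_pos[of cs] by (auto simp: mem_gt1_Cons mem_up)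

lemma finite_OEP [simp]: "finite (OEP c)" and finite_EOP [simp]: "finite (EOP c)"
proof -
  have "finite (Pow (ones c) \<times> Pow (gt1 c))" by simp
  then show "finite (OEP c)" "finite (EOP c)"
    by (rule finite_subset[rotated], auto simp: OEP_def EOP_def)+
qed

lemma reduce_Cons:
  "reduce (a # cs) A B = (if 1 \<in> A then [] else [a - (if 1 \<in> B then 1 else 0)]) @
     reduce cs {i. i + 1 \<in> A} {i. i + 1 \<in> B}"
proof -
  have "[1..<length (a # cs) + 1] = 1 # map Suc [1..<length cs + 1]"
    by (simp add: map_Suc_upt upt_conv_Cons del: upt_Suc)
  moreover have "map (\<lambda>i. (a # cs) ! (i - 1) - (if i \<in> B then 1 else 0)) (filter (\<lambda>i. i \<notin> A) (map Suc [1..<length cs + 1]))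
      = map (\<lambda>i. cs ! (i - 1) - (if i + 1 \<in> B then 1 else 0)) (filter (\<lambda>i. i + 1 \<notin> A) [1..<length cs + 1])"
    by (auto simp: filter_map comp_def nth_Cons' intro!: map_cong)
  ultimately show ?thesis by (simp add: reduce_def del: upt_Suc)
qed

lemma reduce_cong:
  assumes "\<And>i. i > 0 \<Longrightarrow> i \<in> A \<longleftrightarrow> i \<in> A'" "\<And>i. i > 0 \<Longrightarrow> i \<in> B \<longleftrightarrow> i \<in> B'"
  shows "reduce c A B = reduce c A' B'"
proof -
  have "filter (\<lambda>i. i \<notin> A) [1..<length c + 1] = filter (\<lambda>i. i \<notin> A') [1..<length c + 1]"
    by (rule filter_cong[OF refl]) (use assms in \<open>auto simp del: upt_Suc\<close>)
  then show ?thesis unfolding reduce_def using assms by (auto intro!: map_cong simp del: upt_Suc)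
qed

text \<open>The possible traces of an odd-even pair \<open>(A, B)\<close> on the first block \<open>{1, 2}\<close>.\<close>
definition opts :: "nat \<Rightarrow> nat \<Rightarrow> (nat set \<times> nat set) set" where
  "opts a b = {({}, {})} \<union> (if a > 1 then {({}, {1})} else {}) \<union> (if b > 1 then {({}, {2})} else {})
    \<union> (if a = 1 \<and> b = 1 then {({1, 2}, {})} else {})"

lemma opts_iff: "(A, B) \<in> opts a b \<longleftrightarrow> A \<subseteq> {1, 2} \<and> B \<subseteq> {1, 2} \<and> (1 \<in> A \<longrightarrow> a = 1) \<and> (2 \<in> A \<longrightarrow> b = 1)
   \<and> (1 \<in> A \<longleftrightarrow> 2 \<in> A) \<and> (1 \<in> B \<longrightarrow> a > 1) \<and> (2 \<in> B \<longrightarrow> b > 1) \<and> \<not> {1, 2} \<subseteq> B"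
proof -
  have s: "A \<subseteq> {1, 2} \<longleftrightarrow> A = {} \<or> A = {1} \<or> A = {2} \<or> A = {1, 2}" for A :: "nat set" by auto
  show ?thesis unfolding s[of A] s[of B] by (auto simp: opts_def split: if_splits)
qed

lemma odd_even_up:
  assumes "A0 \<subseteq> {1, 2}" "A \<subseteq> {1..}"
  shows "odd_even (A0 \<union> up 2 A) \<longleftrightarrow> (1 \<in> A0 \<longleftrightarrow> 2 \<in> A0) \<and> odd_even A"
proof -
  have m: "i \<in> A0 \<union> up 2 A \<longleftrightarrow> (i \<in> A0 \<and> i \<le> 2) \<or> (i > 2 \<and> i - 2 \<in> A)" for i
    using assms by (auto simp: mem_up)
  have "odd_even (A0 \<union> up 2 A) \<longleftrightarrow> (\<forall>i. i \<in> A0 \<union> up 2 A \<longrightarrow> (odd i \<longrightarrow> i + 1 \<in> A0 \<union> up 2 A) \<and> (even i \<longrightarrow> i - 1 \<in> A0 \<union> up 2 A))"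
    by (auto simp: odd_even_def)
  also have "\<dots> \<longleftrightarrow> (\<forall>i\<in>A0. (odd i \<longrightarrow> i + 1 \<in> A0 \<union> up 2 A) \<and> (even i \<longrightarrow> i - 1 \<in> A0 \<union> up 2 A)) \<and>
      (\<forall>j\<in>A. (odd (j + 2) \<longrightarrow> j + 2 + 1 \<in> A0 \<union> up 2 A) \<and> (even (j + 2) \<longrightarrow> j + 2 - 1 \<in> A0 \<union> up 2 A))"
    by (auto simp: up_def)
  also have "(\<forall>i\<in>A0. (odd i \<longrightarrow> i + 1 \<in> A0 \<union> up 2 A) \<and> (even i \<longrightarrow> i - 1 \<in> A0 \<union> up 2 A)) \<longleftrightarrow> (1 \<in> A0 \<longleftrightarrow> 2 \<in> A0)"
    unfolding m using assms(1) by (auto simp: numeral_2_eq_2)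
  also have "(\<forall>j\<in>A. (odd (j + 2) \<longrightarrow> j + 2 + 1 \<in> A0 \<union> up 2 A) \<and> (even (j + 2) \<longrightarrow> j + 2 - 1 \<in> A0 \<union> up 2 A)) \<longleftrightarrow> odd_even A"
    unfolding m odd_even_def
  proof (intro ball_cong refl conj_cong imp_cong)
    fix j assume "j \<in> A"
    then have j: "j \<ge> 1" using assms by auto
    show "odd (j + 2) = odd j" "even (j + 2) = even j" by simp_all
    show "(j + 2 + 1 \<in> A0 \<and> j + 2 + 1 \<le> 2 \<or> 2 < j + 2 + 1 \<and> j + 2 + 1 - 2 \<in> A) = (j + 1 \<in> A)" by simp
    show "(j + 2 - 1 \<in> A0 \<and> j + 2 - 1 \<le> 2 \<or> 2 < j + 2 - 1 \<and> j + 2 - 1 - 2 \<in> A) = (j - 1 \<in> A)" if "even j"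
    proof -
      have "j \<noteq> 1" using that by auto
      then have "j \<ge> 2" using j by simp
      then show ?thesis by (simp add: numeral_2_eq_2)
    qed
  qed
  finally show ?thesis .
qed

lemma pairs_up:
  assumes "B0 \<subseteq> {1, 2}" "B \<subseteq> {1..}"
  shows "(\<forall>r\<in>{1..Suc m}. \<not> {2 * r - 1, 2 * r} \<subseteq> B0 \<union> up 2 B) \<longleftrightarrow>
     \<not> {1, 2} \<subseteq> B0 \<and> (\<forall>r\<in>{1..m}. \<not> {2 * r - 1, 2 * r} \<subseteq> B)"
proof -
  have m: "i \<in> B0 \<union> up 2 B \<longleftrightarrow> (i \<in> B0 \<and> i \<le> 2) \<or> (i > 2 \<and> i - 2 \<in> B)" for i
    using assms by (auto simp: mem_up)
  have e: "{1..Suc m} = insert 1 (Suc ` {1..m})" by (auto simp: image_iff)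
  have "(\<forall>r\<in>{1..Suc m}. \<not> {2 * r - 1, 2 * r} \<subseteq> B0 \<union> up 2 B) \<longleftrightarrow>
     \<not> {1, 2} \<subseteq> B0 \<union> up 2 B \<and> (\<forall>r\<in>{1..m}. \<not> {2 * r + 1, 2 * r + 2} \<subseteq> B0 \<union> up 2 B)"
    unfolding e by (simp del: image_Suc_atLeastAtMost)
  also have "\<not> {1, 2} \<subseteq> B0 \<union> up 2 B \<longleftrightarrow> \<not> {1, 2} \<subseteq> B0" using m[of 1] m[of 2] by auto
  also have "(\<forall>r\<in>{1..m}. \<not> {2 * r + 1, 2 * r + 2} \<subseteq> B0 \<union> up 2 B) \<longleftrightarrow> (\<forall>r\<in>{1..m}. \<not> {2 * r - 1, 2 * r} \<subseteq> B)"
  proof (intro ball_cong refl)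
    fix r :: nat assume "r \<in> {1..m}"
    then show "(\<not> {2 * r + 1, 2 * r + 2} \<subseteq> B0 \<union> up 2 B) = (\<not> {2 * r - 1, 2 * r} \<subseteq> B)"
      using m[of "2 * r + 1"] m[of "2 * r + 2"] by (simp add: numeral_2_eq_2)
  qed
  finally show ?thesis .
qed

lemma OEP_mem:
  assumes "A0 \<subseteq> {1, 2}" "B0 \<subseteq> {1, 2}" "A \<subseteq> {1..}" "B \<subseteq> {1..}"
  shows "(A0 \<union> up 2 A, B0 \<union> up 2 B) \<in> OEP (a # b # cs) \<longleftrightarrow> (A0, B0) \<in> opts a b \<and> (A, B) \<in> OEP cs"
proof -
  have "C0 \<union> up 2 C \<subseteq> Z \<longleftrightarrow> (1 \<in> C0 \<longrightarrow> 1 \<in> Z) \<and> (2 \<in> C0 \<longrightarrow> 2 \<in> Z) \<and> (\<forall>j\<in>C. j + 2 \<in> Z)"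
    if "C0 \<subseteq> {1, 2}" for C0 C Z using that by (auto simp: up_def)
  note sub = this
  have o: "A0 \<union> up 2 A \<subseteq> ones (a # b # cs) \<longleftrightarrow> (1 \<in> A0 \<longrightarrow> a = 1) \<and> (2 \<in> A0 \<longrightarrow> b = 1) \<and> A \<subseteq> ones cs"
    unfolding sub[OF assms(1)] using assms(3) by (auto simp: mem_ones_Cons numeral_2_eq_2)
  have g: "B0 \<union> up 2 B \<subseteq> gt1 (a # b # cs) \<longleftrightarrow> (1 \<in> B0 \<longrightarrow> a > 1) \<and> (2 \<in> B0 \<longrightarrow> b > 1) \<and> B \<subseteq> gt1 cs"
    unfolding sub[OF assms(2)] using assms(4) by (auto simp: mem_gt1_Cons numeral_2_eq_2)
  have l: "length (a # b # cs) div 2 = Suc (length cs div 2)" by simp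
  show ?thesis
    unfolding OEP_def opts_iff mem_Collect_eq prod.case o g l odd_even_up[OF assms(1,3)] pairs_up[OF assms(2,4)]
    using assms by blast
qed

lemma split_up:
  assumes "A \<subseteq> {1..}"
  obtains A0 A1 where "A = A0 \<union> up 2 A1" "A0 \<subseteq> {1, 2 :: nat}" "A1 \<subseteq> {1..}"
proof
  show "A = (A \<inter> {1, 2}) \<union> up 2 {i \<in> {1..}. i + 2 \<in> A}"
  proof (intro set_eqI)
    fix i show "i \<in> A \<longleftrightarrow> i \<in> (A \<inter> {1, 2}) \<union> up 2 {i \<in> {1..}. i + 2 \<in> A}"
    proof (cases "i \<le> 2")
      case True
      then show ?thesis using assms by (auto simp: mem_up numeral_2_eq_2 le_Suc_eq)
    next
      case False
      define j where "j = i - 3"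
      have i: "i = Suc (Suc (Suc j))" using False by (simp add: j_def)
      show ?thesis unfolding i by (auto simp: mem_up numeral_2_eq_2)
    qed
  qed
qed auto

definition glue :: "(nat set \<times> nat set) \<times> (nat set \<times> nat set) \<Rightarrow> nat set \<times> nat set" where
  "glue = (\<lambda>((A0, B0), (A, B)). (A0 \<union> up 2 A, B0 \<union> up 2 B))"

lemma OEP_pos: "(A, B) \<in> OEP c \<Longrightarrow> A \<subseteq> {1..} \<and> B \<subseteq> {1..}"
  using ones_pos[of c] gt1_pos[of c] unfolding OEP_def by blast

text \<open>The odd-even conditions couple only the positions 2r - 1 and 2r, so the index set is a
  product over blocks.\<close>

lemma OEP_Cons2: "OEP (a # b # cs) = glue ` (opts a b \<times> OEP cs)"
proof (intro equalityI subsetI)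
  fix p assume p: "p \<in> OEP (a # b # cs)"
  obtain A B where AB: "p = (A, B)" by force
  then have "A \<subseteq> {1..}" "B \<subseteq> {1..}" using p OEP_pos by blast+
  then obtain A0 A1 B0 B1 where *: "A = A0 \<union> up 2 A1" "A0 \<subseteq> {1, 2}" "A1 \<subseteq> {1..}"
      "B = B0 \<union> up 2 B1" "B0 \<subseteq> {1, 2}" "B1 \<subseteq> {1..}" by (metis split_up)
  then have "((A0, B0), (A1, B1)) \<in> opts a b \<times> OEP cs"
    using p OEP_mem[OF *(2,5,3,6)] by (simp add: AB)
  moreover have "p = glue ((A0, B0), (A1, B1))" by (simp add: glue_def AB *)
  ultimately show "p \<in> glue ` (opts a b \<times> OEP cs)" by blast
next
  fix p assume "p \<in> glue ` (opts a b \<times> OEP cs)"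
  then obtain A0 B0 A B where *: "p = (A0 \<union> up 2 A, B0 \<union> up 2 B)" "(A0, B0) \<in> opts a b" "(A, B) \<in> OEP cs"
    by (auto simp: glue_def)
  then show "p \<in> OEP (a # b # cs)"
    using OEP_mem[of A0 B0 A B a b cs] OEP_pos[of A B cs] opts_iff by auto
qed

lemma glue_inj: "inj_on glue (opts a b \<times> OEP cs)"
proof -
  have "A0 = A0' \<and> A = A'"
    if "A0 \<union> up 2 A = A0' \<union> up 2 A'" "A0 \<subseteq> {1, 2}" "A0' \<subseteq> {1, 2}" "A \<subseteq> {1..}" "A' \<subseteq> {1..}"
    for A0 A A0' A' :: "nat set"
  proof
    have g: "C0 = (C0 \<union> up 2 C) \<inter> {1, 2} \<and> C = {i. i \<ge> 1 \<and> i + 2 \<in> C0 \<union> up 2 C}"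
      if "C0 \<subseteq> {1, 2}" "C \<subseteq> {1..}" for C0 C :: "nat set"
      using that by (auto simp: mem_up numeral_2_eq_2)
    have "A0 = (A0 \<union> up 2 A) \<inter> {1, 2}" "A0' = (A0' \<union> up 2 A') \<inter> {1, 2}"
      using g[OF that(2,4)] g[OF that(3,5)] by blast+
    then show "A0 = A0'" using that(1) by simp
    have "A = {i. i \<ge> 1 \<and> i + 2 \<in> A0 \<union> up 2 A}" "A' = {i. i \<ge> 1 \<and> i + 2 \<in> A0' \<union> up 2 A'}"
      using g[OF that(2,4)] g[OF that(3,5)] by blast+
    then show "A = A'" using that(1) by simp
  qed
  note * = this
  show ?thesis
  proof (rule inj_onI)
    fix p q assume pq: "p \<in> opts a b \<times> OEP cs" "q \<in> opts a b \<times> OEP cs" "glue p = glue q"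
    obtain A0 B0 A B A0' B0' A' B' where p: "p = ((A0, B0), (A, B))" and q: "q = ((A0', B0'), (A', B'))"
      by (metis surj_pair)
    have a: "(A0, B0) \<in> opts a b" "(A, B) \<in> OEP cs" "(A0', B0') \<in> opts a b" "(A', B') \<in> OEP cs"
      using pq p q by auto
    have e: "A0 \<union> up 2 A = A0' \<union> up 2 A'" "B0 \<union> up 2 B = B0' \<union> up 2 B'" using pq(3) p q by (auto simp: glue_def)
    show "p = q"
    proof -
      have o: "A0 \<subseteq> {1, 2}" "B0 \<subseteq> {1, 2}" "A0' \<subseteq> {1, 2}" "B0' \<subseteq> {1, 2}"
        using a(1,3) unfolding opts_iff by blast+
      have "A \<subseteq> {1..}" "B \<subseteq> {1..}" "A' \<subseteq> {1..}" "B' \<subseteq> {1..}"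
        using OEP_pos a(2,4) by blast+
      then show ?thesis using *[OF e(1) o(1,3)] *[OF e(2) o(2,4)] by (simp add: p q)
    qed
  qed
qed

definition sgn_red :: "(nat list \<Rightarrow> real) \<Rightarrow> nat list \<Rightarrow> nat set \<times> nat set \<Rightarrow> real" where
  "sgn_red g c = (\<lambda>(A, B). (-1) ^ card B * g (reduce c A B))"

lemma OEP_fin: "(A, B) \<in> OEP c \<Longrightarrow> finite A \<and> finite B"
  unfolding OEP_def using finite_subset[of A "ones c"] finite_subset[of B "gt1 c"] by auto

lemma reduce_glue:
  assumes "A0 \<subseteq> {1, 2}" "B0 \<subseteq> {1, 2}" "A \<subseteq> {1..}" "B \<subseteq> {1..}"
  shows "reduce (a # b # cs) (A0 \<union> up 2 A) (B0 \<union> up 2 B) =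
    (if 1 \<in> A0 then [] else [a - (if 1 \<in> B0 then 1 else 0)]) @
    (if 2 \<in> A0 then [] else [b - (if 2 \<in> B0 then 1 else 0)]) @ reduce cs A B"
proof -
  have "reduce cs {i. i + 1 \<in> {i. i + 1 \<in> A0 \<union> up 2 A}} {i. i + 1 \<in> {i. i + 1 \<in> B0 \<union> up 2 B}} = reduce cs A B"
    using assms by (intro reduce_cong) (auto simp: mem_up)
  moreover have "0 \<notin> A" "0 \<notin> B" using assms by auto
  ultimately show ?thesis using assms by (simp add: reduce_Cons mem_up numeral_2_eq_2)
qed

lemma card_glue:
  assumes "A0 \<subseteq> {1, 2}" "A \<subseteq> {1..}" "finite A"
  shows "card (A0 \<union> up 2 A) = card A0 + card A"
proof -
  have "0 \<notin> A" "\<And>i. i \<in> A0 \<Longrightarrow> i \<le> 2" using assms by auto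
  then have "A0 \<inter> up 2 A = {}" by (auto simp: mem_up)
  then show ?thesis using assms finite_subset[of A0 "{1, 2}"] by (subst card_Un_disjoint) auto
qed

lemma sgn_red_glue:
  assumes "(A0, B0) \<in> opts a b" "(A, B) \<in> OEP cs"
  shows "sgn_red g (a # b # cs) (glue ((A0, B0), (A, B))) = (-1) ^ card B0 *
    sgn_red (\<lambda>ds. g ((if 1 \<in> A0 then [] else [a - (if 1 \<in> B0 then 1 else 0)]) @
    (if 2 \<in> A0 then [] else [b - (if 2 \<in> B0 then 1 else 0)]) @ ds)) cs (A, B)"
proof -
  have "A0 \<subseteq> {1, 2}" "B0 \<subseteq> {1, 2}" using assms(1) by (simp_all add: opts_iff)
  then show ?thesis
    using OEP_pos[OF assms(2)] OEP_fin[OF assms(2)]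
    by (simp add: sgn_red_def glue_def reduce_glue card_glue power_add)
qed

lemma finite_opts [simp]: "finite (opts a b)" by (simp add: opts_def)

lemma OEP_Nil: "OEP [] = {({}, {})}"
  by (auto simp: OEP_def ones_def gt1_def odd_even_def)

lemma OEP_single: "OEP [b] = {({}, {})} \<union> (if b > 1 then {({}, {1})} else {})"
proof -
  have A: "A = {}" if "A \<subseteq> ones [b]" "odd_even A" for A
  proof (rule ccontr)
    assume "A \<noteq> {}"
    moreover have "A \<subseteq> {1}" using that(1) by (auto simp: ones_def)
    ultimately have "A = {1}" by blast
    then show False using that(2) by (simp add: odd_even_def)
  qed
  have g: "gt1 [b] = (if b > 1 then {1} else {})" by (auto simp: gt1_def)
  have "odd_even {}" by (simp add: odd_even_def)
  then have "OEP [b] = {({}, B) | B. B \<subseteq> gt1 [b]}" using A by (auto simp: OEP_def)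
  also have "\<dots> = {({}, {})} \<union> (if b > 1 then {({}, {1})} else {})"
    unfolding g by (simp add: subset_singleton_iff) blast
  finally show ?thesis .
qed

text \<open>The sum over the product set splits along the first block, and the possible members of
  \<open>opts\<close> yield the four terms of \<open>SO\<close>.\<close>

theorem SO_sum: "(\<Sum>p\<in>OEP c. sgn_red g c p) = SO g c"
proof (induction g c rule: SO.induct)
  case (1 g)
  then show ?case by (simp add: OEP_Nil sgn_red_def reduce_def)
next
  case (2 g b)
  then show ?case by (simp add: OEP_single sgn_red_def reduce_def)
next
  case (3 g a b cs)
  let ?F = "\<lambda>A0 B0 ds. (if (1::nat) \<in> A0 then [] else [a - (if (1::nat) \<in> B0 then 1 else 0)]) @
    (if (2::nat) \<in> A0 then [] else [b - (if (2::nat) \<in> B0 then 1 else 0)]) @ ds"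
  have "(\<Sum>p\<in>OEP (a # b # cs). sgn_red g (a # b # cs) p)
      = (\<Sum>q\<in>opts a b \<times> OEP cs. sgn_red g (a # b # cs) (glue q))"
    unfolding OEP_Cons2 by (rule sum.reindex_cong[OF glue_inj]) auto
  also have "\<dots> = (\<Sum>(A0, B0)\<in>opts a b. \<Sum>p\<in>OEP cs. (-1) ^ card B0 * sgn_red (\<lambda>ds. g (?F A0 B0 ds)) cs p)"
  proof -
    have "(\<Sum>q\<in>opts a b \<times> OEP cs. sgn_red g (a # b # cs) (glue q))
        = (\<Sum>(q, p)\<in>opts a b \<times> OEP cs. sgn_red g (a # b # cs) (glue (q, p)))"
      by (rule sum.cong) auto
    also have "\<dots> = (\<Sum>q\<in>opts a b. \<Sum>p\<in>OEP cs. sgn_red g (a # b # cs) (glue (q, p)))"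
      by (rule sum.cartesian_product[symmetric])
    also have "\<dots> = (\<Sum>(A0, B0)\<in>opts a b. \<Sum>p\<in>OEP cs. (-1) ^ card B0 * sgn_red (\<lambda>ds. g (?F A0 B0 ds)) cs p)"
      by (intro sum.cong refl) (auto intro!: sum.cong simp: sgn_red_glue simp del: append_Cons split del: if_split)
    finally show ?thesis .
  qed
  also have "\<dots> = (\<Sum>(A0, B0)\<in>opts a b. (-1) ^ card B0 * (\<Sum>p\<in>OEP cs. sgn_red (\<lambda>ds. g (?F A0 B0 ds)) cs p))"
    by (simp add: sum_distrib_left)
  also have "\<dots> = SO g (a # b # cs)"
    using "3.IH" by (auto simp: opts_def sum.insert_if)
  finally show ?case .
qed

section \<open>Even-odd pairs as shifted odd-even pairs\<close>

lemma up1_mem: "i \<in> up (Suc 0) A \<longleftrightarrow> i \<ge> Suc 0 \<and> i - Suc 0 \<in> A"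
  by (simp add: mem_up)

lemma even_odd_up:
  assumes "A \<subseteq> {1..}"
  shows "even_odd (up 1 A) \<longleftrightarrow> odd_even A"
proof -
  have "even_odd (up 1 A) \<longleftrightarrow> (\<forall>j\<in>A. (even (j + 1) \<longrightarrow> j + 1 + 1 \<in> up 1 A) \<and> (odd (j + 1) \<longrightarrow> j + 1 - 1 \<in> up 1 A))"
    unfolding even_odd_def by (auto simp: up_def)
  also have "\<dots> \<longleftrightarrow> odd_even A"
    unfolding odd_even_def
  proof (intro ball_cong refl)
    fix j assume "j \<in> A"
    then have "j \<ge> 1" using assms by auto
    then show "((even (j + 1) \<longrightarrow> j + 1 + 1 \<in> up 1 A) \<and> (odd (j + 1) \<longrightarrow> j + 1 - 1 \<in> up 1 A))
      = ((odd j \<longrightarrow> j + 1 \<in> A) \<and> (even j \<longrightarrow> j - 1 \<in> A))"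
      by (auto simp: up1_mem)
  qed
  finally show ?thesis .
qed

lemma EOP_mem:
  assumes "B0 \<subseteq> {1}" "A \<subseteq> {1..}" "B \<subseteq> {1..}" "odd (length cs)"
  shows "(up 1 A, B0 \<union> up 1 B) \<in> EOP (a # cs) \<longleftrightarrow> (1 \<in> B0 \<longrightarrow> a > 1) \<and> (A, B) \<in> OEP cs"
proof -
  have o: "up 1 A \<subseteq> ones (a # cs) \<longleftrightarrow> A \<subseteq> ones cs"
    using assms(2) by (auto simp: up_def mem_ones_Cons image_subset_iff)
  have g: "B0 \<union> up 1 B \<subseteq> gt1 (a # cs) \<longleftrightarrow> (1 \<in> B0 \<longrightarrow> a > 1) \<and> B \<subseteq> gt1 cs"
    using assms(1,3) by (auto simp: up_def mem_gt1_Cons image_subset_iff)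
  have l: "length (a # cs) div 2 - 1 = length cs div 2"
    using assms(4) by (auto elim!: oddE)
  have p: "(\<forall>r\<in>{1..m}. \<not> {2 * r, 2 * r + 1} \<subseteq> B0 \<union> up 1 B) \<longleftrightarrow> (\<forall>r\<in>{1..m}. \<not> {2 * r - 1, 2 * r} \<subseteq> B)" for m
  proof (intro ball_cong refl)
    fix r :: nat assume "r \<in> {1..m}"
    then have "2 * r \<notin> B0" "2 * r + 1 \<notin> B0" using assms(1) by (auto simp: subset_singleton_iff)
    then show "(\<not> {2 * r, 2 * r + 1} \<subseteq> B0 \<union> up 1 B) = (\<not> {2 * r - 1, 2 * r} \<subseteq> B)"
      using \<open>r \<in> {1..m}\<close> by (simp add: up1_mem)
  qed
  show ?thesis
    unfolding OEP_def EOP_def mem_Collect_eq prod.case o g l even_odd_up[OF assms(2)] p by blast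
qed

definition glue1 :: "nat set \<times> (nat set \<times> nat set) \<Rightarrow> nat set \<times> nat set" where
  "glue1 = (\<lambda>(B0, (A, B)). (up 1 A, B0 \<union> up 1 B))"

definition opts1 :: "nat \<Rightarrow> nat set set" where
  "opts1 a = (if a > 1 then {{}, {1}} else {{}})"

lemma opts1_iff: "B \<in> opts1 a \<longleftrightarrow> B \<subseteq> {1} \<and> (1 \<in> B \<longrightarrow> a > 1)"
  by (auto simp: opts1_def subset_singleton_iff)

text \<open>Position 1 cannot lie in an even-odd A, because it would force 0 into A. Behind it, the
  even-odd conditions become the odd-even ones after a shift by one.\<close>

lemma EOP_Cons:
  assumes "odd (length cs)"
  shows "EOP (a # cs) = glue1 ` (opts1 a \<times> OEP cs)"
proof (intro equalityI subsetI)
  fix p assume p: "p \<in> EOP (a # cs)"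
  obtain A B where AB: "p = (A, B)" by force
  have pos: "A \<subseteq> {1..}" "B \<subseteq> {1..}"
    using p ones_pos[of "a # cs"] gt1_pos[of "a # cs"] unfolding AB EOP_def by blast+
  have "1 \<notin> A"
  proof
    assume "1 \<in> A"
    then have "0 \<in> A" using p unfolding AB EOP_def even_odd_def by fastforce
    then show False using pos by auto
  qed
  define A1 where "A1 = {i. i \<ge> 1 \<and> i + 1 \<in> A}"
  define B1 where "B1 = {i. i \<ge> 1 \<and> i + 1 \<in> B}"
  define B0 where "B0 = B \<inter> {1}"
  have s: "C = (C \<inter> {1}) \<union> up 1 {i. i \<ge> 1 \<and> i + 1 \<in> C}" if "C \<subseteq> {1..}" for C
    using that by (auto simp: up1_mem)
  have A: "A = up 1 A1" using s[OF pos(1)] \<open>1 \<notin> A\<close> by (auto simp: A1_def)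
  have B: "B = B0 \<union> up 1 B1" using s[OF pos(2)] by (simp add: B0_def B1_def)
  have "B0 \<subseteq> {1}" "A1 \<subseteq> {1..}" "B1 \<subseteq> {1..}" by (auto simp: A1_def B1_def B0_def)
  then have "(B0, (A1, B1)) \<in> opts1 a \<times> OEP cs"
    using EOP_mem[of B0 A1 B1 cs a] assms p by (simp add: AB A B opts1_iff)
  moreover have "p = glue1 (B0, (A1, B1))" using A B by (simp add: glue1_def AB)
  ultimately show "p \<in> glue1 ` (opts1 a \<times> OEP cs)" by blast
next
  fix p assume "p \<in> glue1 ` (opts1 a \<times> OEP cs)"
  then obtain B0 A B where *: "p = (up 1 A, B0 \<union> up 1 B)" "B0 \<in> opts1 a" "(A, B) \<in> OEP cs"
    by (auto simp: glue1_def)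
  then show "p \<in> EOP (a # cs)"
    using EOP_mem[of B0 A B cs a] OEP_pos[of A B cs] assms by (auto simp: opts1_iff)
qed

lemma glue1_inj: "inj_on glue1 (opts1 a \<times> OEP cs)"
proof (rule inj_onI)
  fix p q assume pq: "p \<in> opts1 a \<times> OEP cs" "q \<in> opts1 a \<times> OEP cs" "glue1 p = glue1 q"
  obtain B0 A B B0' A' B' where p: "p = (B0, (A, B))" and q: "q = (B0', (A', B'))"
    by (metis surj_pair)
  have e: "up 1 A = up 1 A'" "B0 \<union> up 1 B = B0' \<union> up 1 B'" using pq p q by (auto simp: glue1_def)
  have "B0 \<in> opts1 a" "B0' \<in> opts1 a" "(A, B) \<in> OEP cs" "(A', B') \<in> OEP cs" using pq p q by auto
  then have b: "B0 \<subseteq> {1}" "B0' \<subseteq> {1}" "A \<subseteq> {1..}" "A' \<subseteq> {1..}" "B \<subseteq> {1..}" "B' \<subseteq> {1..}"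
    using OEP_pos unfolding opts1_iff by blast+
  have r: "C0 = (C0 \<union> up 1 C) \<inter> {1} \<and> C = {i. i \<ge> 1 \<and> i + 1 \<in> C0 \<union> up 1 C}"
    if "C0 \<subseteq> {1}" "C \<subseteq> {1..}" for C0 C using that by (auto simp: up1_mem)
  have "A = {i. i \<ge> 1 \<and> i + 1 \<in> {} \<union> up 1 A}" "A' = {i. i \<ge> 1 \<and> i + 1 \<in> {} \<union> up 1 A'}"
    by (rule r[OF empty_subsetI b(3), THEN conjunct2], rule r[OF empty_subsetI b(4), THEN conjunct2])
  then have "A = A'" unfolding e(1) by (rule trans[OF _ sym])
  moreover have "B = B'"
    by (rule trans[OF r[OF b(1,5), THEN conjunct2] trans[OF _ r[OF b(2,6), THEN conjunct2, symmetric]]]) (simp only: e(2))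
  moreover have "B0 = B0'"
    by (rule trans[OF r[OF b(1,5), THEN conjunct1] trans[OF _ r[OF b(2,6), THEN conjunct1, symmetric]]]) (simp only: e(2))
  ultimately show "p = q" by (simp add: p q)
qed

lemma reduce_glue1:
  assumes "B0 \<subseteq> {1}" "A \<subseteq> {1..}" "B \<subseteq> {1..}"
  shows "reduce (a # cs) (up 1 A) (B0 \<union> up 1 B) = (a - (if 1 \<in> B0 then 1 else 0)) # reduce cs A B"
proof -
  have "reduce cs {i. i + 1 \<in> up 1 A} {i. i + 1 \<in> B0 \<union> up 1 B} = reduce cs A B"
    using assms by (intro reduce_cong) (auto simp: up1_mem)
  moreover have "0 \<notin> A" "0 \<notin> B" using assms by auto
  ultimately show ?thesis using assms by (simp add: reduce_Cons up1_mem)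
qed

lemma card_glue1:
  assumes "B0 \<subseteq> {1}" "B \<subseteq> {1..}" "finite B"
  shows "card (B0 \<union> up 1 B) = card B0 + card B"
proof -
  have "0 \<notin> B" "\<And>i. i \<in> B0 \<Longrightarrow> i = 1" using assms by auto
  then have "B0 \<inter> up 1 B = {}" by (fastforce simp: mem_up)
  then show ?thesis using assms finite_subset[of B0 "{1}"] by (subst card_Un_disjoint) auto
qed

lemma sgn_red_glue1:
  assumes "B0 \<in> opts1 a" "p \<in> OEP cs"
  shows "sgn_red g (a # cs) (glue1 (B0, p)) = (-1) ^ card B0 *
    sgn_red (\<lambda>ds. g ((a - (if 1 \<in> B0 then 1 else 0)) # ds)) cs p"
proof -
  obtain A B where p: "p = (A, B)" by force
  have "B0 \<subseteq> {1}" using assms(1) by (simp add: opts1_iff)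
  then have "reduce (a # cs) (up 1 A) (B0 \<union> up 1 B) = (a - (if 1 \<in> B0 then 1 else 0)) # reduce cs A B"
    "card (B0 \<union> up 1 B) = card B0 + card B"
    using OEP_pos[OF assms(2)[unfolded p]] OEP_fin[OF assms(2)[unfolded p]]
    by (blast intro: reduce_glue1, blast intro: card_glue1)
  then show ?thesis by (simp add: p sgn_red_def glue1_def power_add)
qed

lemma EOP_Nil: "EOP [] = {({}, {})}"
  by (auto simp: EOP_def ones_def gt1_def even_odd_def)

theorem SE_sum:
  assumes "even (length c)"
  shows "(\<Sum>p\<in>EOP c. sgn_red g c p) = SE g c"
proof (cases c)
  case Nil
  then show ?thesis by (simp add: EOP_Nil sgn_red_def reduce_def)
next
  case (Cons a cs)
  then have o: "odd (length cs)" using assms by simp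
  have "(\<Sum>p\<in>EOP (a # cs). sgn_red g (a # cs) p)
      = (\<Sum>q\<in>opts1 a \<times> OEP cs. sgn_red g (a # cs) (glue1 q))"
    unfolding EOP_Cons[OF o] by (rule sum.reindex_cong[OF glue1_inj]) auto
  also have "\<dots> = (\<Sum>(B0, p)\<in>opts1 a \<times> OEP cs. sgn_red g (a # cs) (glue1 (B0, p)))"
    by (rule sum.cong) auto
  also have "\<dots> = (\<Sum>B0\<in>opts1 a. \<Sum>p\<in>OEP cs. sgn_red g (a # cs) (glue1 (B0, p)))"
    by (rule sum.cartesian_product[symmetric])
  also have "\<dots> = (\<Sum>B0\<in>opts1 a. (-1) ^ card B0 *
      (\<Sum>p\<in>OEP cs. sgn_red (\<lambda>ds. g ((a - (if 1 \<in> B0 then 1 else 0)) # ds)) cs p))"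
    by (auto intro!: sum.cong simp: sgn_red_glue1 sum_distrib_left split del: if_split)
  also have "\<dots> = SE g (a # cs)"
    by (simp add: SO_sum opts1_def)
  finally show ?thesis using Cons by simp
qed

section \<open>Weight and length of reduced indices\<close>

definition ncard :: "nat set \<times> nat set \<Rightarrow> nat" where
  "ncard p = card (fst p) + card (snd p)"

definition red :: "nat list \<Rightarrow> nat set \<times> nat set \<Rightarrow> nat list" where
  "red c p = reduce c (fst p) (snd p)"

text \<open>A deletes entries equal to 1, always two at a time, and B lowers entries by one; so
  parity of the length is kept and the weight drops by \<open>ncard p\<close>.\<close>

lemma OEP_red:
  assumes "\<forall>k\<in>set c. k > 0" "p \<in> OEP c"
  shows "even (length (red c p)) = even (length c) \<and> (\<forall>k\<in>set (red c p). k > 0)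
    \<and> sum_list (red c p) + ncard p = sum_list c"
  using assms
proof (induction c arbitrary: p rule: word_of_even_index.induct)
  case (1 a b cs)
  then obtain q where q: "p = glue q" "q \<in> opts a b \<times> OEP cs" unfolding OEP_Cons2 by blast
  obtain A0 B0 A B where "q = ((A0, B0), (A, B))" by (metis surj_pair)
  then have p: "p = glue ((A0, B0), (A, B))" "(A0, B0) \<in> opts a b" "(A, B) \<in> OEP cs" using q by auto
  have s: "A0 \<subseteq> {1, 2}" "B0 \<subseteq> {1, 2}" using p(2) by (simp_all add: opts_iff)
  have r: "red (a # b # cs) p = (if 1 \<in> A0 then [] else [a - (if 1 \<in> B0 then 1 else 0)]) @
    (if 2 \<in> A0 then [] else [b - (if 2 \<in> B0 then 1 else 0)]) @ red cs (A, B)"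
    using reduce_glue[OF s] OEP_pos[OF p(3)] by (simp add: red_def p(1) glue_def)
  have n: "ncard p = card A0 + card B0 + ncard (A, B)"
    using card_glue[OF s(1)] card_glue[OF s(2)] OEP_pos[OF p(3)] OEP_fin[OF p(3)]
    by (simp add: ncard_def p(1) glue_def)
  have IH: "even (length (red cs (A, B))) = even (length cs) \<and> (\<forall>k\<in>set (red cs (A, B)). k > 0)
    \<and> sum_list (red cs (A, B)) + ncard (A, B) = sum_list cs"
    using "1.IH"[of "(A, B)"] "1.prems" p(3) by simp
  have ab: "a > 0" "b > 0" using "1.prems" by auto
  have "A0 = {} \<and> B0 = {} \<or> a > 1 \<and> A0 = {} \<and> B0 = {1} \<or> b > 1 \<and> A0 = {} \<and> B0 = {2}
      \<or> a = 1 \<and> b = 1 \<and> A0 = {1, 2} \<and> B0 = {}"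
    using p(2) by (simp add: opts_def split: if_splits)
  then show ?case unfolding r n using IH ab by (elim disjE conjE) simp_all
next
  case "2_1"
  then show ?case by (auto simp: OEP_Nil red_def reduce_def ncard_def)
next
  case ("2_2" v)
  then show ?case by (auto simp: OEP_single red_def reduce_def ncard_def split: if_splits)
qed

text \<open>The first entry is never deleted, hence a nonempty index stays nonempty.\<close>

lemma EOP_red:
  assumes "valid c" "p \<in> EOP c"
  shows "valid (red c p) \<and> sum_list (red c p) + ncard p = sum_list c \<and> (c \<noteq> [] \<longrightarrow> red c p \<noteq> [])"
proof (cases c)
  case Nil
  then show ?thesis using assms by (auto simp: EOP_Nil red_def reduce_def ncard_def valid_def)
next
  case (Cons a cs)
  then have o: "odd (length cs)" "a > 0" "\<forall>k\<in>set cs. k > 0" using assms by (auto simp: valid_def)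
  obtain q where q: "p = glue1 q" "q \<in> opts1 a \<times> OEP cs"
    using assms(2) unfolding Cons EOP_Cons[OF o(1)] by blast
  obtain B0 A B where "q = (B0, (A, B))" by (metis surj_pair)
  then have p: "p = glue1 (B0, (A, B))" "B0 \<in> opts1 a" "(A, B) \<in> OEP cs" using q by auto
  have s: "B0 \<subseteq> {1}" using p(2) by (simp add: opts1_iff)
  have r: "red c p = (a - (if 1 \<in> B0 then 1 else 0)) # red cs (A, B)"
    using reduce_glue1[OF s] OEP_pos[OF p(3)] by (simp add: red_def p(1) glue1_def Cons)
  have n: "ncard p = card B0 + ncard (A, B)"
    using card_glue1[OF s] OEP_pos[OF p(3)] OEP_fin[OF p(3)] by (simp add: ncard_def p(1) glue1_def)
  show ?thesis unfolding r n using OEP_red[OF o(3) p(3)] p(2) o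
    by (auto simp: opts1_def Cons valid_def split: if_splits)
qed

lemma OEP_red_valid:
  assumes "valid c" "p \<in> OEP c"
  shows "valid (red c p)" "sum_list (red c p) + ncard p = sum_list c"
  using OEP_red[of c p] assms by (auto simp: valid_def)

lemma finite_P: "p \<in> EOP c \<union> OEP c \<Longrightarrow> finite (fst p) \<and> finite (snd p)"
  using finite_subset[OF _ finite_ones[of c]] finite_subset[OF _ finite_gt1[of c]]
  by (auto simp: EOP_def OEP_def)

lemma ncard_0: "p \<in> EOP c \<union> OEP c \<Longrightarrow> ncard p = 0 \<longleftrightarrow> p = ({}, {})"
  using finite_P[of p c] by (cases p) (auto simp: ncard_def)

lemma empty_mem: "({}, {}) \<in> EOP c" "({}, {}) \<in> OEP c"
  by (auto simp: EOP_def OEP_def even_odd_def odd_even_def)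

lemma red_empty [simp]: "red c ({}, {}) = c"
proof -
  have "map (\<lambda>i. c ! (i - 1)) [1..<length c + 1] = c"
    by (rule nth_equalityI) (simp_all del: upt_Suc)
  then show ?thesis by (simp add: red_def reduce_def del: upt_Suc)
qed

text \<open>An element of A brings its neighbour along, so A is empty and B a singleton, which
  satisfies both kinds of conditions. Hence the terms with \<open>ncard p = 1\<close> that are
  missing from the last two sums of the recursion would cancel.\<close>

lemma single_ncard: "{p \<in> EOP c. ncard p = 1} = {p \<in> OEP c. ncard p = 1}"
proof -
  have e: "A = {} \<and> (\<exists>i. B = {i})" if "finite A" "finite B" "card A + card B = 1" "0 \<notin> A" "even_odd A \<or> odd_even A" for A B :: "nat set"
  proof -
    have "A = {}"
    proof (rule ccontr)
      assume "A \<noteq> {}"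
      then have "card A > 0" using that(1) by (simp add: card_gt_0_iff)
      then have "card A = 1" using that(3) by simp
      then obtain i where i: "A = {i}" by (rule card_1_singletonE)
      show False using that(4,5) unfolding i even_odd_def odd_even_def by (cases "even i"; cases i) auto
    qed
    then show ?thesis using that by (auto simp: card_1_singleton_iff)
  qed
  have "p \<in> EOP c \<longleftrightarrow> p \<in> OEP c" if n: "ncard p = 1" and p: "p \<in> EOP c \<union> OEP c" for p
  proof -
    obtain A B where AB: "p = (A, B)" by force
    have "A = {} \<and> (\<exists>i. B = {i})"
      by (rule e) (use finite_P[OF p] n p ones_pos[of c] in \<open>auto simp: AB ncard_def EOP_def OEP_def\<close>)
    then obtain i where "A = {}" "B = {i}" by blast
    then show ?thesis by (auto simp: AB EOP_def OEP_def even_odd_def odd_even_def)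
  qed
  then show ?thesis by blast
qed

section \<open>The coefficients of \<open>\<DD>\<close>\<close>

instantiation nat :: weighted
begin
definition lw_nat :: "nat \<Rightarrow> nat" where "lw_nat k = Suc k"
instance
proof
  fix n
  have "{k. lw (k :: nat) \<le> n} \<subseteq> {..n}" by (auto simp: lw_nat_def)
  then show "finite {k. lw (k :: nat) \<le> n}" by (rule finite_subset) simp
qed (simp add: lw_nat_def)
end

lemma lw_nat [simp]: "lw (k :: nat) = Suc k" by (simp add: lw_nat_def)

text \<open>The letter \<open>k\<close> of a list of natural numbers stands for \<open>e_{k+1}\<close>.\<close>
definition W :: "nat list \<Rightarrow> word" where
  "W v = concat (map (\<lambda>k. Y # replicate k X) v)"

lemma W_simps [simp]: "W [] = []" "W (k # v) = Y # replicate k X @ W v" "W (u @ v) = W u @ W v"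
  by (simp_all add: W_def)

lemma word_of_index_Suc: "word_of_index (map Suc v) = W v"
  by (induction v) (simp_all add: word_of_index_def e_def)

lemma lookup_smult [simp]: "Poly_Mapping.lookup (Defs.smult a p) w = a * Poly_Mapping.lookup p w"
  by (simp add: Defs.smult_def map.rep_eq when_def)

lemma lookup_wmon: "Poly_Mapping.lookup (wmon u) w = (if u = w then 1 else 0)"
  by (simp add: wmon_def lookup_single when_def)

lemma keys_wmon [simp]: "Poly_Mapping.keys (wmon u) = {u}"
  by (simp add: wmon_def)

lemma cat_wmon: "cat p (wmon u) = (\<Sum>a\<in>Poly_Mapping.keys p. Defs.smult (Poly_Mapping.lookup p a) (wmon (a @ u)))"
  by (simp add: cat_def lin2_def lookup_wmon)

text \<open>The effect of right concatenation with the word \<open>u\<close> on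
  coefficients.\<close>

definition dropsuf :: "'l list \<Rightarrow> ('l list \<Rightarrow> real) \<Rightarrow> 'l list \<Rightarrow> real" where
  "dropsuf u f w = (if \<exists>v. w = v @ u then f (take (length w - length u) w) else 0)"

lemma dropsuf_append [simp]: "dropsuf u f (v @ u) = f v"
  by (simp add: dropsuf_def)

lemma lookup_cat_wmon:
  "of_rat (Poly_Mapping.lookup (cat p (wmon u)) w) = dropsuf u (\<lambda>v. of_rat (Poly_Mapping.lookup p v)) w"
proof (cases "\<exists>v. w = v @ u")
  case True
  then obtain v where w: "w = v @ u" by blast
  have "Poly_Mapping.lookup (cat p (wmon u)) w = (\<Sum>a\<in>Poly_Mapping.keys p. if a = v then Poly_Mapping.lookup p v else 0)"
    unfolding cat_wmon lookup_sum by (rule sum.cong) (auto simp: lookup_wmon w)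
  also have "\<dots> = Poly_Mapping.lookup p v"
    by (simp add: sum.delta' in_keys_iff)
  finally show ?thesis by (simp add: w)
next
  case False
  then have "Poly_Mapping.lookup (cat p (wmon u)) w = 0"
    unfolding cat_wmon lookup_sum by (intro sum.neutral) (auto simp: lookup_wmon)
  then show ?thesis using False by (simp add: dropsuf_def)
qed

lemma nested_sum:
  assumes "finite P" "finite Q"
  shows "(\<Sum>A | A \<subseteq> P \<and> R A. \<Sum>B | B \<subseteq> Q \<and> S A B. F A B)
     = (\<Sum>(A, B) \<in> {(A, B). A \<subseteq> P \<and> R A \<and> B \<subseteq> Q \<and> S A B}. F A B)"
proof -
  have "{(A, B). A \<subseteq> P \<and> R A \<and> B \<subseteq> Q \<and> S A B} = Sigma {A. A \<subseteq> P \<and> R A} (\<lambda>A. {B. B \<subseteq> Q \<and> S A B})"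
    by auto
  then show ?thesis using assms by (simp add: sum.Sigma)
qed

lemma Dfuel_Suc:
  assumes "c \<noteq> []"
  shows "Dfuel (Suc n) c =
      (\<Sum>p | p \<in> EOP c \<and> ncard p \<ge> 1. Defs.smult (- ((-1) ^ card (snd p))) (cat (Dfuel n (red c p)) (xpow (ncard p))))
    + (\<Sum>p | p \<in> EOP c \<and> ncard p \<ge> 2. Defs.smult (- ((-1) ^ card (snd p))) (cat (Dfuel n (red c p)) (wmon (Y # replicate (ncard p - 1) X))))
    + (\<Sum>p | p \<in> OEP c \<and> ncard p \<ge> 2. Defs.smult ((-1) ^ card (snd p)) (cat (Dfuel n (red c p)) (wmon (Y # replicate (ncard p - 1) X))))"
proof -
  have E: "{p. p \<in> EOP c \<and> ncard p \<ge> k} = {(A, B). A \<subseteq> ones c \<and> even_odd A \<and> B \<subseteq> gt1 c \<and> (card A + card B \<ge> k \<and>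
       (\<forall>r\<in>{1..length c div 2 - 1}. \<not> {2*r, 2*r+1} \<subseteq> B))}" for k
    by (auto simp: EOP_def ncard_def)
  have O: "{p. p \<in> OEP c \<and> ncard p \<ge> k} = {(A, B). A \<subseteq> ones c \<and> odd_even A \<and> B \<subseteq> gt1 c \<and> (card A + card B \<ge> k \<and>
       (\<forall>r\<in>{1..length c div 2}. \<not> {2*r - 1, 2*r} \<subseteq> B))}" for k
    by (auto simp: OEP_def ncard_def)
  show ?thesis
    unfolding E O Dfuel.simps Let_def nested_sum[OF finite_ones finite_gt1, symmetric] if_not_P[OF assms]
    by (simp add: nested_sum case_prod_unfold red_def ncard_def)
qed

lemma valid_pos: "valid c \<Longrightarrow> c \<noteq> [] \<Longrightarrow> sum_list c > 0"
  by (cases c) (auto simp: valid_def)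

lemma neg_diff_add_eq_0: "a = 0 \<Longrightarrow> b = 0 \<Longrightarrow> c = 0 \<Longrightarrow> - a - b + c = (0 :: real)"
  by simp

text \<open>Recursive arguments have smaller weight, so fuel beyond the weight changes
  nothing.\<close>

lemma Dfuel_stable: "valid c \<Longrightarrow> sum_list c \<le> n \<Longrightarrow> Dfuel n c = frakD c"
proof (induction n arbitrary: c rule: less_induct)
  case (less n)
  show ?case
  proof (cases "c = []")
    case True then show ?thesis by (cases n) (simp_all add: frakD_def)
  next
    case False
    then have "sum_list c > 0" using valid_pos less.prems by blast
    then obtain m n' where m: "sum_list c = Suc m" and n: "n = Suc n'" using less.prems by (metis gr0_implies_Suc less_le_trans)
    have le: "m \<le> n'" using less.prems m n by simp
    have *: "Dfuel k (red c p) = frakD (red c p)" if "k < n" "m \<le> k" "p \<in> EOP c \<union> OEP c" "ncard p \<ge> 1" for k p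
    proof -
      have "valid (red c p) \<and> sum_list (red c p) + ncard p = sum_list c"
        using that(3) EOP_red[OF less.prems(1), of p] OEP_red_valid[OF less.prems(1), of p] by blast
      then show ?thesis using less.IH[OF that(1), of "red c p"] that m by simp
    qed
    have "Dfuel (Suc n') c = Dfuel (Suc m) c"
      unfolding Dfuel_Suc[OF False]
      by (intro arg_cong2[of _ _ _ _ "(+)"] sum.cong refl) (use le n in \<open>auto simp: *\<close>)
    then show ?thesis by (simp add: frakD_def m n)
  qed
qed

definition Dco :: "nat list \<Rightarrow> word \<Rightarrow> real" where
  "Dco c w = of_rat (Poly_Mapping.lookup (frakD c) w)"

lemma Dco_rec:
  assumes "valid c" "c \<noteq> []"
  shows "Dco c w =
    - (\<Sum>p | p \<in> EOP c \<and> ncard p \<ge> 1. (-1) ^ card (snd p) * dropsuf (replicate (ncard p) X) (Dco (red c p)) w)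
    - (\<Sum>p | p \<in> EOP c \<and> ncard p \<ge> 2. (-1) ^ card (snd p) * dropsuf (Y # replicate (ncard p - 1) X) (Dco (red c p)) w)
    + (\<Sum>p | p \<in> OEP c \<and> ncard p \<ge> 2. (-1) ^ card (snd p) * dropsuf (Y # replicate (ncard p - 1) X) (Dco (red c p)) w)"
proof -
  have "sum_list c > 0" using valid_pos assms by blast
  then obtain m where m: "sum_list c = Suc m" by (metis gr0_implies_Suc)
  have *: "Dfuel m (red c p) = frakD (red c p)" if "p \<in> EOP c \<union> OEP c" "ncard p \<ge> 1" for p
  proof -
    have "valid (red c p) \<and> sum_list (red c p) + ncard p = sum_list c"
      using that(1) EOP_red[OF assms(1), of p] OEP_red_valid[OF assms(1), of p] by blast
    then show ?thesis using Dfuel_stable[of "red c p" m] that m by simp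
  qed
  have f: "frakD c = Dfuel (Suc m) c" by (simp add: frakD_def m)
  have d: "Dco d = (\<lambda>v. of_rat (Poly_Mapping.lookup (frakD d) v))" for d
    by (simp add: Dco_def fun_eq_iff)
  have s: "of_rat (- ((-1) ^ k) * z) = (- ((-1) ^ k * of_rat z) :: real)" "of_rat ((-1) ^ k * z) = ((-1) ^ k * of_rat z :: real)" for k z
    by (simp_all add: of_rat_mult of_rat_power of_rat_minus)
  show ?thesis
    unfolding Dco_def[of c] f Dfuel_Suc[OF assms(2)] lookup_add of_rat_add lookup_sum of_rat_sum lookup_smult s
      diff_conv_add_uminus sum_negf[symmetric]
    by (intro arg_cong2[of _ _ _ _ "(+)"] sum.cong refl) (auto simp: * d lookup_cat_wmon xpow_def)
qed

lemma dropsuf_Nil: "u \<noteq> [] \<Longrightarrow> dropsuf u f [] = 0"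
  by (simp add: dropsuf_def)

text \<open>The last letter e_{k+1} ends in exactly k letters x; splitting off n of them leaves
  e_{k+1-n}.\<close>

lemma dropsuf_X:
  "dropsuf (replicate n X) f (W (v @ [k])) = (if n \<le> k then f (W (v @ [k - n])) else 0)"
proof (cases "n \<le> k")
  case True
  then have "W (v @ [k]) = W (v @ [k - n]) @ replicate n X"
    by (simp add: replicate_add[symmetric])
  then show ?thesis using True by (simp only: dropsuf_append if_True simp_thms)
next
  case False
  have "\<not> (\<exists>z. W (v @ [k]) = z @ replicate n X)"
  proof
    assume "\<exists>z. W (v @ [k]) = z @ replicate n X"
    then obtain z where z: "rev (W (v @ [k])) = replicate n X @ rev z" by (metis rev_append rev_replicate)
    have "rev (W (v @ [k])) ! k = Y" by (simp add: nth_append)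
    moreover have "(replicate n X @ rev z) ! k = X" using False by (simp add: nth_append)
    ultimately show False using z by simp
  qed
  then show ?thesis using False unfolding dropsuf_def by (simp only: if_False)
qed

lemma dropsuf_YX:
  "dropsuf (Y # replicate m X) f (W (v @ [k])) = (if m = k then f (W v) else 0)"
proof (cases "m = k")
  case True
  then have "W (v @ [k]) = W v @ (Y # replicate m X)" by simp
  then show ?thesis using True by (simp only: dropsuf_append if_True simp_thms)
next
  case False
  have "\<not> (\<exists>z. W (v @ [k]) = z @ (Y # replicate m X))"
  proof
    assume "\<exists>z. W (v @ [k]) = z @ (Y # replicate m X)"
    then obtain z where "W (v @ [k]) = z @ (Y # replicate m X)" by blast
    then have "rev (W (v @ [k])) = rev (z @ (Y # replicate m X))" by simp
    then have z: "replicate k X @ Y # rev (W v) = replicate m X @ Y # rev z" by simp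
    have "(replicate k X @ Y # rev (W v)) ! min k m = (if k \<le> m then Y else X)"
      by (simp add: nth_append min_def)
    moreover have "(replicate m X @ Y # rev z) ! min k m = (if m \<le> k then Y else X)"
      by (simp add: nth_append min_def)
    ultimately show False using z False by (auto split: if_splits)
  qed
  then show ?thesis using False unfolding dropsuf_def by (simp only: if_False)
qed

lemma Dco_Nil: "valid c \<Longrightarrow> Dco c [] = (if c = [] then 1 else 0)"
proof (cases "c = []")
  case True then show ?thesis by (simp add: Dco_def frakD_def lookup_wmon)
next
  case False
  assume "valid c"
  then show ?thesis
    using False unfolding Dco_rec[OF \<open>valid c\<close> False] if_not_P[OF False]
    by (intro neg_diff_add_eq_0 sum.neutral ballI) (auto simp: dropsuf_Nil)
qed

lemma Dco_Nil_index: "Dco [] w = (if w = [] then 1 else 0)"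
  by (auto simp: Dco_def frakD_def lookup_wmon)

text \<open>A leading x could only arise from a factor x^n behind the constant value at the empty
  index. Such factors occur only in the even-odd sum, where the reduced index is nonempty.\<close>

lemma Dco_X: "valid c \<Longrightarrow> Dco c (X # w) = 0"
proof (induction "sum_list c" arbitrary: c w rule: less_induct)
  case less
  show ?case
  proof (cases "c = []")
    case True then show ?thesis by (simp add: Dco_Nil_index)
  next
    case False
    have z: "dropsuf u (Dco (red c p)) (X # w) = 0"
      if p: "p \<in> EOP c \<union> OEP c" "ncard p \<ge> 1" and u: "u \<noteq> []" "hd u = X \<longrightarrow> red c p \<noteq> []" for p u
    proof (cases "\<exists>v. X # w = v @ u")
      case True
      then obtain v where v: "X # w = v @ u" by blast
      have r: "valid (red c p) \<and> sum_list (red c p) + ncard p = sum_list c"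
        using p(1) EOP_red[OF less.prems(1), of p] OEP_red_valid[OF less.prems(1), of p] by blast
      have "Dco (red c p) v = 0"
      proof (cases v)
        case Nil
        then have "hd u = X" using v by (cases u) auto
        then show ?thesis using u r by (simp add: Nil Dco_Nil)
      next
        case (Cons b v')
        then show ?thesis using less.hyps[of "red c p" v'] r p v by simp
      qed
      then show ?thesis unfolding v by simp
    qed (simp add: dropsuf_def)
    have ne: "red c p \<noteq> []" if "p \<in> EOP c" for p using EOP_red[OF less.prems that] False by blast
    show ?thesis
      unfolding Dco_rec[OF less.prems False]
      by (intro neg_diff_add_eq_0 sum.neutral ballI) (auto intro!: z simp: ne)
  qed
qed

definition Phi :: "nat list \<Rightarrow> nat list \<Rightarrow> real" where
  "Phi v c = Dco c (W v)"

lemma sum_if: "finite S \<Longrightarrow> (\<Sum>p | p \<in> S \<and> P p. f p) = (\<Sum>p\<in>S. if P p then f p else (0 :: real))"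
  by (simp add: sum.If_cases Int_def)

lemma Phi_rec:
  assumes "valid c" "c \<noteq> []"
  shows "Phi (v @ [k]) c =
    - (\<Sum>p\<in>EOP c. if ncard p \<ge> 1 \<and> ncard p \<le> k then (-1) ^ card (snd p) * Phi (v @ [k - ncard p]) (red c p) else 0)
    - (\<Sum>p\<in>EOP c. if ncard p \<ge> 2 \<and> ncard p = Suc k then (-1) ^ card (snd p) * Phi v (red c p) else 0)
    + (\<Sum>p\<in>OEP c. if ncard p \<ge> 2 \<and> ncard p = Suc k then (-1) ^ card (snd p) * Phi v (red c p) else 0)"
  unfolding Phi_def Dco_rec[OF assms] dropsuf_X dropsuf_YX sum_if[OF finite_EOP] sum_if[OF finite_OEP]
  by (intro arg_cong2[of _ _ _ _ "(+)"] arg_cong2[of _ _ _ _ "(-)"] arg_cong[of _ _ uminus] sum.cong refl) auto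

lemma Phi_hom: "valid c \<Longrightarrow> sum_list c \<noteq> wt v \<Longrightarrow> Phi v c = 0"
proof (induction "sum_list c" arbitrary: c v rule: less_induct)
  case less
  show ?case
  proof (cases "c = []")
    case True
    then have "v \<noteq> []" using less.prems by auto
    then have "W v \<noteq> []" by (cases v) auto
    then show ?thesis using True by (simp add: Phi_def Dco_Nil_index)
  next
    case False
    have r: "valid (red c p) \<and> sum_list (red c p) + ncard p = sum_list c" if "p \<in> EOP c \<union> OEP c" for p
      using that EOP_red[OF less.prems(1), of p] OEP_red_valid[OF less.prems(1), of p] by blast
    have IH: "Phi u (red c p) = 0"
      if "p \<in> EOP c \<union> OEP c" "ncard p \<ge> 1" "wt u + ncard p \<noteq> sum_list c" for p u
    proof -
      have "sum_list (red c p) < sum_list c" "sum_list (red c p) \<noteq> wt u" using r[OF that(1)] that by linarith+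
      then show ?thesis using less.hyps r[OF that(1)] by blast
    qed
    show ?thesis
    proof (cases v rule: rev_cases)
      case Nil then show ?thesis using less.prems False by (simp add: Phi_def Dco_Nil)
    next
      case (snoc u k)
      have n: "sum_list c \<noteq> wt u + Suc k" using less.prems snoc by simp
      show ?thesis unfolding snoc Phi_rec[OF less.prems(1) False]
        by (intro neg_diff_add_eq_0 sum.neutral ballI) (use n in \<open>auto intro!: IH\<close>)
    qed
  qed
qed

text \<open>Of the functionals \<open>\<Phi>_v\<close> and \<open>\<Phi>_{v e_k}\<close> at most one is nonzero in a given weight, and
  \<open>Psi v\<close> selects it.\<close>
definition Psi :: "nat list \<Rightarrow> nat list \<Rightarrow> real" where
  "Psi v c = (if sum_list c = wt v then Phi v c
     else if sum_list c > wt v then Phi (v @ [sum_list c - wt v - 1]) c else 0)"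

text \<open>Moved to the left, the first sum of the recursion supplies the terms
  \<open>ncard p \<le> k\<close> of the even-odd sum and the second those with
  \<open>ncard p = Suc k\<close>; the third sum remains as the odd-even side.\<close>

theorem SE_Psi:
  assumes c: "valid c"
  shows "SE (Psi v) c = SO (Phi v) c"
proof (cases "c = []")
  case True
  then show ?thesis using Phi_hom[of "[]" v] by (auto simp: Psi_def valid_def)
next
  case False
  have rE: "valid (red c p) \<and> sum_list (red c p) + ncard p = sum_list c" if "p \<in> EOP c" for p
    using EOP_red[OF c that] by blast
  have rO: "valid (red c p) \<and> sum_list (red c p) + ncard p = sum_list c" if "p \<in> OEP c" for p
    using OEP_red_valid[OF c that] by blast
  let ?s = "\<lambda>p. (-1) ^ card (snd p) :: real"
  have LE: "SE (Psi v) c = (\<Sum>p\<in>EOP c. ?s p * Psi v (red c p))"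
    using SE_sum[of c "Psi v"] c by (simp add: valid_def sgn_red_def red_def case_prod_unfold)
  have LO: "SO (Phi v) c = (\<Sum>p\<in>OEP c. ?s p * Phi v (red c p))"
    using SO_sum[of "Phi v" c] by (simp add: sgn_red_def red_def case_prod_unfold)
  consider "sum_list c < wt v" | "sum_list c = wt v" | "sum_list c > wt v" by linarith
  then show ?thesis
  proof cases
    case 1
    have "SE (Psi v) c = 0" unfolding LE
    proof (rule sum.neutral, rule ballI)
      fix p assume "p \<in> EOP c" then show "?s p * Psi v (red c p) = 0" using rE[of p] 1 by (simp add: Psi_def)
    qed
    moreover have "SO (Phi v) c = 0" unfolding LO
    proof (rule sum.neutral, rule ballI)
      fix p assume "p \<in> OEP c" then show "?s p * Phi v (red c p) = 0" using rO[of p] 1 by (simp add: Phi_hom)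
    qed
    ultimately show ?thesis by simp
  next
    case 2
    have "SE (Psi v) c = (\<Sum>p\<in>EOP c. if p = ({}, {}) then Phi v c else 0)" unfolding LE
    proof (rule sum.cong[OF refl])
      fix p assume p: "p \<in> EOP c"
      show "?s p * Psi v (red c p) = (if p = ({}, {}) then Phi v c else 0)"
      proof (cases "p = ({}, {})")
        case False
        then have "ncard p > 0" using ncard_0[of p c] p by simp
        then show ?thesis using rE[OF p] 2 False by (simp add: Psi_def)
      qed (simp add: Psi_def 2)
    qed
    also have "\<dots> = Phi v c" by (simp add: sum.delta empty_mem)
    finally have *: "SE (Psi v) c = Phi v c" .
    have "SO (Phi v) c = (\<Sum>p\<in>OEP c. if p = ({}, {}) then Phi v c else 0)" unfolding LO
    proof (rule sum.cong[OF refl])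
      fix p assume p: "p \<in> OEP c"
      show "?s p * Phi v (red c p) = (if p = ({}, {}) then Phi v c else 0)"
      proof (cases "p = ({}, {})")
        case False
        then have "ncard p > 0" using ncard_0[of p c] p by simp
        then show ?thesis using rO[OF p] 2 False by (simp add: Phi_hom)
      qed simp
    qed
    also have "\<dots> = Phi v c" by (simp add: sum.delta empty_mem)
    finally show ?thesis using * by simp
  next
    case 3
    define k where "k = sum_list c - wt v - 1"
    have k: "sum_list c = wt v + Suc k" using 3 by (simp add: k_def)
    define G where "G = (\<lambda>p. ?s p * Phi v (red c p))"
    have O: "SO (Phi v) c = (\<Sum>p\<in>OEP c. if ncard p = Suc k then G p else 0)" unfolding LO
    proof (rule sum.cong[OF refl])
      fix p assume p: "p \<in> OEP c"
      then show "?s p * Phi v (red c p) = (if ncard p = Suc k then G p else 0)"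
        using rO[OF p] k by (auto simp: Phi_hom G_def)
    qed
    have "SE (Psi v) c = (\<Sum>p\<in>EOP c. (if p = ({}, {}) then Phi (v @ [k]) c else 0)
       + (if ncard p \<ge> 1 \<and> ncard p \<le> k then ?s p * Phi (v @ [k - ncard p]) (red c p) else 0)
       + (if ncard p = Suc k then G p else 0))" unfolding LE
    proof (rule sum.cong[OF refl])
      fix p assume p: "p \<in> EOP c"
      have r: "sum_list (red c p) = wt v + Suc k - ncard p" "ncard p \<le> wt v + Suc k" using rE[OF p] k by linarith+
      show "?s p * Psi v (red c p) = (if p = ({}, {}) then Phi (v @ [k]) c else 0)
       + (if ncard p \<ge> 1 \<and> ncard p \<le> k then ?s p * Phi (v @ [k - ncard p]) (red c p) else 0)
       + (if ncard p = Suc k then G p else 0)"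
      proof (cases "p = ({}, {})")
        case True
        then show ?thesis using k by (simp add: Psi_def ncard_def)
      next
        case False
        then have "ncard p > 0" using ncard_0[of p c] p by simp
        moreover have "wt v + Suc k - ncard p - wt v - 1 = k - ncard p" by simp
        ultimately show ?thesis using False r unfolding Psi_def r(1)
          by (cases "ncard p \<le> k"; cases "ncard p = Suc k") (auto simp: G_def)
      qed
    qed
    also have "\<dots> = Phi (v @ [k]) c
       + (\<Sum>p\<in>EOP c. if ncard p \<ge> 1 \<and> ncard p \<le> k then ?s p * Phi (v @ [k - ncard p]) (red c p) else 0)
       + (\<Sum>p\<in>EOP c. if ncard p = Suc k then G p else 0)"
      by (simp add: sum.distrib sum.delta empty_mem)
    also have "\<dots> = (\<Sum>p\<in>EOP c. if ncard p = Suc k then G p else 0)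
       - (\<Sum>p\<in>EOP c. if ncard p \<ge> 2 \<and> ncard p = Suc k then G p else 0)
       + (\<Sum>p\<in>OEP c. if ncard p \<ge> 2 \<and> ncard p = Suc k then G p else 0)"
      unfolding Phi_rec[OF c False] G_def by simp
    also have "\<dots> = (\<Sum>p\<in>OEP c. if ncard p = Suc k then G p else 0)"
    proof (cases k)
      \<comment> \<open>The bound \<open>ncard p \<ge> 2\<close> has emptied both sums with
        \<open>ncard p = Suc k\<close>, and \<open>single_ncard\<close> shows that their full
        versions are equal.\<close>
      case 0
      have "(\<Sum>p\<in>EOP c. if ncard p = 1 then G p else 0) = (\<Sum>p\<in>OEP c. if ncard p = 1 then G p else 0)"
        unfolding sum_if[OF finite_EOP, symmetric] sum_if[OF finite_OEP, symmetric]
        using single_ncard[of c] by simp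
      then show ?thesis unfolding 0 by (simp add: if_False cong: conj_cong if_cong)
    next
      case (Suc k')
      then have "(2 \<le> ncard p \<and> ncard p = Suc k) = (ncard p = Suc k)" for p by auto
      then show ?thesis by simp
    qed
    finally show ?thesis using O by simp
  qed
qed

section \<open>Words of H^0 and their indices\<close>

definition h0 :: "word \<Rightarrow> bool" where
  "h0 w \<longleftrightarrow> w = [] \<or> hd w = Y \<and> last w = X"

lemma h0_iff: "h0 w \<longleftrightarrow> w = [] \<or> (\<exists>m. w = Y # m @ [X])"
proof
  assume h: "h0 w"
  show "w = [] \<or> (\<exists>m. w = Y # m @ [X])"
  proof (cases w)
    case (Cons a u)
    then have "a = Y" "last (Y # u) = X" using h by (auto simp: h0_def)
    then show ?thesis using Cons by (cases u rule: rev_cases) auto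
  qed simp
qed (auto simp: h0_def)

lemma last_wei: "valid c \<Longrightarrow> c \<noteq> [] \<Longrightarrow> wei c \<noteq> [] \<and> last (wei c) = X"
proof (induction c rule: word_of_even_index.induct)
  case (1 a b cs)
  then have b: "b > 0" "valid cs" by (auto simp: valid_def)
  then show ?case
  proof (cases "cs = []")
    case True
    then show ?thesis using b by (cases b) auto
  next
    case False
    then show ?thesis using "1.IH" b by (simp add: last_append)
  qed
qed (auto simp: valid_def)

lemma h0_wei: "valid c \<Longrightarrow> h0 (wei c)"
  using last_wei[of c] wei_hd[of c] by (cases "c = []") (auto simp: h0_def valid_def)

lemma takeWhile_rep: "w = [] \<or> hd w \<noteq> a \<Longrightarrow> takeWhile (\<lambda>l. l = a) (replicate n a @ w) = replicate n a"
  "w = [] \<or> hd w \<noteq> a \<Longrightarrow> dropWhile (\<lambda>l. l = a) (replicate n a @ w) = w"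
  by (induction n; cases w; auto)+

lemma rep_append_eq:
  assumes "replicate n a @ w = replicate m a @ v" "w = [] \<or> hd w \<noteq> a" "v = [] \<or> hd v \<noteq> a"
  shows "n = m \<and> w = v"
  using takeWhile_rep[OF assms(2), of n] takeWhile_rep[OF assms(3), of m] assms(1)
  by (metis length_replicate)

lemma hd_rep: "n > 0 \<Longrightarrow> hd (replicate n a @ w) = a"
  by (cases n) auto

lemma wei_inj: "valid c \<Longrightarrow> valid d \<Longrightarrow> wei c = wei d \<Longrightarrow> c = d"
proof (induction c arbitrary: d rule: word_of_even_index.induct)
  case (1 a b cs)
  have "d \<noteq> []" using 1 last_wei[of "a # b # cs"] by auto
  then obtain a' b' ds where d: "d = a' # b' # ds"
    using "1.prems"(2) by (cases d; cases "tl d") (auto simp: valid_def)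
  have v: "valid cs" "valid ds" "a > 0" "b > 0" "a' > 0" "b' > 0" using 1 d by (auto simp: valid_def)
  have w: "wei cs = [] \<or> hd (wei cs) \<noteq> X" "wei ds = [] \<or> hd (wei ds) \<noteq> X"
    using wei_hd[of cs] wei_hd[of ds] v by (auto simp: valid_def)
  have e: "replicate a Y @ replicate b X @ wei cs = replicate a' Y @ replicate b' X @ wei ds"
    using "1.prems"(3) d by simp
  have "a = a' \<and> replicate b X @ wei cs = replicate b' X @ wei ds"
    by (rule rep_append_eq[OF e]) (simp_all add: hd_rep v)
  moreover from this have "b = b' \<and> wei cs = wei ds"
    using rep_append_eq[of b X "wei cs" b' "wei ds"] w by blast
  ultimately show ?case using "1.IH"[OF v(1,2)] d by simp
next
  case "2_1"
  then show ?case using last_wei[of d] by (cases "d = []") auto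
qed (auto simp: valid_def)

lemma even_index_of_wei: "valid c \<Longrightarrow> even_index_of (wei c) = c"
  unfolding even_index_of_def
  by (rule the_equality) (use wei_inj in \<open>auto simp: valid_def\<close>)

lemma split_rep: "\<exists>n. w = replicate n a @ dropWhile (\<lambda>l. l = a) w"
proof (induction w)
  case (Cons b w)
  show ?case
  proof (cases "b = a")
    case True
    obtain n where "w = replicate n a @ dropWhile (\<lambda>l. l = a) w" using Cons by blast
    then have "b # w = replicate (Suc n) a @ dropWhile (\<lambda>l. l = a) (b # w)" using True by simp
    then show ?thesis by blast
  qed (auto intro: exI[of _ 0])
qed simp

lemma wei_surj: "h0 w \<Longrightarrow> \<exists>c. valid c \<and> wei c = w"
proof (induction "length w" arbitrary: w rule: less_induct)
  case less
  show ?case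
  proof (cases "w = []")
    case True then show ?thesis by (auto simp: valid_def intro!: exI[of _ "[]"])
  next
    case False
    obtain a u where u: "w = replicate a Y @ u" "u = dropWhile (\<lambda>l. l = Y) w" using split_rep by metis
    have hl: "hd w = Y" "last w = X" using less.prems False by (auto simp: h0_def)
    have "u \<noteq> []"
    proof
      assume "u = []"
      then have "w = replicate a Y" using u(1) by simp
      then have "set w \<subseteq> {Y}" by auto
      then show False using hl(2) last_in_set[OF False] by auto
    qed
    then have hu: "hd u = X" using hd_dropWhile[of "\<lambda>l. l = Y" w] u(2) by (metis letter.exhaust)
    have a: "a > 0" using u(1) hl(1) hu by (cases a) auto
    obtain b z where z: "u = replicate b X @ z" "z = dropWhile (\<lambda>l. l = X) u" using split_rep by metis
    have hz: "z = [] \<or> hd z = Y" using hd_dropWhile[of "\<lambda>l. l = X" u] z(2) by (metis letter.exhaust)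
    have b: "b > 0" using z hu hz \<open>u \<noteq> []\<close> by (cases b) auto
    have "h0 z" using hz hl(2) u(1) z(1) by (auto simp: h0_def last_append)
    moreover have "length z < length w" using u(1) z(1) a by simp
    ultimately obtain cs where "valid cs" "wei cs = z" using less.hyps by blast
    then have "valid (a # b # cs) \<and> wei (a # b # cs) = w" using u(1) z(1) a b by (simp add: valid_def)
    then show ?thesis by blast
  qed
qed

text \<open>\<open>Phi v\<close> as a functional on words, extended by zero outside H^0.\<close>

definition Fv :: "nat list \<Rightarrow> word \<Rightarrow> real" where
  "Fv v w = (if h0 w then Dco (even_index_of w) (W v) else 0)"

lemma Fv_wei: "valid c \<Longrightarrow> Fv v (wei c) = Phi v c"
  by (simp add: Fv_def h0_wei even_index_of_wei Phi_def)

lemma cf_y_mult_x: "cf (y * f * x) (Y # m @ [X]) = cf f m"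
  by (simp add: mult.assoc cf_mult_L)

lemma cf_res0: "h0 w \<Longrightarrow> cf (res0 F) w = F w"
  unfolding h0_iff
proof (elim disjE exE)
  fix m assume "w = Y # m @ [X]"
  then show ?thesis by (simp add: res0_def cf_y_mult_x nu_def cf_one)
qed (simp add: res0_def)

lemma sum_list_wei: "valid c \<Longrightarrow> length (wei c) = sum_list c"
  by (induction c rule: word_of_even_index.induct) (auto simp: valid_def)

text \<open>In the even-odd sum the pair ({}, {}) contributes the value at \<open>c\<close> and
  every other pair a value in smaller weight. Equal even-odd sums therefore force equal functionals,
  by induction on the weight.\<close>

theorem onestep_Psi: "valid c \<Longrightarrow> cf (onestep (Fv v)) (wei c) = Psi v c"
proof (induction "sum_list c" arbitrary: c rule: less_induct)
  case less
  let ?h = "\<lambda>ds. cf (onestep (Fv v)) (wei ds)"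
  have "SE ?h c = cf (evOE (res0 (Fv v))) (wei c)"
    by (simp only: cf_evEO[OF less.prems, symmetric] evEO_onestep)
  also have "\<dots> = SO (\<lambda>ds. cf (res0 (Fv v)) (wei ds)) c"
    by (rule cf_evOE[OF less.prems])
  also have "\<dots> = SO (Phi v) c"
    unfolding SO_sum[symmetric]
  proof (rule sum.cong[OF refl])
    fix p assume "p \<in> OEP c"
    then have "valid (red c p)" using OEP_red_valid less.prems by blast
    then show "sgn_red (\<lambda>ds. cf (res0 (Fv v)) (wei ds)) c p = sgn_red (Phi v) c p"
      by (simp add: sgn_red_def red_def case_prod_unfold cf_res0 h0_wei Fv_wei)
  qed
  also have "\<dots> = SE (Psi v) c" by (rule SE_Psi[OF less.prems, symmetric])
  finally have "(\<Sum>p\<in>EOP c. sgn_red ?h c p) - (\<Sum>p\<in>EOP c. sgn_red (Psi v) c p) = 0"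
    using SE_sum less.prems by (simp add: valid_def)
  moreover have "(\<Sum>p\<in>EOP c. sgn_red ?h c p) - (\<Sum>p\<in>EOP c. sgn_red (Psi v) c p)
      = (\<Sum>p\<in>EOP c. if p = ({}, {}) then ?h c - Psi v c else 0)"
    unfolding sum_subtractf[symmetric]
  proof (rule sum.cong[OF refl])
    fix p assume p: "p \<in> EOP c"
    show "sgn_red ?h c p - sgn_red (Psi v) c p = (if p = ({}, {}) then ?h c - Psi v c else 0)"
    proof (cases "p = ({}, {})")
      case True
      then show ?thesis using red_empty[of c] by (simp add: sgn_red_def red_def)
    next
      case False
      then have "ncard p > 0" using ncard_0[of p c] p by simp
      moreover have r: "valid (red c p)" "sum_list (red c p) + ncard p = sum_list c"
        using EOP_red[OF less.prems p] by blast+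
      ultimately have "?h (red c p) = Psi v (red c p)" using less.hyps by simp
      then show ?thesis using False by (simp add: sgn_red_def red_def case_prod_unfold)
    qed
  qed
  ultimately show ?case by (simp add: sum.delta empty_mem)
qed

section \<open>Series in the letters \<open>e_k\<close> and the quasi-shuffle coproduct\<close>

lemma W_inj: "W u = W v \<Longrightarrow> u = v"
proof (induction u arbitrary: v)
  case Nil then show ?case by (cases v) auto
next
  case (Cons k u)
  then obtain k' v' where v: "v = k' # v'" by (cases v) auto
  have h: "W z = [] \<or> hd (W z) \<noteq> X" for z by (cases z) auto
  have "replicate k X @ W u = replicate k' X @ W v'" using Cons.prems v by simp
  then have "k = k' \<and> W u = W v'" by (rule rep_append_eq[OF _ h h])
  then show ?case using Cons.IH v by simp
qed

lemma W_surj: "w = [] \<or> hd w = Y \<Longrightarrow> \<exists>v. W v = w"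
proof (induction "length w" arbitrary: w rule: less_induct)
  case less
  show ?case
  proof (cases w)
    case Nil then show ?thesis by (auto intro: exI[of _ "[]"])
  next
    case (Cons a u)
    then have a: "a = Y" using less.prems by simp
    obtain k z where z: "u = replicate k X @ z" "z = dropWhile (\<lambda>l. l = X) u" using split_rep by metis
    have "z = [] \<or> hd z = Y" using hd_dropWhile[of "\<lambda>l. l = X" u] z(2) by (metis letter.exhaust)
    moreover have "length z < length w" using z(1) Cons by simp
    ultimately obtain v where "W v = z" using less.hyps by blast
    then have "W (k # v) = w" using Cons a z(1) by simp
    then show ?thesis by blast
  qed
qed

lemma wt_W: "length (W ks) = wt ks"
  by (induction ks) simp_all

text \<open>Restriction to H^1, rewritten in the letters e_k.\<close>

definition kap :: "(letter, real) ser \<Rightarrow> (nat, real) ser" where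
  "kap f = Ser (\<lambda>ks. cf f (W ks))"

lemma cf_kap [simp]: "cf (kap f) ks = cf f (W ks)"
  by (simp add: kap_def)

definition ysup :: "(letter, real) ser \<Rightarrow> bool" where
  "ysup f \<longleftrightarrow> (\<forall>w. cf f (X # w) = 0)"

lemma kap_simps [simp]: "kap 1 = 1" "kap (f + g) = kap f + kap g" "kap (f - g) = kap f - kap g"
  "kap (- f) = - kap f" "kap (c *\<^sub>R f) = c *\<^sub>R kap f" "kap 0 = 0"
proof -
  show "kap 1 = 1"
  proof (rule ser_eqI)
    fix w show "cf (kap 1) w = cf 1 w" by (cases w) (simp_all add: cf_one)
  qed
qed (simp_all add: ser_eq_iff)

lemma linear_kap: "linear kap" by (rule linearI) simp_all

lemma cf_mult_X_block:
  assumes "ysup g"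
  shows "cf (f * g) (replicate k X @ w) = cf (lqs (replicate k X) f * g) w"
  using assms by (induction k arbitrary: f) (simp_all add: cf_mult_Cons ysup_def lqs_Cons)

text \<open>Nonempty words in the support of \<open>g\<close> start with y, so a factorisation of
  \<open>W ks\<close> can only cut between letters e_k or at the end.\<close>

lemma kap_mult:
  assumes "ysup g"
  shows "kap (f * g) = kap f * kap g"
proof (rule ser_eqI)
  fix ks show "cf (kap (f * g)) ks = cf (kap f * kap g) ks"
  proof (induction ks arbitrary: f)
    case (Cons k ks)
    have l: "lq k (kap f) = kap (lqs (Y # replicate k X) f)"
      by (simp add: ser_eq_iff)
    have "cf (kap (f * g)) (k # ks) = cf f [] * cf g (W (k # ks)) + cf (lqs (Y # replicate k X) f * g) (W ks)"
      using cf_mult_X_block[OF assms, of "lq Y f" k "W ks"] by (simp add: cf_mult_Cons lqs_Cons)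
    then show ?case using Cons[of "lqs (Y # replicate k X) f"] by (simp add: cf_mult_Cons l)
  qed simp
qed

lemma ysup_1 [simp]: "ysup 1" and ysup_0 [simp]: "ysup 0" and ysup_y [simp]: "ysup (y * f)" "ysup y"
  by (simp_all add: ysup_def cf_one cf_L)

lemma ysup_add [simp]: "ysup f \<Longrightarrow> ysup g \<Longrightarrow> ysup (f + g)" "ysup f \<Longrightarrow> ysup g \<Longrightarrow> ysup (f - g)"
  "ysup f \<Longrightarrow> ysup (- f)" "ysup f \<Longrightarrow> ysup (c *\<^sub>R f)"
  by (simp_all add: ysup_def)

lemma lq_ysup: "ysup f \<Longrightarrow> lq X f = 0"
  by (simp add: ysup_def ser_eq_iff)

lemma ysup_mult: "ysup f \<Longrightarrow> ysup g \<Longrightarrow> ysup (f * g)"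
  by (simp add: ysup_def cf_mult_Cons lq_ysup)

lemma ysup_mult0: "ysup f \<Longrightarrow> cf f [] = 0 \<Longrightarrow> ysup (f * g)"
  by (simp add: ysup_def cf_mult_Cons lq_ysup)

lemma ysup_star: "ysup h \<Longrightarrow> cf h [] = 0 \<Longrightarrow> ysup (star h)"
  by (subst star_eq) (simp_all add: ysup_mult0)

lemma ysup_pw: "(\<And>k. ysup (h k)) \<Longrightarrow> ysup (pw h v)"
  by (induction v) (simp_all add: ysup_mult)

lemma kap_eqD: assumes "kap f = kap g" "ysup f" "ysup g" shows "f = g"
proof (rule ser_eqI)
  fix w show "cf f w = cf g w"
  proof (cases "w = [] \<or> hd w = Y")
    case True
    then obtain ks where "W ks = w" using W_surj by blast
    then show ?thesis using assms(1) by (metis cf_kap)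
  next
    case False
    then obtain v where "w = X # v" by (cases w) (auto, metis letter.exhaust)
    then show ?thesis using assms(2,3) by (simp add: ysup_def)
  qed
qed

lemma kap_ordge: "ordge n f \<Longrightarrow> ordge n (kap f)"
  by (simp add: ordge_def wt_W wt_word)

lemma adm_kap: "adm h \<Longrightarrow> adm (\<lambda>k. kap (h k))"
  by (simp add: adm_def kap_ordge)

lemma kap_pw: "(\<And>k. ysup (h k)) \<Longrightarrow> kap (pw h v) = pw (\<lambda>k. kap (h k)) v"
  by (induction v) (simp_all add: kap_mult ysup_pw)

lemma kap_sb:
  assumes "adm h" "\<And>k. ysup (h k)"
  shows "kap (sb h f) = sb (\<lambda>k. kap (h k)) f"
proof (rule filtered_linear_eqI[of "\<lambda>f. kap (sb h f)"])
  show "linear (\<lambda>f. kap (sb h f))" by (rule linearI) (simp_all add: sb_add sb_scale)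
qed (auto simp: sb_linear sb_ordge kap_ordge sb_mon assms adm_kap kap_pw)

definition ey :: "nat \<Rightarrow> (letter, real) ser" where
  "ey k = y * x ^ k"

lemma x_power: "x ^ k = mon (replicate k X)"
  by (induction k) simp_all

lemma ordge_power: "ordge 1 f \<Longrightarrow> ordge k (f ^ k)"
  for f :: "('l::weighted, 'a::ring_1) ser"
  by (induction k) (auto intro: ordge_mult[of 1 f, simplified])

lemma ordge_ypower: "cf f [] = 0 \<Longrightarrow> ordge (Suc k) (y * f ^ k)"
  using ordge_mult[of 1 y k "f ^ k"] ordge_power[of f k] by (simp add: ordge_1[unfolded One_nat_def])

lemma adm_ey: "adm ey"
  by (simp add: adm_def ey_def ordge_ypower)

lemma kap_ey: "kap (ey k) = L k"
proof (rule ser_eqI)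
  fix ks
  have "ey k = mon (W [k])" by (simp add: ey_def x_power)
  then have "cf (kap (ey k)) ks = (if W ks = W [k] then 1 else 0)" by (simp add: cf_mon del: mon_simps)
  moreover have "W ks = W [k] \<longleftrightarrow> ks = [k]" using W_inj by blast
  ultimately show "cf (kap (ey k)) ks = cf (L k) ks" by (simp add: cf_L del: W_simps)
qed

lemma adm_L: "adm L"
  by (auto simp: adm_def ordge_def cf_L)

lemma sb_L_id: "sb L f = f"
proof (rule filtered_linear_eqI[of "sb L" "\<lambda>f. f"])
  show "sb L (mon v) = mon v" for v by (simp add: sb_mon adm_L) (simp add: mon_def)
qed (auto simp: sb_linear sb_ordge linear_id[unfolded id_def])

lemma kap_ey_sb: "kap (sb ey f) = f"
  by (subst kap_sb) (simp_all add: adm_ey kap_ey sb_L_id, simp add: ey_def)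

lemma ysup_sb:
  assumes "adm h" "\<And>k. ysup (h k)"
  shows "ysup (sb h f)"
proof -
  have "cf (pw h v) (X # w) = 0" for v w using ysup_pw[of h v] assms by (simp add: ysup_def)
  then show ?thesis by (simp add: ysup_def cf_sb[OF assms(1) order_refl])
qed

lemma sb_ey_kap: "ysup f \<Longrightarrow> sb ey (kap f) = f"
  by (rule kap_eqD) (simp_all add: kap_ey_sb ysup_sb adm_ey ey_def)

text \<open>The quasi-shuffle taken from the left, whereas \<open>harr\<close> works from the last
  letters; \<open>Qs_rev\<close> reconciles the two. Since a stands for e_{a+1}, the merged letter
  is \<open>Suc (a + b)\<close>.\<close>

fun qsh :: "nat list \<Rightarrow> nat list \<Rightarrow> nat list list" where
  "qsh [] ws = [ws]"
| "qsh us [] = [us]"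
| "qsh (a # us) (b # ws) = map ((#) a) (qsh us (b # ws)) @ map ((#) b) (qsh (a # us) ws)
     @ map ((#) (Suc (a + b))) (qsh us ws)"

definition Qs :: "(nat list \<Rightarrow> real) \<Rightarrow> nat list \<Rightarrow> nat list \<Rightarrow> real" where
  "Qs f us ws = sum_list (map f (qsh us ws))"

lemma Qs_simps [simp]: "Qs f [] ws = f ws" "Qs f us [] = f us"
  "Qs f (a # us) (b # ws) = Qs (\<lambda>v. f (a # v)) us (b # ws) + Qs (\<lambda>v. f (b # v)) (a # us) ws
     + Qs (\<lambda>v. f (Suc (a + b) # v)) us ws"
  by (simp_all add: Qs_def comp_def) (cases us; simp)

lemma Qs_add: "Qs (\<lambda>v. f v + g v) us ws = Qs f us ws + Qs g us ws"
  and Qs_mult: "Qs (\<lambda>v. c * f v) us ws = c * Qs f us ws"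
  by (simp_all add: Qs_def sum_list_addf sum_list_const_mult)

lemma Qs_cong: "(\<And>v. v \<in> set (qsh us ws) \<Longrightarrow> f v = g v) \<Longrightarrow> Qs f us ws = Qs g us ws"
  unfolding Qs_def by (metis map_cong)

text \<open>Deconcatenation is a homomorphism for the quasi-shuffle product; dually, the coproduct
  \<open>Del\<close> is multiplicative for concatenation.\<close>

lemma Qs_cmul: "Qs (cmul f g) us ws
   = (\<Sum>i\<le>length us. \<Sum>j\<le>length ws. Qs f (take i us) (take j ws) * Qs g (drop i us) (drop j ws))"
proof (induction us ws arbitrary: f rule: qsh.induct)
  case (3 a us b ws)
  have s: "Qs (\<lambda>v. cmul f g (k # v)) us' ws' = f [] * Qs (\<lambda>v. g (k # v)) us' ws' + Qs (cmul (\<lambda>v. f (k # v)) g) us' ws'"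
    for k us' ws' by (simp add: Qs_add Qs_mult)
  show ?case
    unfolding Qs_simps(3) s "3.IH"
    by (simp add: sum.atMost_Suc_shift sum.distrib algebra_simps del: sum.atMost_Suc)
qed (simp_all add: cmul_take_drop del: cmul.simps)

text \<open>Series in ws whose coefficients are series in us model the completed tensor product; us
  belongs to the first factor and ws to the second.\<close>

definition Del :: "(nat, real) ser \<Rightarrow> (nat, (nat, real) ser) ser" where
  "Del f = Ser (\<lambda>ws. Ser (\<lambda>us. Qs (cf f) us ws))"

lemma cf_Del [simp]: "cf (cf (Del f) ws) us = Qs (cf f) us ws"
  by (simp add: Del_def)

lemma cf_cf_mult: "cf (cf (F * G) ws) us = (\<Sum>j\<le>length ws. \<Sum>i\<le>length us.
    cf (cf F (take j ws)) (take i us) * cf (cf G (drop j ws)) (drop i us))"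
  for F :: "('a, ('b, real) ser) ser"
  by (simp add: cf_mult cmul_take_drop cf_sum)

lemma Del_mult: "Del (f * g) = Del f * Del g"
proof (rule ser_eqI, rule ser_eqI)
  fix ws us
  have "cf (cf (Del (f * g)) ws) us = Qs (cmul (cf f) (cf g)) us ws"
    by (simp add: cf_mult[abs_def])
  also have "\<dots> = cf (cf (Del f * Del g) ws) us"
    unfolding Qs_cmul cf_cf_mult by (subst sum.swap) simp
  finally show "cf (cf (Del (f * g)) ws) us = cf (cf (Del f * Del g) ws) us" .
qed

lemma Del_linear: "linear Del"
proof -
  have "cf (f + g) = (\<lambda>v. cf f v + cf g v)" "cf (c *\<^sub>R f) = (\<lambda>v. c * cf f v)" for f g :: "(nat, real) ser" and c
    by (simp_all add: fun_eq_iff)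
  then show ?thesis by (intro linearI; intro ser_eqI) (simp_all add: Qs_add Qs_mult)
qed

lemma Qs_one: "Qs (cf 1) us ws = (if us = [] \<and> ws = [] then 1 else 0)"
proof (induction us ws rule: qsh.induct)
  case (3 a us b ws)
  have "(\<lambda>v. cf 1 (k # v)) = (\<lambda>v. 0 :: real)" for k :: nat by simp
  then show ?case by (simp add: Qs_def comp_def)
qed (simp_all add: cf_one)

lemma Del_1: "Del 1 = 1"
  by (rule ser_eqI, rule ser_eqI) (simp add: Qs_one cf_one)

lemma wt_qsh: "v \<in> set (qsh us ws) \<Longrightarrow> wt v = wt us + wt ws"
  by (induction us ws arbitrary: v rule: qsh.induct) auto

section \<open>Compatibility with multiplication by \<open>H^{\<ge>2}\<close>\<close>

text \<open>\<open>Cst\<close> and \<open>Rr\<close> are the embeddings a -> a \<otimes> 1 and b ->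
  1 \<otimes> b; their images commute (\<open>Rr_Cst\<close>).\<close>

definition Cst :: "'r::ring_1 \<Rightarrow> ('l, 'r) ser" where
  "Cst h = Ser (\<lambda>ws. if ws = [] then h else 0)"

definition Rr :: "('l, real) ser \<Rightarrow> ('l, 'r::real_algebra_1) ser" where
  "Rr h = Ser (\<lambda>ws. cf h ws *\<^sub>R 1)"

lemma cf_Cst: "cf (Cst h) ws = (if ws = [] then h else 0)"
  by (simp add: Cst_def)

lemma cf_Rr [simp]: "cf (Rr h) ws = cf h ws *\<^sub>R 1"
  by (simp add: Rr_def)

lemma lq_Cst: "lq a (Cst h) = 0" by (simp add: ser_eq_iff cf_Cst)

lemma cf_Cst_mult: "cf (Cst h * F) ws = h * cf F ws"
  by (cases ws) (simp_all add: cf_Cst cf_mult_Cons lq_Cst)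

lemma cf_mult_Cst: "cf (F * Cst h) ws = cf F ws * h"
  by (induction ws arbitrary: F) (simp_all add: cf_Cst cf_mult_Cons)

lemma Cst_mult: "Cst (f * g) = Cst f * Cst g"
  by (rule ser_eqI) (simp add: cf_Cst_mult cf_Cst)

lemma Cst_simps [simp]: "Cst 1 = 1" "Cst 0 = 0" "Cst (f + g) = Cst f + Cst g" "Cst (f - g) = Cst f - Cst g"
  by (simp_all add: ser_eq_iff cf_Cst cf_one)

lemma Rr_mult: "Rr (f * g) = Rr f * Rr g"
proof (rule ser_eqI)
  fix ws show "cf (Rr (f * g)) ws = cf (Rr f * Rr g :: ('a, 'b) ser) ws"
    by (simp add: cf_mult cmul_take_drop scaleR_sum_left mult.commute)
qed

lemma Rr_simps [simp]: "Rr 1 = 1" "Rr 0 = 0" "Rr (f + g) = Rr f + Rr g" "Rr (f - g) = Rr f - Rr g"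
  by (simp_all add: ser_eq_iff cf_one scaleR_add_left scaleR_diff_left)

lemma Rr_Cst: "Rr f * Cst h = Cst h * Rr f"
  by (rule ser_eqI) (simp add: cf_Cst_mult cf_mult_Cst)

text \<open>In the lowest weight in which \<open>F\<close> may be nonzero, every factorisation but
  the trivial one uses a coefficient of \<open>F\<close> of smaller weight. Both coproduct proofs
  below rest on this.\<close>

lemma low_mult:
  fixes F G :: "('a::weighted, ('b::weighted, real) ser) ser"
  assumes "\<And>ws' us'. wt ws' + wt us' < wt ws + wt us \<Longrightarrow> cf (cf F ws') us' = 0"
  shows "cf (cf (F * G) ws) us = cf (cf F ws) us * cf (cf G []) []"
proof -
  have t: "wt (take i w) + wt (drop i w) = wt w" for i and w :: "'c::weighted list"
    by (metis append_take_drop_id wt_simps(3))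
  have "cf (cf F (take j ws)) (take i us) * cf (cf G (drop j ws)) (drop i us)
    = (if j = length ws then if i = length us then cf (cf F ws) us * cf (cf G []) [] else 0 else 0)"
    if "j \<le> length ws" "i \<le> length us" for i j
  proof (cases "j = length ws \<and> i = length us")
    case False
    then have "drop j ws \<noteq> [] \<or> drop i us \<noteq> []" using that by auto
    then have "wt (drop j ws) + wt (drop i us) > 0" by (metis add_is_0 gr0I wt_eq_0)
    then have "cf (cf F (take j ws)) (take i us) = 0" using t[of j ws] t[of i us] by (intro assms) linarith
    then show ?thesis using False by auto
  qed simp
  then have "cf (cf (F * G) ws) us = (\<Sum>j\<le>length ws. \<Sum>i\<le>length us.
      (if j = length ws then if i = length us then cf (cf F ws) us * cf (cf G []) [] else 0 else 0))"
    unfolding cf_cf_mult by (intro sum.cong refl) simp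
  also have "\<dots> = (\<Sum>j\<le>length ws. if j = length ws then (\<Sum>i\<le>length us. if i = length us then cf (cf F ws) us * cf (cf G []) [] else 0) else 0)"
    by (intro sum.cong refl) simp
  finally show ?thesis by (simp add: sum.delta)
qed

text \<open>The words of H^0 in the letters e_k: the last letter is not e_1, which is coded by
  0.\<close>

definition fin0 :: "nat list \<Rightarrow> bool" where
  "fin0 us \<longleftrightarrow> us = [] \<or> last us \<noteq> 0"

lemma W_last: "us \<noteq> [] \<Longrightarrow> W us \<noteq> [] \<and> (last (W us) = X \<longleftrightarrow> last us \<noteq> 0)"
proof (induction us rule: rev_induct)
  case (snoc k us)
  show ?case by (cases k) (auto simp: last_append)
qed simp

lemma h0_W: "h0 (W us) \<longleftrightarrow> fin0 us"
proof (cases "us = []")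
  case False
  then have "hd (W us) = Y" by (cases us) auto
  then show ?thesis using W_last[OF False] False by (auto simp: h0_def fin0_def)
qed (simp add: h0_def fin0_def)

lemma fin0_Cons: "fin0 (a # us) \<longleftrightarrow> (if us = [] then a \<noteq> 0 else fin0 us)"
  by (simp add: fin0_def)

lemma qsh_ne: "r \<in> set (qsh us ws) \<Longrightarrow> r = [] \<longleftrightarrow> us = [] \<and> ws = []"
  by (cases us; cases ws) auto

lemma qsh_fin0: "fin0 us \<Longrightarrow> fin0 ws \<Longrightarrow> r \<in> set (qsh us ws) \<Longrightarrow> fin0 r"
proof (induction us ws arbitrary: r rule: qsh.induct)
  case (3 a us b ws)
  have us: "fin0 us" "fin0 ws" using "3.prems" by (auto simp: fin0_Cons fin0_def split: if_splits)
  from "3.prems"(3) consider r' where "r = a # r'" "r' \<in> set (qsh us (b # ws))"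
    | r' where "r = b # r'" "r' \<in> set (qsh (a # us) ws)" | r' where "r = Suc (a + b) # r'" "r' \<in> set (qsh us ws)"
    by auto
  then show ?case
  proof cases
    case 1
    then show ?thesis using "3.IH"(1)[OF us(1) "3.prems"(2), of r'] qsh_ne[of r' us "b # ws"] by (simp add: fin0_Cons)
  next
    case 2
    then show ?thesis using "3.IH"(2)[OF "3.prems"(1) us(2), of r'] qsh_ne[of r' "a # us" ws] by (simp add: fin0_Cons)
  next
    case 3
    then show ?thesis using "3.IH"(3)[OF us, of r'] by (simp add: fin0_Cons)
  qed
qed auto

subsection \<open>The one-step operator in the letters \<open>e_k\<close>\<close>

definition uxt :: "(letter, real) ser" where "uxt = star xt"

lemma uxt_inv: "(1 - xt) * uxt = 1" "uxt * (1 - xt) = 1"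
  by (simp_all add: uxt_def star_inverse)

lemma uxt_xt: "uxt * xt = xt * uxt"
proof -
  have "uxt * xt = uxt - 1" "xt * uxt = uxt - 1" using uxt_inv by (simp_all add: algebra_simps)
  then show ?thesis by simp
qed

lemma yt_ux: "yt * ux = uxt * y"
proof -
  have "yt * ux = (uxt * (1 - xt)) * yt * ux" by (simp add: uxt_inv)
  also have "\<dots> = uxt * ((1 - xt) * yt) * ux" by (simp only: mult.assoc)
  also have "\<dots> = uxt * y * ((1 - x) * ux)" unfolding twist_y by (simp only: mult.assoc)
  finally show ?thesis by (simp add: ux_inv)
qed

lemma inv_ux: "(1 - xt - y) * ux = 1 - uxt * y"
proof -
  have "(1 - xt - y) * ux = (1 - x) * ux - yt * ux" by (simp add: yt_def algebra_simps)
  then show ?thesis by (simp only: ux_inv yt_ux)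
qed

text \<open>The images of the letters \<open>e_{k+1} = y x^k\<close> under the automorphism, conjugated by \<open>1 - xt\<close>
  so that they again have the form \<open>y H\<close>.\<close>
definition Cc :: "nat \<Rightarrow> (letter, real) ser" where
  "Cc k = (1 - xt) * (yt * xt ^ k) * uxt"

text \<open>In the letters e_k this is 1 + e_1 + e_2 + ..., a group-like series.\<close>

definition gy :: "(letter, real) ser" where "gy = 1 + y * ux"

text \<open>Trades the right factor of \<open>onestep\<close> for \<open>uxt * gy\<close>, up to a
  multiple of y on the right, which no word of H^0 detects.\<close>

lemma uxt_gy: "uxt * gy = (1 - yt) * ux + (uxt + uxt * uxt) * y"
proof -
  have "(1 - xt) * ((1 - yt) * ux) = (1 - xt) * ux - ((1 - xt) * yt) * ux" by (simp add: algebra_simps)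
  also have "\<dots> = (1 - xt) * ux - y * ((1 - x) * ux)" unfolding twist_y by (simp only: mult.assoc)
  also have "\<dots> = (1 - xt - y) * ux + y * ux - y" unfolding ux_inv by (simp add: algebra_simps)
  finally have "(1 - xt) * ((1 - yt) * ux) = gy - y - uxt * y" by (simp add: inv_ux gy_def)
  then have "uxt * ((1 - xt) * ((1 - yt) * ux)) = uxt * (gy - y - uxt * y)" by simp
  then show ?thesis by (simp add: mult.assoc[symmetric] uxt_inv) (simp add: algebra_simps)
qed

lemma Cc_y: "Cc k = y * ((1 - x) * xt ^ k * uxt)"
proof -
  have "Cc k = ((1 - xt) * yt) * (xt ^ k * uxt)" by (simp only: Cc_def mult.assoc)
  then show ?thesis by (simp only: twist_y mult.assoc)
qed

lemma ysup_Cc [simp]: "ysup (Cc k)" and ysup_gy [simp]: "ysup gy"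
  by (simp_all add: Cc_y gy_def)

lemma ysup_ey: "ysup (ey k)" by (simp add: ey_def)

lemma adm_yt: "adm (\<lambda>k. yt * xt ^ k)"
proof -
  have "ordge (Suc k) (yt * xt ^ k)" for k
    using ordge_mult[of 1 yt k "xt ^ k"] ordge_power[of xt k] by (simp add: ordge_1[unfolded One_nat_def])
  then show ?thesis by (simp add: adm_def)
qed

lemma adm_Cc: "adm Cc"
  using adm_yt by (simp add: adm_def Cc_def ordge_multL)

definition XX :: "(nat, real) ser \<Rightarrow> (nat, real) ser" where
  "XX = sb (\<lambda>k. kap (Cc k))"

definition kv where "kv = kap vy"
definition kg where "kg = kap gy"

lemma chi_eq:
  assumes "ysup h"
  shows "(1 - xt) * sb tw h * uxt = sb Cc (kap h)"
proof -
  have "sb tw h = sb tw (sb ey (kap h))" by (simp add: sb_ey_kap assms)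
  also have "\<dots> = sb (\<lambda>k. sb tw (ey k)) (kap h)" by (rule sb_sb[OF adm_ey adm_tw])
  also have "(\<lambda>k. sb tw (ey k)) = (\<lambda>k. yt * xt ^ k)"
  proof
    fix k
    have "sb tw (x ^ k) = xt ^ k" by (induction k) (simp_all add: sb_1 sb_mult sb_L adm_tw)
    then show "sb tw (ey k) = yt * xt ^ k" by (simp add: ey_def sb_mult sb_L adm_tw)
  qed
  finally have "(1 - xt) * sb tw h * uxt = (1 - xt) * sb (\<lambda>k. yt * xt ^ k) (kap h) * uxt" by simp
  also have "\<dots> = sb (\<lambda>k. (1 - xt) * (yt * xt ^ k) * uxt) (kap h)"
    by (rule sb_conj[symmetric]) (simp_all add: adm_yt uxt_inv)
  finally show ?thesis by (simp add: Cc_def[abs_def])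
qed

lemma kap_sb_Cc: "kap (sb Cc f) = XX f"
  by (simp add: XX_def kap_sb adm_Cc)

lemma ysup_sb_Cc: "ysup (sb Cc f)"
  by (simp add: ysup_sb adm_Cc)

lemma cf_ends_y: "fin0 us \<Longrightarrow> cf (G * y) (W us) = 0"
proof (cases "us = []")
  case False
  assume "fin0 us"
  then have l: "W us \<noteq> []" "last (W us) = X" using W_last[OF False] False by (auto simp: fin0_def)
  then obtain w where "W us = w @ [X]" by (metis append_butlast_last_id)
  then show ?thesis by (simp add: cf_mult_L)
qed simp

lemma ysup_res0: "ysup (res0 F)"
  by (simp add: res0_def ysup_def cf_one mult.assoc)

text \<open>The three factors of the main term are supported on H^1, so \<open>kap\<close> carries
  it to the letters e_k; the error ends in y and vanishes on H^0.\<close>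

lemma onestep_mod_y: "\<exists>G. onestep F = vy * sb Cc (kap (res0 F)) * gy + G * y"
proof -
  let ?z = "y * nu F * x"
  have v: "vy = 1 + vy * y" and u: "ux = 1 + x * ux"
    using vy_inv ux_inv by (simp_all add: algebra_simps)
  have "vy * gy = vy + vy * y * ux" by (simp add: gy_def algebra_simps)
  also have "vy * y * ux = vy * y + vy * y * x * ux" by (subst u) (simp add: algebra_simps)
  finally have c: "1 + vy * y * x * ux = vy * gy - (vy + vy) * y"
    using v by (simp add: algebra_simps)
  have e: "(1 - yt) * ux = uxt * gy - (uxt + uxt * uxt) * y"
    by (simp add: uxt_gy)
  have "onestep F = F [] *\<^sub>R (vy * gy - (vy + vy) * y) + vy * ((1 - xt) * sb tw ?z * ((1 - yt) * ux))"
    unfolding onestep_def c by (simp only: mult.assoc)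
  also have "\<dots> = vy * (F [] *\<^sub>R 1 + (1 - xt) * sb tw ?z * uxt) * gy
      + (- (F [] *\<^sub>R (vy + vy)) - vy * (1 - xt) * sb tw ?z * (uxt + uxt * uxt)) * y"
    unfolding e by (simp add: algebra_simps)
  also have "F [] *\<^sub>R 1 + (1 - xt) * sb tw ?z * uxt = (1 - xt) * sb tw (res0 F) * uxt"
    by (simp add: res0_def sb_add sb_scale sb_1 adm_tw distrib_left distrib_right uxt_inv)
  also have "\<dots> = sb Cc (kap (res0 F))" by (rule chi_eq[OF ysup_res0])
  finally show ?thesis by blast
qed

lemma kap_vCg: "kap (vy * sb Cc f * gy) = kv * XX f * kg"
  by (simp add: kap_mult ysup_sb_Cc kv_def kg_def kap_sb_Cc)

lemma cf_onestep_W: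
  assumes "fin0 us"
  shows "cf (onestep F) (W us) = cf (kv * XX (kap (res0 F)) * kg) us"
proof -
  obtain G where "onestep F = vy * sb Cc (kap (res0 F)) * gy + G * y" using onestep_mod_y by blast
  then have "cf (onestep F) (W us) = cf (vy * sb Cc (kap (res0 F)) * gy) (W us)"
    using cf_ends_y[OF assms] by simp
  also have "\<dots> = cf (kap (vy * sb Cc (kap (res0 F)) * gy)) us" by simp
  finally show ?thesis unfolding kap_vCg .
qed

lemma XX_hom: "XX (f * g) = XX f * XX g" "XX (L k) = kap (Cc k)" "XX 1 = 1"
  and XX_lin: "linear XX"
  by (simp_all add: XX_def sb_mult sb_L sb_1 adm_kap adm_Cc sb_linear)

text \<open>\<open>Cc 0 * gy\<close> ends in y, so coefficients at words ending in e_1 do not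
  influence the result on H^0.\<close>

lemma XX_ends0:
  assumes "fin0 us"
  shows "cf (kv * XX (h * L 0) * kg) us = 0"
proof -
  have "Cc 0 * gy = y * (1 - x) * (uxt * gy)" by (simp add: Cc_y mult.assoc)
  also have "uxt * gy = (1 - yt) * ux + (uxt + uxt * uxt) * y" by (rule uxt_gy)
  also have "y * (1 - x) * ((1 - yt) * ux + (uxt + uxt * uxt) * y)
     = y * ((1 - x) * ux) - y * (1 - x) * (yt * ux) + y * (1 - x) * (uxt + uxt * uxt) * y"
    by (simp add: algebra_simps)
  also have "\<dots> = (1 - y * (1 - x) * uxt + y * (1 - x) * (uxt + uxt * uxt)) * y"
    unfolding yt_ux ux_inv by (simp add: algebra_simps)
  finally obtain G where G: "Cc 0 * gy = G * y" by blast
  have "kv * XX (h * L 0) * kg = kap (vy * sb Cc (h * L 0) * gy)" by (simp add: kap_vCg)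
  also have "vy * sb Cc (h * L 0) * gy = vy * sb Cc h * (Cc 0 * gy)"
    by (simp add: sb_mult sb_L adm_Cc mult.assoc)
  also have "\<dots> = (vy * sb Cc h * G) * y" by (simp only: G mult.assoc)
  finally have "cf (kv * XX (h * L 0) * kg) us = cf ((vy * sb Cc h * G) * y) (W us)" by simp
  then show ?thesis using cf_ends_y[OF assms] by simp
qed

text \<open>The twist equations give \<open>xt * p = p * x\<close> for
  \<open>p = 1 - uxt * y\<close>; this intertwiner converts powers of \<open>xt\<close> into powers
  of x.\<close>

lemma Cc_rec: "Cc (Suc k) = Cc k * (1 - y) + ey (Suc k) - (1 - Cc 0) * ey k"
proof -
  define p where "p = 1 - uxt * y"
  have "(1 - xt) * (xt * p) = xt * ((1 - xt) * p)" by (simp add: algebra_simps)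
  also have "(1 - xt) * p = 1 - xt - y"
    by (simp add: p_def right_diff_distrib mult.assoc[symmetric] uxt_inv)
  also have "xt * (1 - xt - y) = (1 - xt - y) * x"
    using twist_x by (simp add: yt_def algebra_simps)
  also have "\<dots> = (1 - xt) * (p * x)"
    by (simp add: \<open>(1 - xt) * p = 1 - xt - y\<close>[symmetric] mult.assoc)
  finally have "uxt * ((1 - xt) * (xt * p)) = uxt * ((1 - xt) * (p * x))" by simp
  then have xp: "xt * p = p * x" by (simp add: mult.assoc[symmetric] uxt_inv)
  have k: "xt ^ k * p = p * x ^ k"
  proof (induction k)
    case (Suc k)
    have "xt ^ Suc k * p = xt * (xt ^ k * p)" by (simp add: mult.assoc)
    also have "\<dots> = (xt * p) * x ^ k" by (simp add: Suc mult.assoc)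
    finally show ?case by (simp add: xp mult.assoc)
  qed simp
  have "uxt * xt = uxt - 1" using uxt_inv(2) by (simp add: algebra_simps)
  then have s: "xt ^ Suc k * uxt = xt ^ k * (uxt - 1)"
    by (simp add: power_Suc2 mult.assoc uxt_xt[symmetric] del: power_Suc)
  have "Cc (Suc k) - Cc k * (1 - y) = y * ((1 - x) * (xt ^ Suc k * uxt - xt ^ k * uxt * (1 - y)))"
    by (simp add: Cc_y algebra_simps)
  also have "xt ^ Suc k * uxt - xt ^ k * uxt * (1 - y) = - (xt ^ k * p)"
    unfolding s p_def by (simp add: algebra_simps)
  also have "- (xt ^ k * p) = - (p * x ^ k)" by (simp only: k)
  also have "y * ((1 - x) * (- (p * x ^ k))) = ey (Suc k) - (1 - Cc 0) * ey k"
    unfolding p_def by (simp add: Cc_y ey_def algebra_simps power_Suc2 power_commutes)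
  finally show ?thesis by (simp add: algebra_simps)
qed

section \<open>Coproducts of the images of the letters e_k\<close>

definition kC :: "nat \<Rightarrow> (nat, real) ser" where "kC k = kap (Cc k)"

lemma kC_rec: "kC (Suc k) = kC k * (1 - L 0) + L (Suc k) - (1 - kC 0) * L k"
proof -
  have "kap y = L 0" using kap_ey[of 0] by (simp add: ey_def)
  moreover have "kap ((1 - Cc 0) * ey k) = (1 - kC 0) * L k"
    using kap_mult[OF ysup_ey, of "1 - Cc 0" k] by (simp add: kap_ey kC_def)
  ultimately show ?thesis unfolding kC_def
    by (subst Cc_rec) (simp add: kap_mult kap_ey kC_def)
qed

lemma ordge_kC: "ordge (Suc k) (kC k)"
  using adm_kap[OF adm_Cc] by (simp add: adm_def kC_def)

text \<open>The characters of the coproduct obtained from quasi-symmetric functions in one variable \<open>s\<close>.\<close>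
definition gs :: "real \<Rightarrow> (nat, real) ser" where
  "gs s = Ser (\<lambda>ks. if ks = [] then 1 else if tl ks = [] then s ^ Suc (hd ks) else 0)"

lemma cf_gs [simp]: "cf (gs s) [] = 1" "cf (gs s) (k # v) = s ^ Suc k * cf 1 v"
  by (simp_all add: gs_def cf_one)

lemma Del_gs: "Del (gs s) = Cst (gs s) * Rr (gs s)"
proof -
  have "Qs (cf (gs s)) us ws = cf (gs s) us * cf (gs s) ws" for us ws
  proof (cases us; cases ws)
    fix a us' b ws' assume *: "us = a # us'" "ws = b # ws'"
    show ?thesis unfolding * Qs_simps(3) cf_gs Qs_mult Qs_one
      by (simp add: cf_one power_add)
  qed simp_all
  then show ?thesis by (simp add: ser_eq_iff cf_Cst_mult)
qed

lemma cf_y_star: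
  assumes "cf f [] = 0" "length w \<le> N"
  shows "cf (y * star (s *\<^sub>R f)) w = (\<Sum>k\<le>N. s ^ k * cf (y * f ^ k) w)"
proof -
  have "cf (y * star (s *\<^sub>R f)) w = cf (y * (\<Sum>n\<le>N. (s *\<^sub>R f) ^ n)) w"
    unfolding cf_mult by (rule cmul_cong) (use assms in \<open>auto simp: cf_star\<close>)
  moreover have "(s *\<^sub>R f) ^ k = s ^ k *\<^sub>R f ^ k" for k by (induction k) simp_all
  ultimately show ?thesis by (simp add: sum_distrib_left cf_sum)
qed

lemma kap_geom:
  assumes "cf f [] = 0" "wt us \<le> N"
  shows "cf (kap (1 + s *\<^sub>R (y * star (s *\<^sub>R f)))) us = cf 1 us + (\<Sum>k\<le>N. s ^ Suc k * cf (kap (y * f ^ k)) us)"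
proof -
  have "cf (kap 1) us = cf 1 us" by (simp only: kap_simps)
  then show ?thesis
    using cf_y_star[OF assms(1), of "W us" N s] assms(2) by (simp add: wt_W sum_distrib_left mult.assoc)
qed

lemma kap_gs: "kap (1 + s *\<^sub>R (y * star (s *\<^sub>R x))) = gs s"
proof (rule ser_eqI)
  fix us
  have "cf (kap (1 + s *\<^sub>R (y * star (s *\<^sub>R x)))) us = cf 1 us + (\<Sum>k\<le>wt us. s ^ Suc k * cf (kap (ey k)) us)"
    unfolding ey_def by (rule kap_geom) simp_all
  also have "\<dots> = cf (gs s) us"
  proof (cases us)
    case (Cons j v)
    have "(\<Sum>k\<le>wt us. s ^ Suc k * cf (kap (ey k)) us) = (\<Sum>k\<le>wt us. if k = j then s ^ Suc j * cf 1 v else 0)"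
      by (intro sum.cong refl) (auto simp: kap_ey cf_L Cons cf_one)
    then show ?thesis by (simp add: Cons sum.delta)
  qed (simp add: kap_ey)
  finally show "cf (kap (1 + s *\<^sub>R (y * star (s *\<^sub>R x)))) us = cf (gs s) us" .
qed

lemma kg_gs: "kg = gs 1"
  using kap_gs[of 1] by (simp add: kg_def gy_def ux_def)

text \<open>The coproduct of e_{k+1}, namely the sum of e_i \<otimes> e_j over i + j = k + 1 with
  e_0 = 1, where \<open>C\<close> replaces the letters in the first factor. An outer letter j means
  e_{j+1} and leaves e_{k-j}, coded by k - 1 - j.\<close>

definition DD :: "(nat \<Rightarrow> (nat, real) ser) \<Rightarrow> nat \<Rightarrow> (nat, (nat, real) ser) ser" where
  "DD C k = Ser (\<lambda>ws. if ws = [] then C k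
     else if tl ws = [] then (if hd ws = k then 1 else if hd ws < k then C (k - 1 - hd ws) else 0) else 0)"

lemma Del_L: "Del (L k) = DD L k"
proof -
  have L: "(\<lambda>v. cf (L k) (a # v)) = (\<lambda>v. (if a = k then 1 else 0) * cf 1 v)" for a :: nat
    by (auto simp: cf_L cf_one fun_eq_iff)
  have "Qs (cf (L k)) us ws = cf (cf (DD L k) ws) us" for us ws
  proof (cases us; cases ws)
    fix a us' b ws' assume *: "us = a # us'" "ws = b # ws'"
    show ?thesis unfolding * Qs_simps(3) L Qs_mult Qs_one
      by (auto simp: DD_def cf_L cf_one)
  qed (auto simp: DD_def cf_L cf_one)
  then show ?thesis by (simp add: ser_eq_iff)
qed

text \<open>Setting \<open>e_1 = 0\<close> in the outer tensor factor.\<close>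
definition kz :: "(nat, 'r::ring_1) ser \<Rightarrow> (nat, 'r) ser" where
  "kz F = Ser (\<lambda>ws. if 0 \<in> set ws then 0 else cf F ws)"

lemma cf_kz: "cf (kz F) ws = (if 0 \<in> set ws then 0 else cf F ws)"
  by (simp add: kz_def)

lemma kz_mult: "kz (F * G) = kz F * kz G"
proof (rule ser_eqI)
  fix ws show "cf (kz (F * G)) ws = cf (kz F * kz G) ws"
  proof (cases "0 \<in> set ws")
    case True
    have "0 \<in> set (take i ws) \<or> 0 \<in> set (drop i ws)" for i
      using True by (metis Un_iff append_take_drop_id set_append)
    then have "cf (kz F) (take i ws) * cf (kz G) (drop i ws) = 0" for i by (metis cf_kz mult_zero_left mult_zero_right)
    then show ?thesis using True by (simp add: cf_kz[of "F * G"] cf_mult cmul_take_drop)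
  next
    case False
    then show ?thesis unfolding cf_kz cf_mult
      by (auto intro!: cmul_cong simp: cf_kz)
  qed
qed

lemma kz_simps [simp]: "kz (Cst h) = Cst h" "kz (F + G) = kz F + kz G" "kz (F - G) = kz F - kz G" "kz 1 = 1"
  by (simp_all add: ser_eq_iff cf_kz cf_Cst cf_one)

definition mapser :: "('r \<Rightarrow> 'r) \<Rightarrow> ('l, 'r::ring_1) ser \<Rightarrow> ('l, 'r) ser" where
  "mapser H F = Ser (\<lambda>ws. H (cf F ws))"

lemma cf_mapser [simp]: "cf (mapser H F) ws = H (cf F ws)"
  by (simp add: mapser_def)

lemma mapser_mult:
  assumes "\<And>f g. H (f * g) = H f * H g" "\<And>f g. H (f + g) = H f + H g" "H 0 = 0"
  shows "mapser H (F * G) = mapser H F * mapser H G"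
proof -
  have s: "H (sum f A) = (\<Sum>a\<in>A. H (f a))" for f :: "nat \<Rightarrow> 'a" and A
    by (induction A rule: infinite_finite_induct) (simp_all add: assms)
  show ?thesis by (rule ser_eqI) (simp add: cf_mult cmul_take_drop s assms)
qed

definition DelZ where "DelZ f = kz (Del f)"

lemma DelZ_mult: "DelZ (f * g) = DelZ f * DelZ g"
  by (simp add: DelZ_def Del_mult kz_mult)

lemma DelZ_add: "DelZ (f + g) = DelZ f + DelZ g" "DelZ (f - g) = DelZ f - DelZ g" "DelZ 1 = 1"
  by (simp_all add: DelZ_def linear_add[OF Del_linear] linear_diff[OF Del_linear] Del_1)

lemma cf_DelZ: "cf (cf (DelZ f) ws) us = (if 0 \<in> set ws then 0 else Qs (cf f) us ws)"
  by (simp add: DelZ_def cf_kz)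

lemma Qs_ordge: "ordge n f \<Longrightarrow> wt us + wt ws < n \<Longrightarrow> Qs (cf f) us ws = 0"
proof -
  assume a: "ordge n f" "wt us + wt ws < n"
  have "Qs (cf f) us ws = Qs (\<lambda>v. 0) us ws"
    by (rule Qs_cong) (use a wt_qsh in \<open>auto simp: ordge_def\<close>)
  then show ?thesis by (simp add: Qs_def)
qed

lemma DelZ_L0: "DelZ (L 0) = Cst (L 0)"
  by (rule ser_eqI) (auto simp: DelZ_def Del_L DD_def cf_kz cf_Cst list.set_sel neq_Nil_conv)

definition DDz where "DDz C k = kz (DD C k)"

lemma cf_DDz: "cf (DDz C k) [] = C k"
  "cf (DDz C k) (j # ws) = (if ws = [] \<and> j > 0 then (if j = k then 1 else if j < k then C (k - 1 - j) else 0) else 0)"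
  by (auto simp: DDz_def DD_def cf_kz)

lemma DDz_kC_rec: "DDz kC (Suc k) = DDz kC k * Cst (1 - L 0) + DelZ (L (Suc k)) - Cst (1 - kC 0) * DelZ (L k)"
proof (rule ser_eqI)
  fix ws
  have D: "DelZ (L i) = DDz L i" for i by (simp add: DelZ_def DDz_def Del_L)
  show "cf (DDz kC (Suc k)) ws = cf (DDz kC k * Cst (1 - L 0) + DelZ (L (Suc k)) - Cst (1 - kC 0) * DelZ (L k)) ws"
  proof (cases ws)
    case Nil
    then show ?thesis using kC_rec[of k] by (simp add: D cf_mult_Cst cf_Cst_mult cf_DDz cf_Cst del: Cst_simps)
  next
    case (Cons j v)
    consider "v \<noteq> [] \<or> j = 0" | "v = []" "0 < j" "j < k" | "v = []" "0 < j" "j = k" | "v = []" "j = Suc k" | "v = []" "j > Suc k"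
      by linarith
    then show ?thesis
    proof cases
      case 2
      then obtain i where i: "k = Suc (i + j)" by (metis add.commute less_imp_Suc_add)
      show ?thesis using 2 kC_rec[of i] by (simp add: Cons D cf_mult_Cst cf_Cst_mult cf_DDz i del: Cst_simps)
    qed (auto simp: Cons D cf_mult_Cst cf_Cst_mult cf_DDz simp del: Cst_simps)
  qed
qed

text \<open>The error \<open>ga\<close> obeys a recursion whose lowest part reads
  \<open>ga (Suc k) = ga k\<close>. Since \<open>ga k\<close> has order at least k + 1, this
  stationary part must be zero.\<close>

lemma DelZ_kC: "DelZ (kC k) = DDz kC k"
proof -
  define ga where "ga = (\<lambda>k. DelZ (kC k) - DDz kC k)"
  have rec: "ga (Suc k) = ga k * Cst (1 - L 0) + ga 0 * DelZ (L k)" for k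
  proof -
    have "DelZ (kC (Suc k)) = DelZ (kC k) * Cst (1 - L 0) + DelZ (L (Suc k)) - (1 - DelZ (kC 0)) * DelZ (L k)"
      by (subst kC_rec) (simp add: DelZ_mult DelZ_add DelZ_L0)
    moreover have "DDz kC 0 = Cst (kC 0)"
      by (rule ser_eqI, case_tac w) (auto simp: cf_DDz cf_Cst)
    ultimately show ?thesis unfolding ga_def DDz_kC_rec[of k] by (simp add: algebra_simps)
  qed
  have big: "cf (cf (ga k) ws) us = 0" if "wt ws + wt us < Suc k" for k ws us
  proof -
    have "cf (cf (DelZ (kC k)) ws) us = 0"
      unfolding cf_DelZ using Qs_ordge[OF ordge_kC, of us ws k] that by simp
    moreover have "cf (cf (DDz kC k) ws) us = 0"
    proof (cases ws)
      case Nil then show ?thesis using ordge_kC[of k] that by (simp add: cf_DDz ordge_def)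
    next
      case (Cons j v)
      have "cf (kC (k - 1 - j)) us = 0" if "j < k" "v = []"
        using ordge_kC[of "k - 1 - j"] \<open>wt ws + wt us < Suc k\<close> that Cons by (simp add: ordge_def)
      then show ?thesis using that Cons by (simp add: cf_DDz)
    qed
    ultimately show ?thesis by (simp add: ga_def)
  qed
  have "cf (cf (ga k) ws) us = 0" for k ws us
  proof (induction "wt ws + wt us" arbitrary: k ws us rule: less_induct)
    case less
    have step: "cf (cf (ga (Suc i)) ws) us = cf (cf (ga i) ws) us" for i
    proof -
      have "cf (cf (ga i * Cst (1 - L 0)) ws) us = cf (cf (ga i) ws) us"
        by (subst low_mult) (use less in \<open>auto simp: cf_Cst\<close>)
      moreover have "cf (cf (ga 0 * DelZ (L i)) ws) us = 0"
        by (subst low_mult) (use less in \<open>auto simp: cf_DelZ\<close>)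
      ultimately show ?thesis unfolding rec[of i] by simp
    qed
    have "cf (cf (ga (k + n)) ws) us = cf (cf (ga k) ws) us" for n
      by (induction n) (simp_all add: step)
    from this[of "wt ws + wt us"] show ?case using big[of ws us "k + (wt ws + wt us)"] by simp
  qed
  then have "ga k = 0" by (intro ser_eqI) simp
  then show ?thesis by (simp add: ga_def)
qed

text \<open>Multiplicativity and continuity reduce the claim to letters, where it is
  \<open>DelZ_kC\<close>; the operator touches only the first tensor factor.\<close>

lemma DelZ_XX: "DelZ (XX f) = mapser XX (DelZ f)"
proof (rule ser_eqI, rule ser_eqI)
  fix ws us
  let ?H1 = "\<lambda>f. cf (cf (DelZ (XX f)) ws) us" and ?H2 = "\<lambda>f. cf (cf (mapser XX (DelZ f)) ws) us"
  have XXs: "XX (f + g) = XX f + XX g" "XX (c *\<^sub>R f) = c *\<^sub>R XX f" "XX 0 = 0" for f g c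
    by (simp_all add: linear_add[OF XX_lin] linear_scale[OF XX_lin] linear_0[OF XX_lin])
  have DZs: "DelZ (c *\<^sub>R f) = c *\<^sub>R DelZ f" for c f
    by (simp add: DelZ_def ser_eq_iff cf_kz linear_scale[OF Del_linear])
  have mm: "mapser XX (F * G) = mapser XX F * mapser XX G" for F G
    by (rule mapser_mult) (simp_all add: XX_hom XXs)
  show "?H1 f = ?H2 f"
  proof (rule linear_eq_by_mons[of ?H1 ?H2 "Suc (wt us + wt ws)"])
    show "linear ?H1" "linear ?H2" by (rule linearI; simp add: XXs DelZ_add DZs)+
    fix g :: "(nat, real) ser" assume g: "ordge (Suc (wt us + wt ws)) g"
    then have "ordge (Suc (wt us + wt ws)) (XX g)" by (simp add: XX_def sb_ordge)
    then show "?H1 g = 0" unfolding cf_DelZ by (simp add: Qs_ordge)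
    have "ordge (Suc (wt us)) (cf (DelZ g) ws)"
      unfolding ordge_def cf_DelZ using Qs_ordge[OF g] by simp
    then have "ordge (Suc (wt us)) (XX (cf (DelZ g) ws))" by (simp add: XX_def sb_ordge)
    then show "?H2 g = 0" by (simp add: ordge_def)
  next
    fix v
    have "DelZ (XX (mon v)) = mapser XX (DelZ (mon v))"
    proof (induction v)
      case Nil
      have "mapser XX 1 = (1 :: (nat, (nat, real) ser) ser)" by (simp add: ser_eq_iff cf_one XX_hom XXs)
      then show ?case by (simp add: XX_hom DelZ_add)
    next
      case (Cons k v)
      have "mapser XX (DDz L k) = DDz kC k"
        by (rule ser_eqI, case_tac w) (auto simp: cf_DDz XX_hom XXs kC_def)
      moreover have "DelZ (L k) = DDz L k" by (simp add: DelZ_def DDz_def Del_L)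
      ultimately have "DelZ (XX (L k)) = mapser XX (DelZ (L k))"
        using DelZ_kC[of k] by (simp add: XX_hom kC_def)
      then show ?case by (simp add: XX_hom(1) DelZ_mult Cons mm)
    qed
    then show "?H1 (mon v) = ?H2 (mon v)" by simp
  qed
qed

text \<open>\<open>kv\<close> inverts 1 - e_1, and e_1 is primitive, so only its part in the first
  factor survives setting e_1 = 0 in the second.\<close>

lemma DelZ_kv: "DelZ kv = Cst kv"
proof -
  have k: "kap y = L 0" using kap_ey[of 0] by (simp add: ey_def)
  have "ysup vy" by (simp add: vy_def ysup_star)
  then have "kv * (1 - L 0) = 1" "(1 - L 0) * kv = 1"
    using kap_mult[of "1 - y" vy] kap_mult[of vy "1 - y"] vy_inv by (simp_all add: kv_def k)
  then have "DelZ (kv * (1 - L 0)) = 1" "Cst ((1 - L 0) * kv) = 1"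
    by (simp_all only: DelZ_add Cst_simps)
  then have 1: "DelZ kv * Cst (1 - L 0) = 1" "Cst (1 - L 0) * Cst kv = 1"
    by (simp_all add: DelZ_mult DelZ_add DelZ_L0 Cst_mult)
  have "DelZ kv = DelZ kv * (Cst (1 - L 0) * Cst kv)" by (simp only: 1 mult_1_right)
  also have "\<dots> = Cst kv" by (simp only: mult.assoc[symmetric] 1(1) mult_1_left)
  finally show ?thesis .
qed

section \<open>Functionals composed with harmonic multiplication by a word\<close>

definition ix :: "word \<Rightarrow> nat list" where
  "ix u = (SOME ks. W ks = u)"

lemma ix_W [simp]: "ix (W ks) = ks"
  unfolding ix_def using W_inj by (metis (mono_tags, lifting) someI_ex)

text \<open>The transpose of u -> u * W ws for the harmonic product.\<close>

definition ract :: "(word \<Rightarrow> real) \<Rightarrow> nat list \<Rightarrow> word \<Rightarrow> real" where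
  "ract F ws u = Qs (\<lambda>r. F (W r)) (ix u) ws"

lemma cf_kap_res0: "cf (kap (res0 F)) us = (if fin0 us then F (W us) else 0)"
proof (cases "fin0 us")
  case True then show ?thesis by (simp add: cf_res0 h0_W)
next
  case False
  then obtain vs where us: "us = vs @ [0]" unfolding fin0_def by (metis append_butlast_last_id)
  have "cf ((y * nu F) * x) (W vs @ [Y]) = 0" by (simp add: cf_mult_L del: mult.assoc)
  then show ?thesis using False by (simp add: us res0_def cf_one del: mult.assoc)
qed

text \<open>In the second tensor factor the operator changes nothing except for the group-like
  \<open>kg\<close>, which consumes at the end of the word either nothing or the single letter j.
  These two cases are the two summands.\<close>

theorem onestep_ract:
  assumes us: "fin0 us" and ws: "0 \<notin> set (ws @ [j])"
  shows "Qs (\<lambda>r. cf (onestep F) (W r)) us (ws @ [j])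
    = cf (onestep (ract F (ws @ [j]))) (W us) + cf (onestep (ract F ws)) (W us)"
proof -
  define f where "f = kap (res0 F)"
  define t where "t = kv * XX f * kg"
  have fw: "fin0 (ws @ [j])" "fin0 ws"
    using ws last_in_set[of ws] by (auto simp: fin0_def simp del: last_in_set) (metis last_in_set)
  have "Qs (\<lambda>r. cf (onestep F) (W r)) us (ws @ [j]) = Qs (cf t) us (ws @ [j])"
    by (rule Qs_cong) (use qsh_fin0[OF us fw(1)] in \<open>simp add: cf_onestep_W t_def f_def\<close>)
  also have "\<dots> = cf (cf (DelZ t) (ws @ [j])) us" using ws by (simp add: cf_DelZ)
  also have "DelZ t = (Cst kv * mapser XX (DelZ f) * Cst kg) * kz (Rr kg)"
    by (simp add: t_def DelZ_mult DelZ_kv DelZ_XX mult.assoc)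
       (simp add: DelZ_def kg_gs Del_gs kz_mult)
  also have "cf ((Cst kv * mapser XX (DelZ f) * Cst kg) * kz (Rr kg)) (ws @ [j])
     = cf (Cst kv * mapser XX (DelZ f) * Cst kg) (ws @ [j]) + cf (Cst kv * mapser XX (DelZ f) * Cst kg) ws"
  proof -
    have "cmul (cf (Cst kv * mapser XX (DelZ f) * Cst kg)) (\<lambda>v. cf (kz (Rr kg)) (v @ [j])) ws
        = cmul (cf (Cst kv * mapser XX (DelZ f) * Cst kg)) (\<lambda>v. if v = [] then 1 else 0) ws"
    proof (rule cmul_cong)
      fix v v' assume v: "v @ v' = ws"
      have "cf (kz (Rr kg)) (v' @ [j]) = cf kg (v' @ [j]) *\<^sub>R (1 :: (nat, real) ser)"
        using ws v by (auto simp: cf_kz)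
      also have "cf kg (v' @ [j]) = (if v' = [] then 1 else 0)"
        by (cases v') (simp_all add: kg_gs cf_one)
      finally show "cf (kz (Rr kg)) (v' @ [j]) = (if v' = [] then 1 else (0 :: (nat, real) ser))" by simp
    qed simp
    then show ?thesis
      by (simp add: cf_mult_snoc cmul_one_right) (simp add: cf_kz kg_gs)
  qed
  also have "cf (\<dots>) us = cf (kv * XX (cf (DelZ f) (ws @ [j])) * kg) us + cf (kv * XX (cf (DelZ f) ws) * kg) us"
    by (simp add: cf_Cst_mult cf_mult_Cst)
  also have "cf (kv * XX (cf (DelZ f) w') * kg) us = cf (onestep (ract F w')) (W us)" if w': "fin0 w'" "0 \<notin> set w'" for w'
  proof -
    \<comment> \<open>The difference lives on words ending in e_1, so \<open>XX_ends0\<close>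
      removes it.\<close>
    define d where "d = cf (DelZ f) w' - kap (res0 (ract F w'))"
    have d0: "cf d v = 0" if "fin0 v" for v
    proof -
      have "Qs (cf f) v w' = Qs (\<lambda>r. F (W r)) v w'"
        by (rule Qs_cong) (use qsh_fin0[OF that w'(1)] in \<open>simp add: f_def cf_kap_res0 del: cf_kap\<close>)
      then show ?thesis using that w'(2) by (simp add: d_def cf_DelZ cf_kap_res0 ract_def del: cf_kap)
    qed
    have "d = Ser (\<lambda>v. cf d (v @ [0])) * L 0"
    proof (rule ser_eqI)
      fix v show "cf d v = cf (Ser (\<lambda>v. cf d (v @ [0])) * L 0) v"
      proof (cases v rule: rev_cases)
        case Nil then show ?thesis using d0[of "[]"] by (simp add: fin0_def)
      next
        case (snoc u k)
        then show ?thesis using d0[of v] by (cases k) (simp_all add: cf_mult_L fin0_def)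
      qed
    qed
    then have "cf (kv * XX d * kg) us = 0" using XX_ends0[OF us] by metis
    moreover have "cf (DelZ f) w' = kap (res0 (ract F w')) + d" by (simp add: d_def)
    ultimately show ?thesis
      by (simp add: linear_add[OF XX_lin] distrib_left distrib_right cf_onestep_W[OF us])
  qed
  note this[OF fw(1) ws]
  finally show ?thesis using \<open>\<And>w'. fin0 w' \<Longrightarrow> 0 \<notin> set w' \<Longrightarrow> cf (kv * XX (cf (DelZ f) w') * kg) us = cf (onestep (ract F w')) (W us)\<close>[OF fw(2)] ws
    by simp
qed

section \<open>Preservation of primitivity\<close>

text \<open>The transpose of \<phi> on letters (\<open>cf_fl\<close>); an involution, as \<phi> is
  one.\<close>

definition fl :: "letter \<Rightarrow> (letter, real) ser" where
  "fl a = (case a of X \<Rightarrow> x | Y \<Rightarrow> x - y)"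

lemma fl_simps [simp]: "fl X = x" "fl Y = x - y" by (simp_all add: fl_def)

lemma adm_fl: "adm fl" by (simp add: adm_letter)

lemma fl_fl: "sb fl (sb fl f) = f"
proof -
  have "(\<lambda>k. sb fl (fl k)) = L"
  proof
    fix k show "sb fl (fl k) = L k" by (cases k) (simp_all add: sb_L sb_diff adm_fl)
  qed
  then show ?thesis by (simp add: sb_sb adm_fl sb_L_id)
qed

fun phiF :: "(word \<Rightarrow> real) \<Rightarrow> word \<Rightarrow> real" where
  "phiF f [] = f []"
| "phiF f (X # w) = phiF (\<lambda>v. f (X # v)) w + phiF (\<lambda>v. f (Y # v)) w"
| "phiF f (Y # w) = - phiF (\<lambda>v. f (Y # v)) w"

lemma cf_fl: "cf (sb fl f) w = phiF (cf f) w"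
proof (induction w arbitrary: f)
  case Nil
  show ?case by (subst sb_decomp[OF adm_fl]) simp
next
  case (Cons a w)
  have l: "(\<lambda>v. cf f (b # v)) = cf (lq b f)" for b by (simp add: fun_eq_iff)
  have "cf (sb fl f) (a # w) = cf (x * sb fl (lq X f) + (x - y) * sb fl (lq Y f)) (a # w)"
    by (subst sb_decomp[OF adm_fl]) simp
  then show ?case by (cases a) (simp_all add: left_diff_distrib Cons l)
qed

text \<open>The functional w -> F(\<phi>(w) x) on yH, set to 0 at the empty word. It is primitive
  exactly when F kills every \<phi>(w_1 * w_2) x.\<close>

definition lam :: "(word \<Rightarrow> real) \<Rightarrow> (nat, real) ser" where
  "lam F = Ser (\<lambda>ks. if ks = [] then 0 else phiF (\<lambda>u. F (u @ [X])) (W ks))"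

text \<open>The sign and the leading y come from \<phi>(y) = -y.\<close>

lemma lam_kap: "lam F = kap (- (y * sb fl (nu F)))"
proof (rule ser_eqI)
  fix ks show "cf (lam F) ks = cf (kap (- (y * sb fl (nu F)))) ks"
    by (cases ks) (simp_all add: lam_def cf_fl nu_def)
qed

definition prim :: "(nat, real) ser \<Rightarrow> bool" where
  "prim f \<longleftrightarrow> Del f = Cst f + Rr f"

lemma prim_lam: "prim (lam F) \<longleftrightarrow> (\<forall>us ws. us \<noteq> [] \<longrightarrow> ws \<noteq> [] \<longrightarrow> Qs (cf (lam F)) us ws = 0)"
proof -
  have "cf (cf (Cst (lam F) + Rr (lam F)) ws) us
      = (if us = [] then cf (lam F) ws else if ws = [] then cf (lam F) us else 0)" for us ws
    by (auto simp: cf_Cst lam_def cf_one)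
  then show ?thesis
    unfolding prim_def ser_eq_iff by (auto split: if_splits)
qed

subsection \<open>The twisted alphabet\<close>

definition xi :: "(letter, real) ser" where "xi = sb fl xt"

lemma cf_xi_Nil [simp]: "cf xi [] = 0"
  using sb_ordge[of 1 xt fl] by (simp add: xi_def ordge_1[unfolded One_nat_def])

lemma xi_eq: "xi * (1 - xi + y) = (1 - x + y) * x"
proof -
  have "sb fl (xt * (1 - yt)) = sb fl ((1 - y) * x)" by (simp only: twist_x)
  then show ?thesis
    by (simp add: sb_mult sb_diff sb_add sb_1 sb_L adm_fl yt_def xi_def[symmetric] algebra_simps)
qed

text \<open>Both families satisfy the divided power rule for the coproduct; for \<open>En\<close> this is the
  definition of the coproduct, for \<open>Th\<close> it is what makes the conjugated automorphism respect it.\<close>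
definition Th :: "nat \<Rightarrow> (nat, real) ser" where
  "Th k = (case k of 0 \<Rightarrow> 1 | Suc i \<Rightarrow> kap (y * xi ^ i))"

definition En :: "nat \<Rightarrow> (nat, real) ser" where
  "En k = (case k of 0 \<Rightarrow> 1 | Suc i \<Rightarrow> L i)"

lemma Th_simps [simp]: "Th 0 = 1" "Th (Suc i) = kap (y * xi ^ i)"
  and En_simps [simp]: "En 0 = 1" "En (Suc i) = L i"
  by (simp_all add: Th_def En_def)

lemma ordge_Th: "ordge k (Th k)"
  by (cases k) (simp_all add: kap_ordge ordge_ypower)

text \<open>\<open>Gx\<close> and \<open>Ps\<close> become, under \<open>kap\<close>, the generating
  series in s of \<open>Th\<close> and \<open>En\<close>.\<close>

definition Gx :: "real \<Rightarrow> (letter, real) ser" where "Gx s = 1 + s *\<^sub>R (y * star (s *\<^sub>R xi))"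
definition Ps :: "real \<Rightarrow> (letter, real) ser" where "Ps s = 1 + s *\<^sub>R (y * star (s *\<^sub>R x))"

lemma ysup_GP [simp]: "ysup (Gx s)" "ysup (Ps s)"
  by (simp_all add: Gx_def Ps_def)

lemma cf_kap_Gx: "wt us \<le> N \<Longrightarrow> cf (kap (Gx s)) us = (\<Sum>k\<le>N. s ^ k * cf (Th k) us)"
proof -
  assume N: "wt us \<le> N"
  have "cf (kap (Gx s)) us = cf 1 us + (\<Sum>k\<le>N. s ^ Suc k * cf (kap (y * xi ^ k)) us)"
    unfolding Gx_def by (rule kap_geom) (simp_all add: N)
  also have "\<dots> = (\<Sum>k\<le>Suc N. s ^ k * cf (Th k) us)"
    by (subst sum.atMost_Suc_shift) (simp del: sum.atMost_Suc)
  also have "\<dots> = (\<Sum>k\<le>N. s ^ k * cf (Th k) us)"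
    using ordge_Th[of "Suc N"] N by (simp add: ordge_def)
  finally show ?thesis .
qed

lemma inverse_commute:
  fixes a b p q :: "'r::monoid_mult"
  assumes "a * p = 1" "p * a = 1" "b * q = 1" "q * b = 1" "a * b = b * a"
  shows "p * q = q * p"
proof -
  have "(q * p) * (a * b) = 1" by (metis assms(2,4) mult.assoc mult_1_left)
  moreover have "(a * b) * (p * q) = 1" unfolding assms(5) by (metis assms(1,3) mult.assoc mult_1_left)
  ultimately show ?thesis by (metis mult.assoc mult_1_left mult_1_right)
qed

text \<open>Pairs \<open>(s, s')\<close> with \<open>1/s + 1/s' = 1\<close> satisfy the hypothesis.  As \<open>Ps\<close> is group-like,
  comparing coefficients along this curve forces \<open>Gx\<close> to be group-like too.\<close>
lemma curve:
  assumes "s * s' = s + s'"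
  shows "Gx s * Ps s' = Gx s' * Ps s"
proof -
  define A where "A = (\<lambda>s. star (s *\<^sub>R xi))"
  define B where "B = (\<lambda>s. star (s *\<^sub>R x))"
  have A: "(1 - s *\<^sub>R xi) * A s = 1" "A s * (1 - s *\<^sub>R xi) = 1" for s
    by (simp_all add: A_def star_inverse)
  have B: "(1 - s *\<^sub>R x) * B s = 1" "B s * (1 - s *\<^sub>R x) = 1" for s
    by (simp_all add: B_def star_inverse)
  define z where "z = xi - y"
  have G: "Gx s = (1 - s *\<^sub>R z) * A s" for s
  proof -
    have "(1 - s *\<^sub>R z) * A s = (1 - s *\<^sub>R xi) * A s + s *\<^sub>R (y * A s)" by (simp add: z_def algebra_simps)
    then show ?thesis unfolding A(1) by (simp add: Gx_def A_def)
  qed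
  have P: "Ps s = (1 - s *\<^sub>R (x - y)) * B s" for s
  proof -
    have "(1 - s *\<^sub>R (x - y)) * B s = (1 - s *\<^sub>R x) * B s + s *\<^sub>R (y * B s)" by (simp add: algebra_simps)
    then show ?thesis unfolding B(1) by (simp add: Ps_def B_def)
  qed
  \<comment> \<open>This exchange of x-series and \<open>xi\<close>-series is the only place where
    the curve enters: the s s' term and the s + s' term cancel by the equation for
    \<open>xi\<close>.\<close>
  have key: "A s * (1 - s' *\<^sub>R (x - y)) = (1 - s' *\<^sub>R z) * B s" if ss: "s * s' = s + s'" for s s'
  proof -
    have e: "(x - y) * x - xi * z = x - xi" using xi_eq by (simp add: z_def algebra_simps)
    have "(1 - s' *\<^sub>R (x - y)) * (1 - s *\<^sub>R x) - (1 - s *\<^sub>R xi) * (1 - s' *\<^sub>R z)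
      = (s * s') *\<^sub>R ((x - y) * x - xi * z) - (s + s') *\<^sub>R (x - xi)"
      by (simp add: z_def algebra_simps)
    also have "\<dots> = 0" unfolding e ss by simp
    finally have "(1 - s' *\<^sub>R (x - y)) * (1 - s *\<^sub>R x) = (1 - s *\<^sub>R xi) * (1 - s' *\<^sub>R z)" by simp
    then have "A s * ((1 - s' *\<^sub>R (x - y)) * (1 - s *\<^sub>R x)) * B s = A s * ((1 - s *\<^sub>R xi) * (1 - s' *\<^sub>R z)) * B s" by simp
    then have "A s * (1 - s' *\<^sub>R (x - y)) * ((1 - s *\<^sub>R x) * B s) = (A s * (1 - s *\<^sub>R xi)) * (1 - s' *\<^sub>R z) * B s"
      by (simp only: mult.assoc)
    then show ?thesis by (simp only: A B mult_1_left mult_1_right)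
  qed
  have prod: "Gx s * Ps s' = ((1 - s *\<^sub>R z) * (1 - s' *\<^sub>R z)) * (B s * B s')" if ss: "s * s' = s + s'" for s s'
  proof -
    have "Gx s * Ps s' = (1 - s *\<^sub>R z) * (A s * (1 - s' *\<^sub>R (x - y))) * B s'" by (simp only: G P mult.assoc)
    then show ?thesis by (simp only: key[OF ss] mult.assoc)
  qed
  have "(1 - s *\<^sub>R z) * (1 - s' *\<^sub>R z) = (1 - s' *\<^sub>R z) * (1 - s *\<^sub>R z)" by (simp add: algebra_simps)
  moreover have "B s * B s' = B s' * B s"
    by (rule inverse_commute[OF B B]) (simp add: algebra_simps)
  moreover have "s' * s = s' + s" using assms by (simp add: mult.commute add.commute)
  ultimately show ?thesis by (simp add: prod assms)
qed

text \<open>Clearing denominators in p(s) = p(s/(s - 1)) shows that p(s)(s - 1)^N has degree at most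
  N; hence p is constant, and its constant coefficient is zero.\<close>

lemma moebius_poly_zero:
  fixes c :: "nat \<Rightarrow> real"
  assumes "\<And>s. s \<noteq> 0 \<Longrightarrow> s \<noteq> 1 \<Longrightarrow> (\<Sum>k\<le>N. s ^ k * c k) = (\<Sum>k\<le>N. (s / (s - 1)) ^ k * c k)"
    and "c 0 = 0" "k \<le> N"
  shows "c k = 0"
proof -
  define p where "p = (\<Sum>k\<le>N. monom (c k) k)"
  define q where "q = (\<Sum>k\<le>N. Polynomial.smult (c k) ([:0, 1:] ^ k * [:-1, 1:] ^ (N - k)))"
  have pc: "coeff p k = (if k \<le> N then c k else 0)" for k
    unfolding p_def coeff_sum by (simp add: sum.delta')
  have ev: "poly (p * [:-1, 1:] ^ N - q) s = 0" if s: "s \<noteq> 0" "s \<noteq> 1" for s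
  proof -
    have "(s - 1) ^ N * (s / (s - 1)) ^ k = s ^ k * (s - 1) ^ (N - k)" if "k \<le> N" for k
    proof -
      have "(s - 1) ^ N = (s - 1) ^ k * (s - 1) ^ (N - k)" using that by (simp add: power_add[symmetric])
      then show ?thesis using s by (simp add: power_divide)
    qed
    then have "(\<Sum>k\<le>N. (s / (s - 1)) ^ k * c k) * (s - 1) ^ N = (\<Sum>k\<le>N. c k * (s ^ k * (s - 1) ^ (N - k)))"
      unfolding sum_distrib_right by (intro sum.cong refl) (simp add: algebra_simps)
    moreover have "poly p s = (\<Sum>k\<le>N. s ^ k * c k)"
      unfolding p_def poly_sum by (simp add: poly_monom mult.commute)
    ultimately show ?thesis using assms(1)[OF s]
      by (simp add: q_def poly_sum poly_power)
  qed
  have "p * [:-1, 1:] ^ N - q = 0"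
  proof (rule ccontr)
    assume "p * [:-1, 1:] ^ N - q \<noteq> 0"
    then have "finite {s. poly (p * [:-1, 1:] ^ N - q) s = 0}" by (rule poly_roots_finite)
    then have "finite (UNIV - {0, 1 :: real})" by (rule finite_subset[rotated]) (use ev in auto)
    then show False using infinite_UNIV_char_0[where 'a = real] by simp
  qed
  then have eq: "p * [:-1, 1:] ^ N = q" by simp
  have dq: "degree q \<le> N"
    unfolding q_def
  proof (rule degree_sum_le)
    fix k assume "k \<in> {..N}"
    have "degree (Polynomial.smult (c k) ([:0, 1:] ^ k * [:-1, 1:] ^ (N - k))) \<le> degree ([:0, 1 :: real:] ^ k) + degree ([:-1, 1 :: real:] ^ (N - k))"
      by (meson degree_mult_le degree_smult_le order_trans)
    also have "\<dots> \<le> N" using \<open>k \<in> {..N}\<close> by (simp add: degree_power_eq)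
    finally show "degree (Polynomial.smult (c k) ([:0, 1:] ^ k * [:-1, 1:] ^ (N - k))) \<le> N" .
  qed simp
  have "degree p = 0"
  proof (cases "p = 0")
    case False
    then have "degree (p * [:-1, 1:] ^ N) = degree p + N" by (simp add: degree_mult_eq degree_power_eq)
    then show ?thesis using dq eq by simp
  qed simp
  then have "k > 0 \<Longrightarrow> coeff p k = 0" by (simp add: coeff_eq_0)
  then show ?thesis using assms(2,3) pc[of k] by (cases k) auto
qed

definition DT :: "(nat \<Rightarrow> (nat, real) ser) \<Rightarrow> nat \<Rightarrow> (nat, (nat, real) ser) ser" where
  "DT C k = (\<Sum>i\<le>k. Cst (C i) * Rr (C (k - i)))"

lemma cf_DT: "cf (DT C k) ws = (\<Sum>i\<le>k. cf (C (k - i)) ws *\<^sub>R C i)"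
  by (simp add: DT_def cf_sum cf_Cst_mult)

lemma Del_En: "Del (En k) = DT En k"
proof (cases k)
  case 0
  then show ?thesis by (simp add: Del_1 DT_def)
next
  case (Suc n)
  have "cf (DD L n) ws = cf (DT En (Suc n)) ws" for ws
  proof -
    have e: "cf (En j) ws = (if ws = [] then (if j = 0 then 1 else 0) else if tl ws = [] \<and> j = Suc (hd ws) then 1 else 0)" for j
      by (cases j; cases ws) (auto simp: cf_one cf_L)
    have "cf (DT En (Suc n)) ws = (\<Sum>i\<le>Suc n. if ws = [] then (if i = Suc n then En i else 0)
        else if tl ws = [] \<and> Suc n - i = Suc (hd ws) then En i else 0)"
      unfolding cf_DT e by (intro sum.cong refl) auto
    also have "\<dots> = cf (DD L n) ws"
    proof (cases "ws = []")
      case True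
      then show ?thesis by (simp add: DD_def)
    next
      case False
      show ?thesis
      proof (cases "tl ws = [] \<and> hd ws \<le> n")
        case True
        have "(\<Sum>i\<le>Suc n. if ws = [] then (if i = Suc n then En i else 0)
          else if tl ws = [] \<and> Suc n - i = Suc (hd ws) then En i else 0)
          = (\<Sum>i\<le>Suc n. if i = n - hd ws then En i else 0)"
          using True False by (intro sum.cong refl) auto
        also have "\<dots> = En (n - hd ws)" by (simp add: sum.delta)
        also have "\<dots> = cf (DD L n) ws"
        proof (cases "n = hd ws")
          case True then show ?thesis using \<open>ws \<noteq> []\<close> \<open>tl ws = [] \<and> hd ws \<le> n\<close> by (simp add: DD_def)
        next
          case False
          then have "n - hd ws = Suc (n - 1 - hd ws)" using \<open>tl ws = [] \<and> hd ws \<le> n\<close> by linarith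
          then show ?thesis using False \<open>ws \<noteq> []\<close> \<open>tl ws = [] \<and> hd ws \<le> n\<close> by (simp add: DD_def)
        qed
        finally show ?thesis .
      next
        case False
        have "(\<Sum>i\<le>Suc n. if ws = [] then (if i = Suc n then En i else 0)
          else if tl ws = [] \<and> Suc n - i = Suc (hd ws) then En i else 0) = 0"
          using False \<open>ws \<noteq> []\<close> by (intro sum.neutral) auto
        then show ?thesis using False \<open>ws \<noteq> []\<close> by (auto simp: DD_def)
      qed
    qed
    finally show ?thesis ..
  qed
  then show ?thesis unfolding Suc by (simp add: Del_L ser_eq_iff)
qed

lemma Del_sum_coeff: "Qs (\<lambda>r. \<Sum>k\<in>A. c k * f k r) us ws = (\<Sum>k\<in>A. c k * Qs (f k) us ws)"
  by (induction A rule: infinite_finite_induct) (simp_all add: Qs_add Qs_mult, simp_all add: Qs_def)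

text \<open>Let \<open>Ga s\<close> measure the failure of \<open>Gx s\<close> to be group-like. By
  \<open>curve\<close> and \<open>low_mult\<close> its lowest coefficients agree at s and s' = s/(s
  - 1); they are polynomials in s with coefficients from \<open>ga\<close>, so
  \<open>moebius_poly_zero\<close> applies.\<close>

lemma Del_Th: "Del (Th k) = DT Th k"
proof -
  define ga where "ga = (\<lambda>k. Del (Th k) - DT Th k)"
  define Ga where "Ga = (\<lambda>s. Del (kap (Gx s)) - Cst (kap (Gx s)) * Rr (kap (Gx s)))"
  have expand: "cf (cf (Ga s) ws) us = (\<Sum>k\<le>N. s ^ k * cf (cf (ga k) ws) us)"
    if N: "wt ws + wt us = N" for s ws us N
  proof -
    have 1: "cf (cf (Del (kap (Gx s))) ws) us = (\<Sum>k\<le>N. s ^ k * cf (cf (Del (Th k)) ws) us)"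
    proof -
      have "Qs (cf (kap (Gx s))) us ws = Qs (\<lambda>r. \<Sum>k\<le>N. s ^ k * cf (Th k) r) us ws"
        by (rule Qs_cong, rule cf_kap_Gx) (use N wt_qsh in fastforce)
      then show ?thesis by (simp add: Del_sum_coeff)
    qed
    have "cf (cf (Cst (kap (Gx s)) * Rr (kap (Gx s))) ws) us = cf (kap (Gx s)) us * cf (kap (Gx s)) ws"
      by (simp add: cf_Cst_mult mult.commute del: cf_kap)
    also have "\<dots> = (\<Sum>i\<le>N. s ^ i * cf (Th i) us) * (\<Sum>j\<le>N. s ^ j * cf (Th j) ws)"
      by (subst (1 2) cf_kap_Gx[where N = N]) (use N in auto)
    also have "\<dots> = (\<Sum>(i, j)\<in>{..N} \<times> {..N}. s ^ (i + j) * (cf (Th i) us * cf (Th j) ws))"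
      by (simp add: sum_product sum.cartesian_product power_add algebra_simps)
    also have "\<dots> = (\<Sum>(i, j)\<in>{(i, j). i + j \<le> N}. s ^ (i + j) * (cf (Th i) us * cf (Th j) ws))"
    proof (rule sum.mono_neutral_right)
      show "\<forall>p\<in>{..N} \<times> {..N} - {(i, j). i + j \<le> N}. (case p of (i, j) \<Rightarrow> s ^ (i + j) * (cf (Th i) us * cf (Th j) ws)) = 0"
      proof
        fix p assume p: "p \<in> {..N} \<times> {..N} - {(i, j). i + j \<le> N}"
        obtain i j where ij: "p = (i, j)" by force
        then have "wt us < i \<or> wt ws < j" using N p by auto
        then show "(case p of (i, j) \<Rightarrow> s ^ (i + j) * (cf (Th i) us * cf (Th j) ws)) = 0"
          using ordge_Th[of i] ordge_Th[of j] by (auto simp: ordge_def ij)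
      qed
    qed auto
    also have "\<dots> = (\<Sum>k\<le>N. \<Sum>i\<le>k. s ^ (i + (k - i)) * (cf (Th i) us * cf (Th (k - i)) ws))"
      by (rule sum.triangle_reindex_eq)
    also have "\<dots> = (\<Sum>k\<le>N. s ^ k * cf (cf (DT Th k) ws) us)"
      by (intro sum.cong refl) (simp add: cf_DT cf_sum sum_distrib_left mult.commute)
    finally show ?thesis unfolding Ga_def ga_def 1 cf_simps
      by (simp add: 1 sum_subtractf right_diff_distrib)
  qed
  have cv: "Ga s * Del (gs s') = Ga s' * Del (gs s)" if ss: "s * s' = s + s'" for s s'
  proof -
    have k: "kap (Gx s) * gs s' = kap (Gx s') * gs s"
      using curve[OF ss] unfolding kap_gs[symmetric] Ps_def[symmetric] by (simp add: kap_mult[symmetric])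
    have "Cst (kap (Gx s)) * Rr (kap (Gx s)) * Del (gs s') = Cst (kap (Gx s) * gs s') * Rr (kap (Gx s) * gs s')" for s s'
    proof -
      have "Cst a * Rr a * (Cst b * Rr b) = Cst a * (Rr a * Cst b) * Rr b" for a b :: "(nat, real) ser"
        by (simp only: mult.assoc)
      then show ?thesis unfolding Del_gs by (simp add: Rr_Cst Cst_mult Rr_mult mult.assoc)
    qed
    then show ?thesis unfolding Ga_def left_diff_distrib Del_mult[symmetric] k by (simp add: k)
  qed
  have "cf (cf (ga k) ws) us = 0" for k ws us
  proof (induction "wt ws + wt us" arbitrary: k ws us rule: less_induct)
    case less
    define N where "N = wt ws + wt us"
    have Ga0: "cf (cf (Ga s) ws') us' = 0" if "wt ws' + wt us' < wt ws + wt us" for s ws' us'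
      using expand[OF refl] less that by simp
    have "cf (cf (Ga s) ws) us = cf (cf (Ga s') ws) us" if ss: "s * s' = s + s'" for s s'
    proof -
      have "cf (cf (Ga s) ws) us = cf (cf (Ga s * Del (gs s')) ws) us"
        by (subst low_mult) (use Ga0 in auto)
      also have "\<dots> = cf (cf (Ga s' * Del (gs s)) ws) us" by (simp only: cv[OF ss])
      also have "\<dots> = cf (cf (Ga s') ws) us" by (subst low_mult) (use Ga0 in auto)
      finally show ?thesis .
    qed
    then have E: "(\<Sum>k\<le>N. s ^ k * cf (cf (ga k) ws) us) = (\<Sum>k\<le>N. s' ^ k * cf (cf (ga k) ws) us)"
      if "s * s' = s + s'" for s s'
      using that by (simp add: expand[OF N_def[symmetric], symmetric])
    show ?case
    proof (cases "k \<le> N")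
      case True
      show ?thesis
      proof (rule moebius_poly_zero[where N = N and c = "\<lambda>k. cf (cf (ga k) ws) us"])
        show "cf (cf (ga 0) ws) us = 0" by (simp add: ga_def Del_1 DT_def)
        show "(\<Sum>k\<le>N. s ^ k * cf (cf (ga k) ws) us) = (\<Sum>k\<le>N. (s / (s - 1)) ^ k * cf (cf (ga k) ws) us)"
          if "s \<noteq> 0" "s \<noteq> 1" for s
          by (rule E) (use that in \<open>simp add: field_simps\<close>)
      qed (rule True)
    next
      case False
      have "Qs (cf (Th k)) us ws = 0" by (rule Qs_ordge[OF ordge_Th]) (use False N_def in simp)
      moreover have "cf (cf (DT Th k) ws) us = 0"
        unfolding cf_DT cf_sum
      proof (rule sum.neutral, rule ballI)
        fix i assume "i \<in> {..k}"
        then have "wt ws < k - i \<or> wt us < i" using False N_def by auto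
        then show "cf (cf (Th (k - i)) ws *\<^sub>R Th i) us = 0"
          using ordge_Th[of i] ordge_Th[of "k - i"] by (auto simp: ordge_def)
      qed
      ultimately show ?thesis by (simp add: ga_def)
    qed
  qed
  then have "ga k = 0" by (intro ser_eqI) simp
  then show ?thesis by (simp add: ga_def)
qed

section \<open>The coalgebra map determined by the series \<open>Th\<close>\<close>

definition th :: "nat \<Rightarrow> (nat, real) ser" where "th k = kap (y * xi ^ k)"

lemma adm_th: "adm th"
  by (simp add: adm_def th_def kap_ordge ordge_ypower)

definition TH :: "(nat, real) ser \<Rightarrow> (nat, real) ser" where "TH = sb th"

lemma TH_lin: "linear TH" and TH_mult: "TH (f * g) = TH f * TH g" and TH_1: "TH 1 = 1"
  and TH_L: "TH (L k) = th k"
  by (simp_all add: TH_def sb_linear sb_mult sb_1 sb_L adm_th)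

lemmas TH_simps = linear_add[OF TH_lin] linear_diff[OF TH_lin] linear_scale[OF TH_lin] linear_0[OF TH_lin] TH_mult TH_1

lemma pw_Rr: "pw (\<lambda>k. Rr (h k)) v = Rr (pw h v)"
  by (induction v) (simp_all add: Rr_mult)

lemma adm_Rr: "adm h \<Longrightarrow> adm (\<lambda>k. Rr (h k))"
  by (simp add: adm_def ordge_def)

text \<open>The map \<open>TH\<close> \<otimes> \<open>TH\<close> on the completed tensor
  product.\<close>

definition TT :: "(nat, (nat, real) ser) ser \<Rightarrow> (nat, (nat, real) ser) ser" where
  "TT G = subst (\<lambda>k. Rr (th k)) (mapser TH G)"

lemma cf_TT: "cf (TT G) ws = (\<Sum>v | wt v \<le> wt ws. cf (pw th v) ws *\<^sub>R TH (cf G v))"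
  by (simp add: TT_def subst_def pw_Rr)

lemma TT_mult: "TT (F * G) = TT F * TT G"
proof -
  have m: "mapser TH (F * G) = mapser TH F * mapser TH G"
    by (rule mapser_mult) (simp_all add: TH_simps)
  show ?thesis unfolding TT_def m
    by (rule subst_mult) (simp_all add: adm_Rr adm_th pw_Rr)
qed

lemma TT_add: "TT (F + G) = TT F + TT G"
  by (rule ser_eqI) (simp add: cf_TT TH_simps sum.distrib scaleR_add_right)

lemma TT_scale: "TT (c *\<^sub>R F) = c *\<^sub>R TT F"
  by (rule ser_eqI) (simp add: cf_TT TH_simps scaleR_sum_right mult.commute)

lemma TT_0: "TT 0 = 0"
  by (rule ser_eqI) (simp add: cf_TT TH_simps)

lemma TT_sum: "TT (sum f A) = (\<Sum>a\<in>A. TT (f a))"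
  by (induction A rule: infinite_finite_induct) (simp_all add: TT_add TT_0)

lemma TT_Cst: "TT (Cst a) = Cst (TH a)"
proof (rule ser_eqI)
  fix ws :: "nat list"
  have "cf (TT (Cst a)) ws = (\<Sum>v :: nat list | wt v \<le> wt ws. if v = [] then cf (1 :: (nat, real) ser) ws *\<^sub>R TH a else 0)"
    unfolding cf_TT by (intro sum.cong refl) (auto simp: cf_Cst TH_simps)
  also have "\<dots> = cf (Cst (TH a)) ws" by (simp add: sum.delta cf_Cst cf_one)
  finally show "cf (TT (Cst a)) ws = cf (Cst (TH a)) ws" .
qed

lemma TT_Rr: "TT (Rr b) = Rr (TH b)"
proof (rule ser_eqI)
  fix ws :: "nat list"
  have "cf (TT (Rr b)) ws = (\<Sum>v | wt v \<le> wt ws. (cf b v * cf (pw th v) ws) *\<^sub>R 1)"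
    unfolding cf_TT by (intro sum.cong refl) (simp add: TH_simps mult.commute)
  also have "\<dots> = cf (Rr (TH b)) ws"
    by (simp add: TH_def cf_sb[OF adm_th order_refl] scaleR_sum_left)
  finally show "cf (TT (Rr b)) ws = cf (Rr (TH b)) ws" .
qed

text \<open>Both sides are continuous algebra maps, so letters suffice. There \<open>En\<close> goes
  to \<open>Th\<close>, and both families obey the same divided power rule.\<close>

lemma Del_TH: "Del (TH f) = TT (Del f)"
proof (rule ser_eqI, rule ser_eqI)
  fix ws us :: "nat list"
  let ?n = "Suc (wt us + wt ws)"
  let ?H1 = "\<lambda>f. cf (cf (Del (TH f)) ws) us" and ?H2 = "\<lambda>f. cf (cf (TT (Del f)) ws) us"
  note D = linear_add[OF Del_linear] linear_scale[OF Del_linear]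
  show "?H1 f = ?H2 f"
  proof (rule linear_eq_by_mons[of ?H1 ?H2 ?n])
    show "linear ?H1" "linear ?H2" by (rule linearI; simp add: TH_simps D TT_add TT_scale del: cf_Del)+
    fix g :: "(nat, real) ser" assume g: "ordge ?n g"
    then have "ordge ?n (TH g)" by (simp add: TH_def sb_ordge)
    then show "?H1 g = 0" by (simp add: Qs_ordge)
    show "?H2 g = 0"
      unfolding cf_TT cf_sum
    proof (rule sum.neutral, rule ballI)
      fix v :: "nat list" assume v: "v \<in> {v. wt v \<le> wt ws}"
      have "ordge (Suc (wt us)) (cf (Del g) v)"
        unfolding ordge_def cf_Del using Qs_ordge[OF g] v by auto
      then have "ordge (Suc (wt us)) (TH (cf (Del g) v))" by (simp add: TH_def sb_ordge)
      then show "cf (cf (pw th v) ws *\<^sub>R TH (cf (Del g) v)) us = 0" by (simp add: ordge_def)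
    qed
  next
    fix v
    have "Del (TH (mon v)) = TT (Del (mon v))"
    proof (induction v)
      case Nil
      then show ?case using TT_Cst[of 1] by (simp add: TH_simps Del_1)
    next
      case (Cons k v)
      have E: "TH (En i) = Th i" for i by (cases i) (simp_all add: TH_simps TH_L th_def)
      have "TT (Del (L k)) = TT (DT En (Suc k))" using Del_En[of "Suc k"] by simp
      also have "\<dots> = DT Th (Suc k)"
        by (simp add: DT_def TT_sum TT_mult TT_Cst TT_Rr E del: sum.atMost_Suc Th_simps En_simps)
      also have "\<dots> = Del (TH (L k))" using Del_Th[of "Suc k"] by (simp add: TH_L th_def)
      finally show ?case by (simp add: TH_mult Del_mult TT_mult Cons)
    qed
    then show "?H1 (mon v) = ?H2 (mon v)" by simp
  qed
qed

lemma prim_TH: "prim f \<Longrightarrow> prim (TH f)"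
  unfolding prim_def Del_TH by (simp add: TT_add TT_Cst TT_Rr)

subsection \<open>The one-step operator on primitive functionals\<close>

text \<open>The twist equations replace the outer \<open>yt\<close> and \<open>xt\<close> by y and
  x, and these commute past \<open>vy\<close> and \<open>ux\<close> to the two ends.\<close>

lemma nu_onestep: "nu (cf (onestep F)) = F [] *\<^sub>R (vy * ux) + vy * (1 - x) * sb tw (nu F) * (1 - y) * ux"
    (is "_ = ?nu")
proof -
  have vy: "vy * y = y * vy" and ux: "x * ux = ux * x"
  proof -
    have "vy * y = vy - 1" "y * vy = vy - 1" "x * ux = ux - 1" "ux * x = ux - 1"
      using vy_inv ux_inv by (simp_all add: algebra_simps)
    then show "vy * y = y * vy" "x * ux = ux * x" by simp_all
  qed
  have "vy * (1 - xt) * sb tw (y * nu F * x) * (1 - yt) * ux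
      = vy * ((1 - xt) * yt) * sb tw (nu F) * (xt * (1 - yt)) * ux"
    by (simp only: sb_mult[OF adm_tw] sb_L[OF adm_tw] tw_simps mult.assoc)
  also have "\<dots> = (vy * y) * (1 - x) * sb tw (nu F) * (1 - y) * (x * ux)"
    unfolding twist_x twist_y by (simp only: mult.assoc)
  also have "\<dots> = y * (vy * (1 - x) * sb tw (nu F) * (1 - y) * ux) * x"
    unfolding vy ux by (simp only: mult.assoc)
  finally have e: "vy * (1 - xt) * sb tw (y * nu F * x) * (1 - yt) * ux
      = y * (vy * (1 - x) * sb tw (nu F) * (1 - y) * ux) * x" .
  have "vy * y * x * ux = (vy * y) * (x * ux)" by (simp only: mult.assoc)
  also have "\<dots> = y * (vy * ux) * x" unfolding vy ux by (simp only: mult.assoc)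
  finally have e2: "vy * y * x * ux = y * (vy * ux) * x" .
  have "onestep F = F [] *\<^sub>R 1 + y * ?nu * x"
    unfolding onestep_def e e2 by (simp add: algebra_simps)
  then show ?thesis
    by (intro ser_eqI) (simp only: nu_def cf_Ser cf_simps cf_scaleR cf_y_mult_x, simp add: cf_one)
qed

definition gi :: "(letter, real) ser" where "gi = star (- (y * ux))"

lemma gi_inv: "gi * gy = 1" "gy * gi = 1"
  using star_inverse[of "- (y * ux)"] by (simp_all add: gi_def gy_def)

lemma ysup_gi [simp]: "ysup gi"
  by (simp add: gi_def ysup_star)

text \<open>The derivative of \<open>gs s\<close> at s = 1, that is, the sum of k e_k.\<close>

definition del1 :: "(nat, real) ser" where "del1 = kap (y * ux * ux)"

definition kgi where "kgi = kap gi"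

text \<open>Conjugated by \<open>fl\<close>, the boundary factors become \<open>gi\<close> and its
  inverse \<open>gy\<close>; the constant term of F adds a multiple of a logarithmic
  derivative.\<close>

lemma lam_onestep: "lam (cf (onestep F)) = kgi * TH (lam F) * kg - F [] *\<^sub>R (kgi * del1)"
proof -
  define n where "n = sb fl (nu F)"
  define vt where "vt = sb fl vy"
  \<comment> \<open>The automorphism conjugated by \<open>fl\<close>; it fixes y because
    \<open>xt - yt = x - y\<close>.\<close>
  define th2 where "th2 = (\<lambda>a. case a of X \<Rightarrow> xi | Y \<Rightarrow> y)"
  have th2s: "th2 X = xi" "th2 Y = y" by (simp_all add: th2_def)
  have adm2: "adm th2" by (simp add: adm_letter th2s)
  have "sb fl (vy * (1 - y)) = 1" "sb fl ((1 - y) * vy) = 1" unfolding vy_inv by (simp_all add: sb_1 adm_fl)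
  then have vt: "vt * (1 - x + y) = 1" "(1 - x + y) * vt = 1"
    by (simp_all add: sb_mult sb_diff sb_1 sb_L adm_fl vt_def algebra_simps)
  have ux: "sb fl ux = ux"
  proof -
    have "sb fl ((1 - x) * ux) = 1" unfolding ux_inv by (simp add: sb_1 adm_fl)
    then have "(1 - x) * sb fl ux = 1" by (simp add: sb_mult sb_diff sb_1 sb_L adm_fl)
    then have "ux * ((1 - x) * sb fl ux) = ux" by simp
    then show ?thesis by (simp add: mult.assoc[symmetric] ux_inv)
  qed
  have tw: "sb fl (sb tw (nu F)) = sb th2 n"
  proof -
    have "sb fl (sb tw (nu F)) = sb (\<lambda>k. sb fl (tw k)) (sb fl n)"
      by (simp add: sb_sb adm_tw adm_fl n_def fl_fl)
    also have "\<dots> = sb (\<lambda>k. sb (\<lambda>k. sb fl (tw k)) (fl k)) n"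
      by (rule sb_sb) (simp_all add: adm_fl adm_sb adm_tw)
    also have "(\<lambda>k. sb (\<lambda>k. sb fl (tw k)) (fl k)) = th2"
    proof
      fix k
      have a: "adm (\<lambda>k. sb fl (tw k))" by (simp add: adm_sb adm_tw)
      have "sb fl (xt - yt) = y" by (simp add: yt_def sb_diff sb_L adm_fl)
      then show "sb (\<lambda>k. sb fl (tw k)) (fl k) = th2 k"
        by (cases k) (simp_all add: sb_L[OF a] sb_diff th2_def xi_def)
    qed
    finally show ?thesis .
  qed
  have fnu: "sb fl (nu (cf (onestep F))) = F [] *\<^sub>R (vt * ux) + vt * (1 - x) * sb th2 n * (1 - x + y) * ux"
    unfolding nu_onestep
    by (simp add: sb_add sb_scale sb_mult sb_diff sb_1 sb_L adm_fl vt_def ux tw algebra_simps)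
  have gy: "gy = (1 - x + y) * ux" using ux_inv by (simp add: gy_def algebra_simps)
  have "gy * (y * vt * (1 - x)) = (y + y * ux * y) * vt * (1 - x)" by (simp add: gy_def algebra_simps)
  also have "y + y * ux * y = y * ux * (1 - x + y)"
    using ux_inv(2) by (simp add: algebra_simps) (metis (no_types, opaque_lifting) add.commute distrib_left mult_1_right)
  also have "\<dots> * vt * (1 - x) = y * (ux * ((1 - x + y) * vt) * (1 - x))" by (simp only: mult.assoc)
  also have "\<dots> = y" by (simp add: vt ux_inv)
  finally have "gi * (gy * (y * vt * (1 - x))) = gi * y" by simp
  then have yv: "y * vt * (1 - x) = gi * y" by (simp add: mult.assoc[symmetric] gi_inv)
  have "y * vt = (y * vt * (1 - x)) * ux" by (simp add: mult.assoc ux_inv)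
  then have yv2: "y * vt = gi * y * ux" unfolding yv .
  have "y * sb fl (nu (cf (onestep F))) = F [] *\<^sub>R ((y * vt) * ux) + (y * vt * (1 - x)) * sb th2 n * ((1 - x + y) * ux)"
    unfolding fnu by (subst distrib_left) (simp only: mult_scaleR_right mult.assoc)
  also have "\<dots> = F [] *\<^sub>R (gi * (y * ux * ux)) + gi * (y * sb th2 n) * gy"
    unfolding yv unfolding yv2 gy[symmetric] by (simp only: mult.assoc)
  finally have e: "- (y * sb fl (nu (cf (onestep F)))) = gi * sb th2 (- (y * n)) * gy - F [] *\<^sub>R (gi * (y * ux * ux))"
    by (simp add: sb_neg sb_mult sb_L adm2 th2s)
  have t: "kap (sb th2 h) = TH (kap h)" and ys: "ysup (sb th2 h)" if "ysup h" for h
  proof -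
    have "(\<lambda>k. sb th2 (ey k)) = (\<lambda>k. y * xi ^ k)"
    proof
      fix k
      have "sb th2 (x ^ k) = xi ^ k" by (induction k) (simp_all add: sb_1 sb_mult sb_L adm2 th2s)
      then show "sb th2 (ey k) = y * xi ^ k" by (simp add: ey_def sb_mult sb_L adm2 th2s)
    qed
    then have s: "sb th2 h = sb (\<lambda>k. y * xi ^ k) (kap h)"
      using sb_sb[OF adm_ey adm2, of "kap h"] sb_ey_kap[OF that] by simp
    have a: "adm (\<lambda>k. y * xi ^ k)" by (simp add: adm_def ordge_ypower)
    show "kap (sb th2 h) = TH (kap h)" unfolding s TH_def by (subst kap_sb[OF a]) (simp_all add: th_def[abs_def])
    show "ysup (sb th2 h)" unfolding s by (rule ysup_sb[OF a]) simp
  qed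
  have "lam (cf (onestep F)) = kap (gi * sb th2 (- (y * n)) * gy - F [] *\<^sub>R (gi * (y * ux * ux)))"
    unfolding lam_kap e by (rule refl)
  also have "\<dots> = kgi * TH (kap (- (y * n))) * kg - F [] *\<^sub>R (kgi * del1)"
    by (simp add: kap_mult t ys ysup_mult kgi_def kg_def del1_def mult.assoc)
  finally show ?thesis by (simp add: lam_kap n_def)
qed

lemma cf_del1: "cf del1 [] = 0" "cf del1 (k # v) = real (Suc k) * cf 1 v"
proof -
  have u: "ux = 1 + x * ux" using ux_inv by (simp add: algebra_simps)
  have h: "W v = [] \<or> hd (W v) = Y" by (cases v) auto
  have u0: "cf ux (X # w) = cf ux w" "cf ux (Y # w) = 0" "cf ux [] = 1" for w
    using arg_cong[OF u, of "\<lambda>f. cf f (X # w)"] arg_cong[OF u, of "\<lambda>f. cf f (Y # w)"] arg_cong[OF u, of "\<lambda>f. cf f []"]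
    by simp_all
  have "cf ux (W v) = cf 1 v" using h u0 by (cases v) (auto simp: cf_one)
  then have u1: "cf ux (replicate n X @ W v) = cf 1 v" for n by (induction n) (simp_all add: u0)
  have "ux * ux = ux + x * (ux * ux)" by (subst (1) u) (simp add: algebra_simps)
  from arg_cong[OF this, of "\<lambda>f. cf f (X # w)" for w] arg_cong[OF this, of "\<lambda>f. cf f (Y # w)" for w]
  have uu: "cf (ux * ux) (X # w) = cf ux w + cf (ux * ux) w" "cf (ux * ux) (Y # w) = 0" for w
    by (simp_all add: u0)
  have "cf (ux * ux) (replicate n X @ W v) = real (Suc n) * cf 1 v" for n
  proof (induction n)
    case 0
    show ?case using h by (cases v) (auto simp: uu u0)
  next
    case (Suc n)
    then show ?case by (simp add: uu u1 algebra_simps)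
  qed
  then show "cf del1 (k # v) = real (Suc k) * cf 1 v" by (simp add: del1_def mult.assoc)
  show "cf del1 [] = 0" by (simp add: del1_def)
qed

text \<open>The Leibniz rule, from differentiating the group-like property of \<open>gs s\<close> at
  s = 1.\<close>

lemma Del_del1: "Del del1 = Cst del1 * Rr kg + Cst kg * Rr del1"
proof -
  have "Qs (cf del1) us ws = cf del1 us * cf kg ws + cf kg us * cf del1 ws" for us ws
  proof (cases us; cases ws)
    fix a us' b ws' assume *: "us = a # us'" "ws = b # ws'"
    show ?thesis unfolding * Qs_simps(3) cf_del1 Qs_mult Qs_one kg_gs
      by (simp add: cf_one)
  qed (simp_all add: cf_del1 kg_gs)
  then show ?thesis by (simp add: ser_eq_iff cf_Cst_mult mult.commute add.commute)
qed

lemma Del_kgi: "Del kgi = Cst kgi * Rr kgi"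
proof -
  have g: "kgi * kg = 1" "kg * kgi = 1"
    unfolding kgi_def kg_def by (simp_all add: kap_mult[symmetric] gi_inv)
  have "Del kgi * Del kg = 1" unfolding Del_mult[symmetric] g by (rule Del_1)
  then have a: "Del kgi * (Cst kg * Rr kg) = 1" unfolding kg_gs Del_gs .
  have "(Cst kg * Rr kg) * (Cst kgi * Rr kgi) = Cst kg * (Rr kg * Cst kgi) * Rr kgi" by (simp only: mult.assoc)
  also have "\<dots> = Cst (kg * kgi) * Rr (kg * kgi)" by (simp add: Rr_Cst Cst_mult Rr_mult mult.assoc)
  finally have b: "(Cst kg * Rr kg) * (Cst kgi * Rr kgi) = 1" by (simp add: g)
  have "Del kgi = Del kgi * ((Cst kg * Rr kg) * (Cst kgi * Rr kgi))" by (simp only: b mult_1_right)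
  also have "\<dots> = Cst kgi * Rr kgi" by (simp only: mult.assoc[symmetric] a[unfolded mult.assoc[symmetric]] mult_1_left)
  finally show ?thesis .
qed

text \<open>Conjugation by a group-like series preserves primitivity, and \<open>kgi * del1\<close>
  is the logarithmic derivative of a group-like curve, hence primitive.\<close>

theorem prim_onestep:
  assumes "prim (lam F)"
  shows "prim (lam (cf (onestep F)))"
proof -
  have g: "kgi * kg = 1" unfolding kgi_def kg_def by (simp add: kap_mult[symmetric] gi_inv)
  define t where "t = TH (lam F)"
  have t: "Del t = Cst t + Rr t" using prim_TH[OF assms] by (simp add: prim_def t_def)
  have C: "Cst a * Rr b * (Cst c * Rr d) = Cst (a * c) * Rr (b * d)" for a b c d :: "(nat, real) ser"
  proof -
    have "Cst a * Rr b * (Cst c * Rr d) = Cst a * (Rr b * Cst c) * Rr d" by (simp only: mult.assoc)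
    then show ?thesis by (simp add: Rr_Cst Cst_mult Rr_mult mult.assoc)
  qed
  have t1: "Del t = Cst t * Rr 1 + Cst 1 * Rr t" by (simp add: t)
  have "Del (kgi * t * kg) = (Cst kgi * Rr kgi) * (Cst t * Rr 1 + Cst 1 * Rr t) * (Cst kg * Rr kg)"
    unfolding Del_mult Del_kgi t1[symmetric] by (simp add: kg_gs Del_gs)
  also have "\<dots> = Cst (kgi * t * kg) * Rr (kgi * kg) + Cst (kgi * kg) * Rr (kgi * t * kg)"
    unfolding distrib_left distrib_right C by (simp add: mult.assoc)
  finally have 1: "Del (kgi * t * kg) = Cst (kgi * t * kg) + Rr (kgi * t * kg)" by (simp add: g)
  have "Del (kgi * del1) = (Cst kgi * Rr kgi) * (Cst del1 * Rr kg + Cst kg * Rr del1)"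
    unfolding Del_mult Del_kgi Del_del1 by (rule refl)
  also have "\<dots> = Cst (kgi * del1) * Rr (kgi * kg) + Cst (kgi * kg) * Rr (kgi * del1)"
    unfolding distrib_left C by (rule refl)
  finally have 2: "Del (kgi * del1) = Cst (kgi * del1) + Rr (kgi * del1)" by (simp add: g)
  have sc: "Cst (c *\<^sub>R a) = c *\<^sub>R Cst a" "Rr (c *\<^sub>R a) = c *\<^sub>R Rr a" for c and a :: "(nat, real) ser"
    by (simp_all add: ser_eq_iff cf_Cst)
  show ?thesis
    unfolding prim_def lam_onestep t_def[symmetric] linear_diff[OF Del_linear] linear_scale[OF Del_linear] 1 2
    by (simp add: sc algebra_simps)
qed

section \<open>All coefficients of \<open>\<DD>\<close> vanish on the generators\<close>

lemma phiF_len: "(\<And>v. length v = length w \<Longrightarrow> f v = g v) \<Longrightarrow> phiF f w = phiF g w"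
proof (induction w arbitrary: f g)
  case (Cons a w)
  have "phiF (\<lambda>v. f (b # v)) w = phiF (\<lambda>v. g (b # v)) w" for b
    by (rule Cons.IH) (simp add: Cons.prems)
  then show ?case by (cases a) simp_all
qed simp

lemma phiF_0: "phiF (\<lambda>v. 0) w = 0"
proof (induction w)
  case (Cons a w) then show ?case by (cases a) simp_all
qed simp

lemma phiF_add: "phiF (\<lambda>v. f v + g v) w = phiF f w + phiF g w"
proof (induction w arbitrary: f g)
  case (Cons a w) then show ?case by (cases a) simp_all
qed simp

lemma lam_cong:
  assumes "\<And>m. length m + 2 = Suc (wt r) \<Longrightarrow> F (Y # m @ [X]) = G (Y # m @ [X])"
  shows "cf (lam F) r = cf (lam G) r"
proof (cases r)
  case (Cons k r')
  have "phiF (\<lambda>u. F (Y # u @ [X])) (replicate k X @ W r') = phiF (\<lambda>u. G (Y # u @ [X])) (replicate k X @ W r')"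
    by (rule phiF_len) (simp add: assms Cons wt_W)
  then show ?thesis by (simp add: lam_def Cons)
qed (simp add: lam_def)

lemma W_ix: "h0 u \<Longrightarrow> W (ix u) = u"
  unfolding ix_def using W_surj[of u] by (rule someI_ex) (auto simp: h0_def)

lemma fin0_ix: "h0 u \<Longrightarrow> fin0 (ix u)"
  using h0_W[of "ix u"] W_ix by simp

lemma h0_YX: "h0 (Y # m @ [X])" by (simp add: h0_def)

lemma fin0_no0: "0 \<notin> set ws \<Longrightarrow> fin0 ws"
  using last_in_set by (fastforce simp: fin0_def)

lemma ract_cong:
  assumes "0 \<notin> set ws" "h0 u" "\<And>w. h0 w \<Longrightarrow> length w = length u + wt ws \<Longrightarrow> F w = G w"
  shows "ract F ws u = ract G ws u"
  unfolding ract_def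
proof (rule Qs_cong)
  fix r assume r: "r \<in> set (qsh (ix u) ws)"
  have "fin0 r" by (rule qsh_fin0[OF fin0_ix[OF assms(2)] fin0_no0[OF assms(1)] r])
  moreover have "length (W r) = length u + wt ws"
    using wt_qsh[OF r] wt_W[of "ix u"] W_ix[OF assms(2)] by (simp add: wt_W)
  ultimately show "F (W r) = G (W r)" by (intro assms(3)) (simp_all add: h0_W)
qed

lemma lam_ract_cong:
  assumes "0 \<notin> set ws" "\<And>w. h0 w \<Longrightarrow> length w = Suc (wt r) + wt ws \<Longrightarrow> F w = G w"
  shows "cf (lam (ract F ws)) r = cf (lam (ract G ws)) r"
  by (rule lam_cong, rule ract_cong[OF assms(1) h0_YX]) (simp add: assms(2))

lemma lam_ract_zero:
  assumes "0 \<notin> set ws" "\<And>m. F (Y # m @ [X]) = 0"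
  shows "lam (ract F ws) = 0"
proof (rule ser_eqI)
  fix r
  have "cf (lam (ract F ws)) r = cf (lam (ract (\<lambda>w. 0) ws)) r"
    by (rule lam_ract_cong[OF assms(1)]) (use assms(2) in \<open>auto simp: h0_iff\<close>)
  also have "\<dots> = 0" by (simp add: lam_def ract_def Qs_def phiF_0)
  finally show "cf (lam (ract F ws)) r = cf 0 r" by simp
qed

lemma Qs_cf_0 [simp]: "Qs (cf 0) us ws = 0"
proof -
  have "cf 0 = (\<lambda>v :: nat list. 0 :: real)" by (simp add: fun_eq_iff)
  then show ?thesis by (simp add: Qs_def)
qed

lemma lam_ract_Nil: "lam (ract F []) = lam F"
  by (rule ser_eqI, rule lam_cong) (simp add: ract_def W_ix h0_YX)

lemma prim_0: "prim 0"
  by (simp add: prim_def linear_0[OF Del_linear])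

lemma prim_add: "prim f \<Longrightarrow> prim g \<Longrightarrow> prim (f + g)"
  by (simp add: prim_def linear_add[OF Del_linear])

text \<open>By \<open>onestep_ract\<close> the functional for \<open>w' @ [j]\<close> involves those
  for \<open>w' @ [j]\<close> and for \<open>w'\<close>, which is why the hypothesis ranges over all
  ws.\<close>

lemma prim_ract_onestep:
  assumes "\<And>ws. 0 \<notin> set ws \<Longrightarrow> prim (lam (ract G ws))" "0 \<notin> set ws"
  shows "prim (lam (ract (cf (onestep G)) ws))"
proof (cases ws rule: rev_cases)
  case Nil
  have "prim (lam G)" using assms(1)[of "[]"] by (simp add: lam_ract_Nil)
  then show ?thesis using prim_onestep by (simp add: Nil lam_ract_Nil)
next
  case (snoc w' j)
  then have w': "0 \<notin> set (w' @ [j])" "0 \<notin> set w'" using assms(2) by auto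
  have "lam (ract (cf (onestep G)) (w' @ [j]))
      = lam (cf (onestep (ract G (w' @ [j])))) + lam (cf (onestep (ract G w')))"
  proof (rule ser_eqI)
    fix r
    have "cf (lam (ract (cf (onestep G)) (w' @ [j]))) r
       = cf (lam (\<lambda>u. cf (onestep (ract G (w' @ [j]))) u + cf (onestep (ract G w')) u)) r"
    proof (rule lam_cong)
      fix m
      let ?u = "Y # m @ [X]"
      show "ract (cf (onestep G)) (w' @ [j]) ?u
          = cf (onestep (ract G (w' @ [j]))) ?u + cf (onestep (ract G w')) ?u"
        using onestep_ract[OF fin0_ix[OF h0_YX] w'(1), of G m] by (simp add: ract_def W_ix h0_YX)
    qed
    also have "\<dots> = cf (lam (cf (onestep (ract G (w' @ [j])))) + lam (cf (onestep (ract G w')))) r"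
      by (simp add: lam_def phiF_add)
    finally show "cf (lam (ract (cf (onestep G)) (w' @ [j]))) r
      = cf (lam (cf (onestep (ract G (w' @ [j])))) + lam (cf (onestep (ract G w')))) r" .
  qed
  then show ?thesis unfolding snoc
    using prim_add[OF prim_onestep[OF assms(1)[OF w'(1)]] prim_onestep[OF assms(1)[OF w'(2)]]] by simp
qed

text \<open>On H^0, \<open>Fv (v @ [k])\<close> is the homogeneous part of
  \<open>onestep (Fv v)\<close> in weight \<open>wt v + Suc k\<close>, and each test for primitivity
  involves a single weight.\<close>

theorem prim_Fv: "0 \<notin> set ws \<Longrightarrow> prim (lam (ract (Fv v) ws))"
proof (induction v arbitrary: ws rule: rev_induct)
  case Nil
  \<comment> \<open>The empty v picks out constant terms, and \<DD> of a nonempty index has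
    none.\<close>
  have "Fv [] (Y # m @ [X]) = 0" for m
  proof -
    obtain c where c: "valid c" "wei c = Y # m @ [X]" using wei_surj[OF h0_YX] by blast
    then have "c \<noteq> []" by auto
    then show ?thesis using c Fv_wei[OF c(1), of "[]"] by (simp add: Phi_def Dco_Nil)
  qed
  then show ?case using lam_ract_zero[OF Nil] prim_0 by metis
next
  case (snoc k v)
  let ?H = "cf (onestep (Fv v))"
  have H: "prim (lam (ract ?H ws))"
    by (rule prim_ract_onestep[OF snoc.IH snoc.prems])
  have *: "(length w = wt v + Suc k \<longrightarrow> Fv (v @ [k]) w = ?H w) \<and> (length w \<noteq> wt v + Suc k \<longrightarrow> Fv (v @ [k]) w = 0)"
    if h: "h0 w" for w
  proof -
    obtain c where c: "valid c" "wei c = w" using wei_surj[OF h] by blast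
    have "Fv (v @ [k]) w = Phi (v @ [k]) c" "?H w = Psi v c" "length w = sum_list c"
      using Fv_wei[OF c(1)] onestep_Psi[OF c(1)] sum_list_wei[OF c(1)] c(2) by auto
    then show ?thesis using Phi_hom[OF c(1), of "v @ [k]"] by (auto simp: Psi_def)
  qed
  show ?case
    unfolding prim_lam
  proof (intro allI impI)
    fix us1 us2 :: "nat list" assume ne: "us1 \<noteq> []" "us2 \<noteq> []"
    \<comment> \<open>The length of every word evaluated in this test; the \<open>Suc\<close>
      accounts for the x appended after applying \<phi>.\<close>
    let ?M = "Suc (wt us1 + wt us2) + wt ws"
    have "Qs (cf (lam (ract (Fv (v @ [k])) ws))) us1 us2
        = Qs (cf (lam (ract (if ?M = wt v + Suc k then ?H else (\<lambda>w. 0)) ws))) us1 us2"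
    proof (rule Qs_cong, rule lam_ract_cong[OF snoc.prems])
      fix r w assume r: "r \<in> set (qsh us1 us2)" and w: "h0 w" "length w = Suc (wt r) + wt ws"
      have "length w = ?M" using wt_qsh[OF r] w(2) by simp
      then show "Fv (v @ [k]) w = (if ?M = wt v + Suc k then ?H else (\<lambda>w. 0)) w"
        using *[OF w(1)] by simp
    qed
    also have "\<dots> = 0"
    proof (cases "?M = wt v + Suc k")
      case True
      then show ?thesis using H ne unfolding prim_lam by simp
    next
      case False
      have "lam (ract (\<lambda>w. 0) ws) = 0" by (rule lam_ract_zero[OF snoc.prems]) simp
      then show ?thesis using False by simp
    qed
    finally show "Qs (cf (lam (ract (Fv (v @ [k])) ws))) us1 us2 = 0" .
  qed
qed

subsection \<open>Pairing functionals with polynomials\<close>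

definition pair :: "(word \<Rightarrow> real) \<Rightarrow> hpoly \<Rightarrow> real" where
  "pair f p = (\<Sum>w\<in>Poly_Mapping.keys p. of_rat (Poly_Mapping.lookup p w) * f w)"

lemma pair_superset:
  assumes "finite K" "Poly_Mapping.keys p \<subseteq> K"
  shows "pair f p = (\<Sum>w\<in>K. of_rat (Poly_Mapping.lookup p w) * f w)"
  unfolding pair_def by (rule sum.mono_neutral_left) (use assms in \<open>auto simp: in_keys_iff\<close>)

lemma pair_add: "pair f (p + q) = pair f p + pair f q"
proof -
  let ?K = "Poly_Mapping.keys p \<union> Poly_Mapping.keys q"
  have "Poly_Mapping.keys (p + q) \<subseteq> ?K" by (rule Poly_Mapping.keys_add)
  then show ?thesis
    by (simp add: pair_superset[of ?K] lookup_add of_rat_add distrib_right sum.distrib)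
qed

lemma pair_uminus: "pair f (- p) = - pair f p"
  using pair_add[of f p "- p"] by (simp add: pair_def)

lemma pair_smult: "pair f (Defs.smult c p) = of_rat c * pair f p"
proof -
  have "Poly_Mapping.keys (Defs.smult c p) \<subseteq> Poly_Mapping.keys p" by (auto simp: in_keys_iff)
  then have "pair f (Defs.smult c p) = (\<Sum>w\<in>Poly_Mapping.keys p. of_rat (Poly_Mapping.lookup (Defs.smult c p) w) * f w)"
    by (intro pair_superset) simp_all
  then show ?thesis by (simp add: pair_def of_rat_mult sum_distrib_left mult.assoc)
qed

lemma pair_0: "pair f 0 = 0" by (simp add: pair_def)

lemma pair_sum: "pair f (sum g A) = (\<Sum>a\<in>A. pair f (g a))"
  by (induction A rule: infinite_finite_induct) (simp_all add: pair_0 pair_add)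

lemma pair_wmon: "pair f (wmon u) = f u"
  by (simp add: pair_def lookup_wmon)

lemma pair_zero_fun: "(\<And>w. w \<in> Poly_Mapping.keys p \<Longrightarrow> f w = 0) \<Longrightarrow> pair f p = 0"
  by (simp add: pair_def)

lemma pair_cong: "(\<And>w. w \<in> Poly_Mapping.keys p \<Longrightarrow> f w = g w) \<Longrightarrow> pair f p = pair g p"
  by (simp add: pair_def)

lemma pair_lin: "pair f (lin g p) = pair (\<lambda>w. pair f (g w)) p"
  by (simp add: lin_def pair_sum pair_smult, simp add: pair_def)

lemma pair_lin2: "pair f (lin2 g p q) = pair (\<lambda>u. pair (\<lambda>v. pair f (g u v)) q) p"
  by (simp add: lin2_def pair_sum pair_smult of_rat_mult mult.assoc sum_distrib_left[symmetric], simp add: pair_def)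

lemma pair_cat: "pair f (cat p q) = pair (\<lambda>u. pair (\<lambda>v. f (u @ v)) q) p"
  by (simp add: cat_def pair_lin2 pair_wmon)

lemma pair_swap: "pair (\<lambda>u. pair (\<lambda>v. h u v) q) p = pair (\<lambda>v. pair (\<lambda>u. h u v) p) q"
  unfolding pair_def sum_distrib_left
  by (subst sum.swap) (simp add: algebra_simps)

lemma pair_phi_word: "pair f (phi_word w) = phiF f w"
proof (induction w arbitrary: f)
  case (Cons a w)
  show ?case by (cases a) (simp_all add: pair_cat pair_add pair_uminus pair_wmon Cons)
qed (simp add: pair_wmon)

lemma pair_phi: "pair f (phi p) = pair (phiF f) p"
  by (simp add: phi_def pair_lin pair_phi_word)

lemma lookup_pair: "of_rat (Poly_Mapping.lookup p w0) = pair (\<lambda>w. if w = w0 then 1 else 0) p"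
proof -
  have "pair (\<lambda>w. if w = w0 then 1 else 0) p
      = (\<Sum>w\<in>Poly_Mapping.keys p. if w = w0 then of_rat (Poly_Mapping.lookup p w0) else 0)"
    unfolding pair_def by (intro sum.cong refl) auto
  then show ?thesis by (simp add: sum.delta in_keys_iff)
qed

lemma pair_harr: "pair f (harr (map Suc us) (map Suc ws)) = Qs (\<lambda>r. f (W (rev r))) us ws"
proof (induction us ws arbitrary: f rule: qsh.induct)
  case (1 ws)
  then show ?case by (simp add: pair_wmon rev_map word_of_index_Suc)
next
  case (2 a us)
  have "rev (map Suc us) @ [Suc a] = map Suc (rev us @ [a])" by (simp add: rev_map)
  then show ?case by (simp add: pair_wmon word_of_index_Suc del: map_append)
next
  case (3 a us b ws)
  have e: "e (Suc k) = W [k]" for k by (simp add: e_def)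
  have s: "Suc a + Suc b = Suc (Suc (a + b))" by simp
  show ?case
    using 3 unfolding list.map(2) harr.simps(3) pair_add pair_cat pair_wmon e s
    by simp
qed

lemma Qs_snoc1: "Qs f [a] (ws @ [b]) = f (ws @ [b, a]) + Qs (\<lambda>r. f (r @ [b])) [a] ws + f (ws @ [Suc (a + b)])"
  by (induction ws arbitrary: f) simp_all

lemma Qs_snoc2: "Qs f (us @ [a]) [b] = Qs (\<lambda>r. f (r @ [a])) us [b] + f (us @ [a, b]) + f (us @ [Suc (a + b)])"
  by (induction us arbitrary: f) simp_all

text \<open>The recursion at the last letters, in the form used by \<open>harr\<close>; it makes the
  left and right quasi-shuffles agree.\<close>

lemma Qs_snoc: "Qs f (us @ [a]) (ws @ [b]) = Qs (\<lambda>r. f (r @ [a])) us (ws @ [b])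
    + Qs (\<lambda>r. f (r @ [b])) (us @ [a]) ws + Qs (\<lambda>r. f (r @ [Suc (a + b)])) us ws"
proof (induction us ws arbitrary: f rule: qsh.induct)
  case (1 ws) then show ?case by (simp add: Qs_snoc1)
next
  case (2 c us) then show ?case using Qs_snoc2[of f "c # us" a b] by simp
next
  case (3 c us d ws)
  have "Qs f ((c # us) @ [a]) ((d # ws) @ [b]) = Qs (\<lambda>v. f (c # v)) (us @ [a]) ((d # ws) @ [b])
    + Qs (\<lambda>v. f (d # v)) ((c # us) @ [a]) (ws @ [b]) + Qs (\<lambda>v. f (Suc (c + d) # v)) (us @ [a]) (ws @ [b])"
    by simp
  then show ?case unfolding "3.IH" by simp
qed

lemma Qs_rev: "Qs (\<lambda>r. f (rev r)) us ws = Qs f (rev us) (rev ws)"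
proof (induction us ws arbitrary: f rule: qsh.induct)
  case (3 a us b ws)
  have "(\<lambda>r. f (rev r @ [c])) = (\<lambda>r. (\<lambda>z. f (z @ [c])) (rev r))" for c by simp
  then show ?case using "3.IH"(1)[of "\<lambda>z. f (z @ [a])"] "3.IH"(2)[of "\<lambda>z. f (z @ [b])"] "3.IH"(3)[of "\<lambda>z. f (z @ [Suc (a + b)])"]
    by (simp add: Qs_snoc)
qed simp_all

lemma index_of_W: "index_of (W ks) = map Suc ks"
  unfolding index_of_def
proof (rule the_equality)
  show "(\<forall>k\<in>set (map Suc ks). 0 < k) \<and> word_of_index (map Suc ks) = W ks"
    by (simp add: word_of_index_Suc)
next
  fix js assume js: "(\<forall>k\<in>set js. 0 < k) \<and> word_of_index js = W ks"
  then have m: "map Suc (map (\<lambda>k. k - 1) js) = js" by (intro nth_equalityI) auto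
  then have "W (map (\<lambda>k. k - 1) js) = W ks" using js word_of_index_Suc by metis
  then show "js = map Suc ks" using W_inj m by metis
qed

lemma pair_harr_W: "pair f (harr (rev (index_of (W us))) (rev (index_of (W ws)))) = Qs (\<lambda>r. f (W r)) us ws"
proof -
  have "pair f (harr (rev (index_of (W us))) (rev (index_of (W ws))))
      = Qs (\<lambda>r. f (W (rev r))) (rev us) (rev ws)"
    unfolding index_of_W rev_map by (rule pair_harr)
  also have "\<dots> = Qs (\<lambda>r. f (W r)) us ws"
    using Qs_rev[of "\<lambda>r. f (W r)" "rev us" "rev ws"] by simp
  finally show ?thesis .
qed

text \<open>Transposing the product with w_3, the factor x, \<phi> and the inner product in turn
  reduces the pairing to values of \<open>lam (ract f ws)\<close> on quasi-shuffles of nonempty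
  words.\<close>

lemma pair_generator:
  assumes "in_yH w1" "in_yH w2" "in_Hge2 w3"
    and f: "\<And>us1 us2 ws. us1 \<noteq> [] \<Longrightarrow> us2 \<noteq> [] \<Longrightarrow> 0 \<notin> set ws \<Longrightarrow> Qs (cf (lam (ract f ws))) us1 us2 = 0"
  shows "pair f (hstar (cat (phi (hstar w1 w2)) (wmon [X])) w3) = 0"
proof -
  let ?p = "cat (phi (hstar w1 w2)) (wmon [X])"
  let ?K = "\<lambda>v u. pair f (harr (rev (index_of u)) (rev (index_of v)))"
  have "pair f (hstar ?p w3) = pair (\<lambda>v. pair (?K v) ?p) w3"
    by (simp add: hstar_def pair_lin2 pair_swap[of _ w3])
  also have "\<dots> = 0"
  proof (rule pair_zero_fun)
    fix v assume v: "v \<in> Poly_Mapping.keys w3"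
    then obtain ks where ks: "\<forall>k\<in>set ks. k \<ge> 2" "v = word_of_index ks"
      using assms(3) by (auto simp: in_Hge2_def ge2_word_def)
    define ws where "ws = map (\<lambda>k. k - 1) ks"
    have "map Suc ws = ks" unfolding ws_def map_map by (rule map_idI) (use ks(1) in force)
    then have vw: "v = W ws" using ks(2) word_of_index_Suc by metis
    have w0: "0 \<notin> set ws" using ks(1) by (auto simp: ws_def)
    have "pair (?K v) ?p = pair (phiF (\<lambda>u. ?K v (u @ [X]))) (hstar w1 w2)"
      by (simp add: pair_cat pair_wmon pair_phi)
    also have "\<dots> = pair (\<lambda>u1. pair (\<lambda>u2. pair (phiF (\<lambda>u. ?K v (u @ [X]))) (harr (rev (index_of u1)) (rev (index_of u2)))) w2) w1"
      by (simp add: hstar_def pair_lin2)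
    also have "\<dots> = 0"
    proof (rule pair_zero_fun, rule pair_zero_fun)
      fix u1 u2 assume u: "u1 \<in> Poly_Mapping.keys w1" "u2 \<in> Poly_Mapping.keys w2"
      then have "hd u1 = Y" "u1 \<noteq> []" "hd u2 = Y" "u2 \<noteq> []" using assms(1,2) by (auto simp: in_yH_def)
      then obtain us1 us2 where us: "u1 = W us1" "u2 = W us2" "us1 \<noteq> []" "us2 \<noteq> []"
        using W_surj[of u1] W_surj[of u2] by (metis W_simps(1))
      have "pair (phiF (\<lambda>u. ?K v (u @ [X]))) (harr (rev (index_of u1)) (rev (index_of u2)))
          = Qs (\<lambda>r. phiF (\<lambda>u. ?K v (u @ [X])) (W r)) us1 us2"
        unfolding us by (rule pair_harr_W)
      also have "\<dots> = Qs (cf (lam (ract f ws))) us1 us2"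
      proof (rule Qs_cong)
        fix r assume "r \<in> set (qsh us1 us2)"
        then have "r \<noteq> []" using qsh_ne us by blast
        then obtain k r' where r: "r = k # r'" by (cases r) auto
        have "?K v (Y # m @ [X]) = ract f ws (Y # m @ [X])" for m
          using pair_harr_W[of f "ix (Y # m @ [X])" ws] by (simp add: ract_def vw W_ix h0_YX)
        then show "phiF (\<lambda>u. ?K v (u @ [X])) (W r) = cf (lam (ract f ws)) r"
          by (simp add: lam_def r)
      qed
      also have "\<dots> = 0" by (rule f[OF us(3,4) w0])
      finally show "pair (phiF (\<lambda>u. ?K v (u @ [X]))) (harr (rev (index_of u1)) (rev (index_of u2))) = 0" .
    qed
    finally show "pair (?K v) ?p = 0" .
  qed
  finally show ?thesis .
qed

text \<open>Both parts use \<open>pair_generator\<close>: indicator functionals of words outside yHx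
  show that g lies in yHx, and the functionals \<open>Fv v\<close> show that \<DD> vanishes on
  it.\<close>

lemma generator_Drop1:
  assumes "in_yH w1" "in_yH w2" "in_Hge2 w3"
  defines "g \<equiv> hstar (cat (phi (hstar w1 w2)) (wmon [X])) w3"
  shows "in_yHx g" "calD g = 0"
proof -
  have key: "\<exists>m. w = Y # m @ [X]" if "w \<in> Poly_Mapping.keys g" for w
  proof (rule ccontr)
    assume n: "\<not> (\<exists>m. w = Y # m @ [X])"
    have "of_rat (Poly_Mapping.lookup g w) = pair (\<lambda>u. if u = w then 1 else 0) g" by (rule lookup_pair)
    also have "\<dots> = 0"
      unfolding g_def
    proof (rule pair_generator[OF assms(1-3)])
      fix us1 us2 ws :: "nat list" assume "0 \<notin> set ws"
      then have "lam (ract (\<lambda>u. if u = w then 1 else 0) ws) = 0"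
        by (rule lam_ract_zero) (use n in auto)
      then show "Qs (cf (lam (ract (\<lambda>u. if u = w then 1 else 0) ws))) us1 us2 = 0" by simp
    qed
    finally show False using that by (simp add: in_keys_iff)
  qed
  then show "in_yHx g" by (simp add: in_yHx_def)
  show "calD g = 0"
  proof (rule poly_mapping_eqI)
    fix w0
    have k: "valid (even_index_of w) \<and> Dco (even_index_of w) (W v) = Fv v w" if "w \<in> Poly_Mapping.keys g" for w v
    proof -
      have h: "h0 w" using key[OF that] h0_YX by blast
      then obtain c where "valid c" "wei c = w" using wei_surj by blast
      then show ?thesis using h even_index_of_wei by (auto simp: Fv_def)
    qed
    have "of_rat (Poly_Mapping.lookup (calD g) w0) = pair (\<lambda>w. Dco (even_index_of w) w0) g"
      unfolding calD_def Dco_def by (simp only: lookup_pair pair_lin)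
    also have "\<dots> = 0"
    proof (cases "w0 = [] \<or> hd w0 = Y")
      case True
      then obtain v where v: "W v = w0" using W_surj by blast
      have "pair (\<lambda>w. Dco (even_index_of w) w0) g = pair (Fv v) g"
        by (rule pair_cong) (use k v in auto)
      also have "\<dots> = 0"
        unfolding g_def
        by (rule pair_generator[OF assms(1-3)]) (use prim_Fv prim_lam in blast)
      finally show ?thesis .
    next
      case False
      then obtain u where "w0 = X # u" by (cases w0) (auto, metis letter.exhaust)
      then show ?thesis using k Dco_X by (intro pair_zero_fun) blast
    qed
    finally show "Poly_Mapping.lookup (calD g) w0 = Poly_Mapping.lookup 0 w0" by simp
  qed
qed

lemma qspan_mono: "A \<subseteq> B \<Longrightarrow> qspan A \<subseteq> qspan B"
  unfolding qspan_def by blast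

theorem mainTheorem5:
  shows "LinKaw \<subseteq> Drop1"
  unfolding LinKaw_def Drop1_def
proof (rule qspan_mono, safe)
  fix w1 w2 w3 assume "in_yH w1" "in_yH w2" "in_Hge2 w3"
  note * = generator_Drop1[OF this]
  \<comment> \<open>As \<DD> vanishes on the generator, the generator is its own witness.\<close>
  show "\<exists>w. hstar (cat (phi (hstar w1 w2)) (wmon [X])) w3 = w - calD w \<and> in_yHx w"
    by (rule exI[of _ "hstar (cat (phi (hstar w1 w2)) (wmon [X])) w3"]) (simp add: *)
qed

end
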